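(* Let $(\mathcal{D})$ be any combination (i.e. conjunction of any subcollection) of the following seven group properties: being torsion-free; being locally indicable; being amenable; being elementary amenable; being subexponentially amenable; being right orderable; being orderable. Then every countable group with Property $(\mathcal{D})$ embeds in a countable perfect group with Property $(\mathcal{D})$.
   Context: Groups are discrete. A group is perfect if it equals its commutator subgroup. A group is indicable if it has an infinite cyclic quotient, and locally indicable if all its non-trivial finitely generated subgroups are indicable. A group $G$ is amenable if it has a left-invariant finitely additive probability measure defined on all subsets of $G$. The class $EG$ of elementary amenable groups is the smallest class of groups containing all finite groups and all abelian groups and closed under (i) taking subgroups, (ii) taking quotients, (iii) extensions, (iv) direct limits. The class $SG$ of subexponentially amenable groups is the smallest class of groups containing all finitely generated groups of subexponential growth and closed under (i)-(iv). A group is orderable if it has a linear (total) order invariant under both left and right multiplication, and right orderable if it has a linear order invariant under right multiplication. *)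

theory Defs
  imports Complex_Main "HOL-Library.Countable_Set" "HOL-Algebra.Algebra"
begin

definition perfect_group :: "'a monoid \<Rightarrow> bool" where
  "perfect_group G \<longleftrightarrow> group G \<and> derived G (carrier G) = carrier G"

definition finitely_generated_group :: "'a monoid \<Rightarrow> bool" where
  "finitely_generated_group G \<longleftrightarrow>
     group G \<and> (\<exists>S. finite S \<and> S \<subseteq> carrier G \<and> generate G S = carrier G)"

definition torsion_free_group :: "'a monoid \<Rightarrow> bool" where
  "torsion_free_group G \<longleftrightarrow>
     group G \<and> (\<forall>x\<in>carrier G. \<forall>n::nat. n > 0 \<and> x [^]\<^bsub>G\<^esub> n = \<one>\<^bsub>G\<^esub> \<longrightarrow> x = \<one>\<^bsub>G\<^esub>)"

definition indicable :: "'a monoid \<Rightarrow> bool" where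
  "indicable G \<longleftrightarrow> group G \<and> (\<exists>N. N \<lhd> G \<and> G Mod N \<cong> integer_group)"

definition locally_indicable :: "'a monoid \<Rightarrow> bool" where
  "locally_indicable G \<longleftrightarrow>
     group G \<and>
     (\<forall>K. subgroup K G \<and> K \<noteq> {\<one>\<^bsub>G\<^esub>} \<and> finitely_generated_group (G\<lparr>carrier := K\<rparr>)
          \<longrightarrow> indicable (G\<lparr>carrier := K\<rparr>))"

definition amenable :: "'a monoid \<Rightarrow> bool" where
  "amenable G \<longleftrightarrow>
     group G \<and>
     (\<exists>\<mu> :: 'a set \<Rightarrow> real.
        (\<forall>A. A \<subseteq> carrier G \<longrightarrow> \<mu> A \<ge> 0) \<and>
        \<mu> (carrier G) = 1 \<and>
        (\<forall>A B. A \<subseteq> carrier G \<and> B \<subseteq> carrier G \<and> A \<inter> B = {} \<longrightarrow> \<mu> (A \<union> B) = \<mu> A + \<mu> B) \<and>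
        (\<forall>g\<in>carrier G. \<forall>A. A \<subseteq> carrier G \<longrightarrow> \<mu> (g <#\<^bsub>G\<^esub> A) = \<mu> A))"

definition right_orderable :: "'a monoid \<Rightarrow> bool" where
  "right_orderable G \<longleftrightarrow>
     group G \<and>
     (\<exists>r. linear_order_on (carrier G) r \<and>
        (\<forall>x\<in>carrier G. \<forall>y\<in>carrier G. \<forall>z\<in>carrier G.
           (x, y) \<in> r \<longrightarrow> (x \<otimes>\<^bsub>G\<^esub> z, y \<otimes>\<^bsub>G\<^esub> z) \<in> r))"

definition orderable :: "'a monoid \<Rightarrow> bool" where
  "orderable G \<longleftrightarrow>
     group G \<and>
     (\<exists>r. linear_order_on (carrier G) r \<and>
        (\<forall>x\<in>carrier G. \<forall>y\<in>carrier G. \<forall>z\<in>carrier G.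
           (x, y) \<in> r \<longrightarrow>
             (x \<otimes>\<^bsub>G\<^esub> z, y \<otimes>\<^bsub>G\<^esub> z) \<in> r \<and> (z \<otimes>\<^bsub>G\<^esub> x, z \<otimes>\<^bsub>G\<^esub> y) \<in> r))"

text \<open>
  The elements of word length at most n with respect to S. Since the unit is added to the
  alphabet, products of exactly n letters give all words of length at most n.
\<close>

fun word_ball :: "'a monoid \<Rightarrow> 'a set \<Rightarrow> nat \<Rightarrow> 'a set" where
  "word_ball G S 0 = {\<one>\<^bsub>G\<^esub>}"
| "word_ball G S (Suc n) =
     word_ball G S n <#>\<^bsub>G\<^esub> insert \<one>\<^bsub>G\<^esub> (S \<union> set_inv\<^bsub>G\<^esub> S)"

text \<open>
  The growth rate is the limit of the n-th roots of the ball sizes. Whether it equals 1 does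
  not depend on the finite generating set.
\<close>

definition fg_subexponential_growth :: "'a monoid \<Rightarrow> bool" where
  "fg_subexponential_growth G \<longleftrightarrow>
     group G \<and>
     (\<exists>S. finite S \<and> S \<subseteq> carrier G \<and> generate G S = carrier G \<and>
          (\<lambda>n. root n (real (card (word_ball G S n)))) \<longlonglongrightarrow> 1)"

definition directed_system ::
  "'i set \<Rightarrow> 'i rel \<Rightarrow> ('i \<Rightarrow> 'a monoid) \<Rightarrow> ('i \<Rightarrow> 'i \<Rightarrow> 'a \<Rightarrow> 'a) \<Rightarrow> bool" where
  "directed_system I r Gs \<phi> \<longleftrightarrow>
     I \<noteq> {} \<and> preorder_on I r \<and>
     (\<forall>i\<in>I. \<forall>j\<in>I. \<exists>k\<in>I. (i, k) \<in> r \<and> (j, k) \<in> r) \<and>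
     (\<forall>i\<in>I. group (Gs i)) \<and>
     (\<forall>i j. (i, j) \<in> r \<longrightarrow> \<phi> i j \<in> hom (Gs i) (Gs j)) \<and>
     (\<forall>i\<in>I. \<forall>x\<in>carrier (Gs i). \<phi> i i x = x) \<and>
     (\<forall>i j k. (i, j) \<in> r \<and> (j, k) \<in> r \<longrightarrow>
        (\<forall>x\<in>carrier (Gs i). \<phi> j k (\<phi> i j x) = \<phi> i k x))"

text \<open>
  The direct limit is the disjoint union of the groups of the system, modulo eventual equality.
\<close>

definition direct_limit_rel ::
  "'i set \<Rightarrow> 'i rel \<Rightarrow> ('i \<Rightarrow> 'a monoid) \<Rightarrow> ('i \<Rightarrow> 'i \<Rightarrow> 'a \<Rightarrow> 'a) \<Rightarrow> ('i \<times> 'a) rel" where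
  "direct_limit_rel I r Gs \<phi> =
     {((i, x), (j, y)). i \<in> I \<and> j \<in> I \<and> x \<in> carrier (Gs i) \<and> y \<in> carrier (Gs j) \<and>
        (\<exists>k\<in>I. (i, k) \<in> r \<and> (j, k) \<in> r \<and> \<phi> i k x = \<phi> j k y)}"

text \<open>
  The unions below are over representatives (and common upper bounds), as usual for operations
  on equivalence classes: all sets in a union are one and the same class.
\<close>

definition direct_limit ::
  "'i set \<Rightarrow> 'i rel \<Rightarrow> ('i \<Rightarrow> 'a monoid) \<Rightarrow> ('i \<Rightarrow> 'i \<Rightarrow> 'a \<Rightarrow> 'a) \<Rightarrow> ('i \<times> 'a) set monoid" where
  "direct_limit I r Gs \<phi> =
     \<lparr>carrier = (SIGMA i:I. carrier (Gs i)) // direct_limit_rel I r Gs \<phi>,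
      monoid.mult = (\<lambda>A B. \<Union>(i, x)\<in>A. \<Union>(j, y)\<in>B. \<Union>k\<in>{k \<in> I. (i, k) \<in> r \<and> (j, k) \<in> r}.
         direct_limit_rel I r Gs \<phi> `` {(k, \<phi> i k x \<otimes>\<^bsub>Gs k\<^esub> \<phi> j k y)}),
      one = (\<Union>i\<in>I. direct_limit_rel I r Gs \<phi> `` {(i, \<one>\<^bsub>Gs i\<^esub>)})\<rparr>"

text \<open>
  The smallest class of groups containing a base class and closed under subgroups, quotients,
  extensions and direct limits. HOL cannot quantify over types inside a definition, so all
  groups in a derivation (and the index sets of direct systems) live in the type \<open>'a\<close> of the
  elements of the group in question; quotients and direct limits, which the library or the
  definition above puts on another type, enter up to isomorphism. For the two base classes
  below this loses no member of the usual class with carrier in \<open>'a\<close>. If \<open>'a\<close> is finite, all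
  groups on it are finite and hence in the base class. If \<open>'a\<close> is infinite,
  one shows by induction on an unrestricted derivation that every subquotient
  of the group that has a copy on \<open>'a\<close> has a derivation on \<open>'a\<close>, because a group is the direct
  limit of its finitely generated subgroups, and these are indexed by finite subsets of \<open>'a\<close>.
\<close>

inductive elementary_closure :: "('a monoid \<Rightarrow> bool) \<Rightarrow> 'a monoid \<Rightarrow> bool"
  for \<B> :: "'a monoid \<Rightarrow> bool" where
  base: "group G \<Longrightarrow> \<B> G \<Longrightarrow> elementary_closure \<B> G"
| subgroup: "elementary_closure \<B> G \<Longrightarrow> subgroup K G \<Longrightarrow> elementary_closure \<B> (G\<lparr>carrier := K\<rparr>)"
| quotient: "elementary_closure \<B> G \<Longrightarrow> N \<lhd> G \<Longrightarrow> group Q \<Longrightarrow> Q \<cong> G Mod N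
    \<Longrightarrow> elementary_closure \<B> Q"
| extension: "group G \<Longrightarrow> N \<lhd> G \<Longrightarrow> elementary_closure \<B> (G\<lparr>carrier := N\<rparr>)
    \<Longrightarrow> elementary_closure \<B> Q \<Longrightarrow> Q \<cong> G Mod N \<Longrightarrow> elementary_closure \<B> G"
| direct_limit: "directed_system (I :: 'a set) r Gs \<phi> \<Longrightarrow> (\<And>i. i \<in> I \<Longrightarrow> elementary_closure \<B> (Gs i))
    \<Longrightarrow> group L \<Longrightarrow> L \<cong> direct_limit I r Gs \<phi> \<Longrightarrow> elementary_closure \<B> L"

definition elementary_amenable :: "'a monoid \<Rightarrow> bool" where
  "elementary_amenable = elementary_closure (\<lambda>G. finite (carrier G) \<or> comm_group G)"

definition subexponentially_amenable :: "'a monoid \<Rightarrow> bool" where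
  "subexponentially_amenable = elementary_closure fg_subexponential_growth"

datatype group_property =
  Torsion_Free | Locally_Indicable | Amenable | Elementary_Amenable
| Subexponentially_Amenable | Right_Orderable | Orderable

fun has_property :: "'a monoid \<Rightarrow> group_property \<Rightarrow> bool" where
  "has_property G Torsion_Free = torsion_free_group G"
| "has_property G Locally_Indicable = locally_indicable G"
| "has_property G Amenable = amenable G"
| "has_property G Elementary_Amenable = elementary_amenable G"
| "has_property G Subexponentially_Amenable = subexponentially_amenable G"
| "has_property G Right_Orderable = right_orderable G"
| "has_property G Orderable = orderable G"

end

theory Submission
  imports Defs
begin

text \<open>
  Let \<open>W(G)\<close> be the group of functions from the integers to \<open>G\<close> that are trivial near minus infinity
  and constant near plus infinity, extended by the translations. It is built from copies of \<open>G\<close> and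
  \<open>\<int>\<close> by extensions and increasing unions, and it can be ordered lexicographically if \<open>G\<close> is ordered;
  so it inherits each of the seven properties. Every element of \<open>G\<close>, placed at the coordinate \<open>0\<close>, is a
  commutator in \<open>W(G)\<close>. In the union of \<open>G \<subseteq> W(G) \<subseteq> W(W(G)) \<subseteq> \<dots>\<close> every element is therefore a
  commutator, and the seven properties pass to the union.
\<close>

section \<open>Homomorphisms and subgroups\<close>

text \<open>The tower is built without looking at the properties, so a conjunction is verified one
  property at a time. For \<open>W(G)\<close>, six of them need only isomorphism invariance,
  extensions, increasing unions and the group \<int>. Orderability is the exception: an extension of
  \<int> by \<int>, such as the Klein bottle group, need not be orderable. Constancy near plus
  infinity makes a point mass the quotient of a function by its translate, while it keeps
  \<open>W(G)\<close> countable and within two extensions of a union of finite powers of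
  \<open>G\<close>.

  The other obstacle is typing. \<open>G\<close> lives on an arbitrary type, \<open>W(G)\<close> on
  a larger one, and \<open>elementary_closure\<close> derives a group only from groups on the same
  type. Hence every group is replaced by a copy on the natural numbers. For elementary and
  subexponential amenability this is more than a renaming: a derivation may pass through uncountable
  groups and has to be rebuilt from countable ones.\<close>

lemma group_homI: "group G \<Longrightarrow> group H \<Longrightarrow> h \<in> hom G H \<Longrightarrow> group_hom G H h"
  by (simp add: group_hom_def group_hom_axioms_def)

lemma iso_subgroup_image:
  assumes "\<phi> \<in> iso G H" "K \<subseteq> carrier G"
  shows "\<phi> \<in> iso (G\<lparr>carrier := K\<rparr>) (H\<lparr>carrier := \<phi> ` K\<rparr>)"
  using assms by (auto simp: iso_def hom_def bij_betw_def inj_on_subset Pi_iff subset_iff)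

lemma mon_iso_image:
  assumes "h \<in> hom G H" "inj_on h (carrier G)"
  shows "h \<in> iso G (H\<lparr>carrier := h ` carrier G\<rparr>)"
  using assms by (auto simp: iso_def hom_def bij_betw_def)

lemma subgroup_hom_image:
  assumes "group G" "group H" "h \<in> hom G H" "subgroup K G"
  shows "subgroup (h ` K) H"
  using group_hom.subgroup_img_is_subgroup[OF group_homI[OF assms(1-3)] assms(4)] .

lemma subgroup_hom_kernel:
  assumes "group G" "group H" "h \<in> hom G H"
  shows "subgroup (kernel G H h) G"
  using group_hom.subgroup_kernel[OF group_homI[OF assms]] .

lemma hom_subgroup_restrict:
  assumes "h \<in> hom G H" "subgroup K G"
  shows "h \<in> hom (G\<lparr>carrier := K\<rparr>) (H\<lparr>carrier := h ` K\<rparr>)"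
  using assms by (auto simp: hom_def Pi_iff subgroup.mem_carrier)


section \<open>Copies of countable groups on the natural numbers\<close>

text \<open>Transport of structure along an enumeration; it is meaningful for a countable carrier,
  where \<open>d\<close> inverts \<open>e\<close>. The carrier is the image of \<open>e\<close> and
  not the whole type because \<open>G\<close> may be finite.\<close>

definition nat_copy :: "'a monoid \<Rightarrow> nat monoid" where
  "nat_copy G =
     (let e = to_nat_on (carrier G); d = from_nat_into (carrier G)
      in \<lparr>carrier = e ` carrier G, monoid.mult = (\<lambda>x y. e (d x \<otimes>\<^bsub>G\<^esub> d y)), one = e \<one>\<^bsub>G\<^esub>\<rparr>)"

lemma nat_copy_iso:
  assumes "group G" "countable (carrier G)"
  shows "to_nat_on (carrier G) \<in> iso G (nat_copy G)"
  using assms inj_on_to_nat_on[OF assms(2)]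
  by (auto simp: nat_copy_def Let_def iso_def hom_def bij_betw_def)

lemma nat_copy_group:
  assumes "group G" "countable (carrier G)"
  shows "group (nat_copy G)"
proof -
  interpret group G by fact
  \<comment> \<open>\<open>iso_imp_img_group\<close> resets the unit to the image of the unit, which
    \<open>nat_copy\<close> has as its unit already.\<close>
  have "group ((nat_copy G)\<lparr>one := to_nat_on (carrier G) \<one>\<^bsub>G\<^esub>\<rparr>)"
    by (rule iso_imp_img_group) (rule nat_copy_iso[OF assms])
  moreover have "(nat_copy G)\<lparr>one := to_nat_on (carrier G) \<one>\<^bsub>G\<^esub>\<rparr> = nat_copy G"
    by (simp add: nat_copy_def Let_def)
  ultimately show ?thesis by simp
qed

lemma nat_copy_is_iso:
  "group G \<Longrightarrow> countable (carrier G) \<Longrightarrow> G \<cong> nat_copy G"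
  by (rule is_isoI) (rule nat_copy_iso)

text \<open>A locale parameter \<open>P\<close> is fixed to one type. This extends it to countable
  groups on every type, so that closure properties assumed on the natural numbers can be applied to
  function groups, subgroups and direct limits.\<close>

definition has_copy :: "(nat monoid \<Rightarrow> bool) \<Rightarrow> 'a monoid \<Rightarrow> bool" where
  "has_copy P G \<longleftrightarrow> group G \<and> countable (carrier G) \<and> P (nat_copy G)"

lemma has_copyD:
  assumes "has_copy P G"
  shows "group G" "countable (carrier G)" "P (nat_copy G)"
  using assms by (auto simp: has_copy_def)

locale union_closed_class =
  fixes P :: "nat monoid \<Rightarrow> bool"
  assumes iso: "\<And>M N. \<lbrakk>group M; group N; M \<cong> N; P M\<rbrakk> \<Longrightarrow> P N"
    and union: "\<And>M K. \<lbrakk>group M; \<And>n. subgroup (K n) M; incseq K; (\<Union>n::nat. K n) = carrier M;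
      \<And>n. P (M\<lparr>carrier := K n\<rparr>)\<rbrakk> \<Longrightarrow> P M"
begin

lemma copy_nat: "group M \<Longrightarrow> has_copy P M \<longleftrightarrow> P M"
  unfolding has_copy_def using iso nat_copy_is_iso nat_copy_group group.iso_sym
  by (metis countableI_type)

lemma copy_iso:
  assumes "has_copy P G" "group H" "G \<cong> H"
  shows "has_copy P H"
proof -
  note G = has_copyD[OF assms(1)]
  obtain f where f: "f \<in> iso G H" using assms(3) by (auto simp: is_iso_def)
  then have "carrier H = f ` carrier G" by (auto simp: iso_def bij_betw_def)
  then have cH: "countable (carrier H)" using G(2) by simp
  have "nat_copy G \<cong> nat_copy H"
    by (rule iso_trans[OF iso_trans[OF group.iso_sym[OF G(1) nat_copy_is_iso[OF G(1,2)]] assms(3)]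
          nat_copy_is_iso[OF assms(2) cH]])
  then have "P (nat_copy H)"
    using iso[OF nat_copy_group[OF G(1,2)] nat_copy_group[OF assms(2) cH]] G(3) by blast
  then show ?thesis using assms(2) cH by (simp add: has_copy_def)
qed

lemma copy_iff_iso_nat:
  assumes "group G" "group M" "\<phi> \<in> iso G M"
  shows "has_copy P G \<longleftrightarrow> P M"
  using copy_iso[of G M] copy_iso[of M G] copy_nat[OF assms(2)] assms is_isoI group.iso_sym by metis

text \<open>A subgroup has two incarnations on the natural numbers, by its own enumeration and as
  the image inside a copy of the ambient group. They are isomorphic, so \<open>P\<close> may be
  tested on either.\<close>

lemma copy_subgroup_iff:
  assumes "group G" "group M" "\<phi> \<in> iso G M" "subgroup K G"
  shows "has_copy P (G\<lparr>carrier := K\<rparr>) \<longleftrightarrow> P (M\<lparr>carrier := \<phi> ` K\<rparr>)"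
proof (rule copy_iff_iso_nat)
  show "group (G\<lparr>carrier := K\<rparr>)" using assms group.subgroup_imp_group by blast
  have "subgroup (\<phi> ` K) M"
    using subgroup_hom_image[OF assms(1,2) _ assms(4)] assms(3) by (simp add: iso_def)
  then show "group (M\<lparr>carrier := \<phi> ` K\<rparr>)" using assms group.subgroup_imp_group by blast
  show "\<phi> \<in> iso (G\<lparr>carrier := K\<rparr>) (M\<lparr>carrier := \<phi> ` K\<rparr>)"
    using iso_subgroup_image assms subgroup.subset by blast
qed

text \<open>A countable union of countable subgroups is countable, so one enumeration of the whole
  group carries the entire chain to the natural numbers, where \<open>union\<close> applies.\<close>

lemma copy_union:
  assumes "group G" "\<And>n. subgroup (K n) G" "incseq K" "(\<Union>n::nat. K n) = carrier G"
    and "\<And>n. has_copy P (G\<lparr>carrier := K n\<rparr>)"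
  shows "has_copy P G"
proof -
  have "countable (K n)" for n using has_copyD(2)[OF assms(5)[of n]] by simp
  then have cG: "countable (carrier G)" unfolding assms(4)[symmetric] by blast
  let ?M = "nat_copy G" and ?e = "to_nat_on (carrier G)"
  note e = nat_copy_iso[OF assms(1) cG] and M = nat_copy_group[OF assms(1) cG]
  have "P ?M"
  proof (rule union[OF M, where K = "\<lambda>n. ?e ` K n"])
    show "subgroup (?e ` K n) ?M" for n
      using subgroup_hom_image[OF assms(1) M _ assms(2)] e by (simp add: iso_def)
    show "incseq (\<lambda>n. ?e ` K n)" using assms(3) by (auto simp: mono_def)
    show "(\<Union>n. ?e ` K n) = carrier ?M"
      unfolding image_UN[symmetric] assms(4) using e by (simp add: iso_def bij_betw_def)
    show "P (?M\<lparr>carrier := ?e ` K n\<rparr>)" for n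
      using copy_subgroup_iff[OF assms(1) M e assms(2)] assms(5) by blast
  qed
  then show ?thesis using assms(1) cG by (simp add: has_copy_def)
qed

end

text \<open>Extensions are given by a surjective homomorphism, since a factor group would live on a
  type of sets, outside the scope of \<open>P\<close>.\<close>

locale extension_closed_class = union_closed_class +
  assumes ext: "\<And>M Q h. \<lbrakk>group M; group Q; h \<in> hom M Q; h ` carrier M = carrier Q;
      P (M\<lparr>carrier := kernel M Q h\<rparr>); P Q\<rbrakk> \<Longrightarrow> P M"
begin

text \<open>Conjugating \<open>h\<close> by the enumerations of \<open>G\<close> and
  \<open>Q\<close> gives a surjection between the copies whose kernel is the image of the kernel of
  \<open>h\<close>.\<close>

lemma copy_ext:
  fixes G :: "'b monoid" and Q :: "'c monoid"
  assumes "group G" "countable (carrier G)" "h \<in> hom G Q" "h ` carrier G = carrier Q"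
    and "has_copy P (G\<lparr>carrier := kernel G Q h\<rparr>)" "has_copy P Q"
  shows "has_copy P G"
proof -
  note Q = has_copyD[OF assms(6)]
  let ?M = "nat_copy G" and ?e = "to_nat_on (carrier G)"
  let ?N = "nat_copy Q" and ?d = "to_nat_on (carrier Q)"
  let ?h = "?d \<circ> h \<circ> inv_into (carrier G) ?e"
  note e = nat_copy_iso[OF assms(1,2)] and d = nat_copy_iso[OF Q(1,2)]
  note M = nat_copy_group[OF assms(1,2)] and N = nat_copy_group[OF Q(1,2)]
  have e_inv: "inv_into (carrier G) ?e \<in> iso ?M G" by (rule group.iso_set_sym[OF assms(1) e])
  have ce: "carrier ?M = ?e ` carrier G" using e by (simp add: iso_def bij_betw_def)
  have cd: "carrier ?N = ?d ` carrier Q" using d by (simp add: iso_def bij_betw_def)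
  have he: "?h (?e x) = ?d (h x)" if "x \<in> carrier G" for x
    using that inj_on_to_nat_on[OF assms(2)] by (simp add: inv_into_f_f)
  have "h \<circ> inv_into (carrier G) ?e \<in> hom ?M Q"
    using e_inv assms(3) by (intro Group.hom_compose[of _ _ G]) (auto simp: iso_def)
  then have hom: "?h \<in> hom ?M ?N"
    unfolding o_assoc[symmetric] using d by (intro Group.hom_compose[of _ _ Q]) (auto simp: iso_def)
  have "?h ` carrier ?M = (\<lambda>x. ?d (h x)) ` carrier G"
    unfolding ce image_image using he by auto
  then have onto: "?h ` carrier ?M = carrier ?N"
    unfolding cd assms(4)[symmetric] image_image .
  have d1: "?d (h x) = \<one>\<^bsub>?N\<^esub> \<longleftrightarrow> h x = \<one>\<^bsub>Q\<^esub>" if "x \<in> carrier G" for x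
  proof -
    have hx: "h x \<in> carrier Q" using assms(4) that by blast
    have "?d \<one>\<^bsub>Q\<^esub> = \<one>\<^bsub>?N\<^esub>"
      using hom_one[OF _ Q(1) N, of ?d] d by (simp add: iso_def)
    moreover have "\<one>\<^bsub>Q\<^esub> \<in> carrier Q" using Q(1) by (simp add: group.is_monoid monoid.one_closed)
    ultimately show ?thesis
      using inj_onD[OF inj_on_to_nat_on[OF Q(2)] _ hx] by metis
  qed
  have ker: "kernel ?M ?N ?h = ?e ` kernel G Q h"
  proof -
    have "kernel ?M ?N ?h = ?e ` {x \<in> carrier G. ?d (h x) = \<one>\<^bsub>?N\<^esub>}"
      unfolding kernel_def ce using he by auto
    also have "{x \<in> carrier G. ?d (h x) = \<one>\<^bsub>?N\<^esub>} = kernel G Q h"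
      unfolding kernel_def using d1 by blast
    finally show ?thesis .
  qed
  have "P ?M"
  proof (rule ext[OF M N hom onto])
    show "P (?M\<lparr>carrier := kernel ?M ?N ?h\<rparr>)"
      unfolding ker
      using copy_subgroup_iff[OF assms(1) M e subgroup_hom_kernel[OF assms(1) Q(1) assms(3)]]
        assms(5) by blast
  qed (rule Q(3))
  then show ?thesis using assms(1,2) by (simp add: has_copy_def)
qed

end


section \<open>Direct limits\<close>

text \<open>Serves two systems: an arbitrary one occurring in a derivation of
  \<open>elementary_closure\<close>, and the tower of the main construction.\<close>

locale direct_sys =
  fixes I :: "'i set" and r :: "'i rel" and Gs :: "'i \<Rightarrow> 'b monoid" and \<phi> :: "'i \<Rightarrow> 'i \<Rightarrow> 'b \<Rightarrow> 'b"
  assumes sys: "directed_system I r Gs \<phi>"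
begin

abbreviation "R \<equiv> direct_limit_rel I r Gs \<phi>"
abbreviation "DL \<equiv> direct_limit I r Gs \<phi>"

definition cl :: "'i \<Rightarrow> 'b \<Rightarrow> ('i \<times> 'b) set" where
  "cl i x = R `` {(i, x)}"

lemma ne: "I \<noteq> {}"
  using sys by (simp add: directed_system_def)

lemma preorder: "preorder_on I r"
  using sys by (simp add: directed_system_def)

lemma r_mem: "(i, j) \<in> r \<Longrightarrow> i \<in> I \<and> j \<in> I"
  using preorder by (auto simp: preorder_on_def)

lemma r_refl: "i \<in> I \<Longrightarrow> (i, i) \<in> r"
  using preorder by (auto simp: preorder_on_def refl_on_def)

lemma r_trans: "(i, j) \<in> r \<Longrightarrow> (j, k) \<in> r \<Longrightarrow> (i, k) \<in> r"
  using preorder unfolding preorder_on_def by (auto dest: transD)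

lemma dir: "i \<in> I \<Longrightarrow> j \<in> I \<Longrightarrow> \<exists>k\<in>I. (i, k) \<in> r \<and> (j, k) \<in> r"
  using sys by (simp add: directed_system_def)

lemma grp: "i \<in> I \<Longrightarrow> group (Gs i)"
  using sys by (simp add: directed_system_def)

lemma hom: "(i, j) \<in> r \<Longrightarrow> \<phi> i j \<in> hom (Gs i) (Gs j)"
  using sys by (simp add: directed_system_def)

lemma map_id: "i \<in> I \<Longrightarrow> x \<in> carrier (Gs i) \<Longrightarrow> \<phi> i i x = x"
  using sys by (simp add: directed_system_def)

lemma map_comp:
  assumes "(i, j) \<in> r" "(j, k) \<in> r" "x \<in> carrier (Gs i)"
  shows "\<phi> j k (\<phi> i j x) = \<phi> i k x"
proof -
  have "\<forall>i j k. (i, j) \<in> r \<and> (j, k) \<in> r \<longrightarrow> (\<forall>x\<in>carrier (Gs i). \<phi> j k (\<phi> i j x) = \<phi> i k x)"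
    using sys unfolding directed_system_def by (elim conjE)
  then show ?thesis using assms by simp
qed

lemma map_closed: "(i, j) \<in> r \<Longrightarrow> x \<in> carrier (Gs i) \<Longrightarrow> \<phi> i j x \<in> carrier (Gs j)"
  using hom by (auto simp: hom_def)

lemma R_iff: "((i, x), (j, y)) \<in> R \<longleftrightarrow> i \<in> I \<and> j \<in> I \<and> x \<in> carrier (Gs i) \<and> y \<in> carrier (Gs j) \<and>
    (\<exists>k\<in>I. (i, k) \<in> r \<and> (j, k) \<in> r \<and> \<phi> i k x = \<phi> j k y)"
  by (simp add: direct_limit_rel_def)

lemma equiv_R: "equiv (SIGMA i:I. carrier (Gs i)) R"
proof (rule equivI)
  show "R \<subseteq> (SIGMA i:I. carrier (Gs i)) \<times> (SIGMA i:I. carrier (Gs i))"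
    by (auto simp: R_iff)
  show "refl_on (SIGMA i:I. carrier (Gs i)) R"
    by (auto simp: refl_on_def R_iff intro!: r_refl)
  show "sym R" by (rule symI) (auto simp: R_iff; metis)
  show "trans R"
  proof (rule transI, clarify)
    fix i x j y k z
    assume a: "((i, x), (j, y)) \<in> R" "((j, y), (k, z)) \<in> R"
    \<comment> \<open>Each relation is witnessed at its own index; transitivity is read off at an
      index above both.\<close>
    then obtain l m where lm: "l \<in> I" "(i, l) \<in> r" "(j, l) \<in> r" "\<phi> i l x = \<phi> j l y"
      "m \<in> I" "(j, m) \<in> r" "(k, m) \<in> r" "\<phi> j m y = \<phi> k m z" by (auto simp: R_iff)
    then obtain n where n: "n \<in> I" "(l, n) \<in> r" "(m, n) \<in> r" using dir by blast
    have mem: "x \<in> carrier (Gs i)" "y \<in> carrier (Gs j)" "z \<in> carrier (Gs k)"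
      using a by (auto simp: R_iff)
    have "\<phi> i n x = \<phi> j n y"
      using map_comp[OF lm(2) n(2) mem(1)] map_comp[OF lm(3) n(2) mem(2)] lm(4) by simp
    moreover have "\<phi> j n y = \<phi> k n z"
      using map_comp[OF lm(6) n(3) mem(2)] map_comp[OF lm(7) n(3) mem(3)] lm(8) by simp
    ultimately have "\<phi> i n x = \<phi> k n z" by simp
    then show "((i, x), (k, z)) \<in> R"
      using a n(1) r_trans[OF lm(2) n(2)] r_trans[OF lm(7) n(3)] unfolding R_iff by blast
  qed
qed

lemma cl_eq_iff:
  assumes "i \<in> I" "j \<in> I" "x \<in> carrier (Gs i)" "y \<in> carrier (Gs j)"
  shows "cl i x = cl j y \<longleftrightarrow> (\<exists>k\<in>I. (i, k) \<in> r \<and> (j, k) \<in> r \<and> \<phi> i k x = \<phi> j k y)"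
  unfolding cl_def using eq_equiv_class_iff[OF equiv_R, of "(i, x)" "(j, y)"] assms
  by (simp add: R_iff)

lemma cl_eqI:
  assumes "(i, k) \<in> r" "(j, k) \<in> r" "x \<in> carrier (Gs i)" "y \<in> carrier (Gs j)" "\<phi> i k x = \<phi> j k y"
  shows "cl i x = cl j y"
  using cl_eq_iff[of i j x y] assms r_mem by blast

lemma cl_eqE:
  assumes "cl i x = cl j y" "i \<in> I" "j \<in> I" "x \<in> carrier (Gs i)" "y \<in> carrier (Gs j)"
  obtains k where "k \<in> I" "(i, k) \<in> r" "(j, k) \<in> r" "\<phi> i k x = \<phi> j k y"
  using cl_eq_iff[of i j x y] assms by blast

lemma cl_map:
  assumes "(i, j) \<in> r" "x \<in> carrier (Gs i)"
  shows "cl j (\<phi> i j x) = cl i x"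
proof -
  have j: "j \<in> I" using r_mem assms by auto
  show ?thesis
    by (rule cl_eqI[OF r_refl[OF j] assms(1) map_closed[OF assms] assms(2)])
      (rule map_id[OF j map_closed[OF assms]])
qed

lemma carrier_DL: "carrier DL = {cl i x |i x. i \<in> I \<and> x \<in> carrier (Gs i)}"
  unfolding direct_limit_def cl_def by (auto simp: quotient_def)

lemma cl_carrier: "i \<in> I \<Longrightarrow> x \<in> carrier (Gs i) \<Longrightarrow> cl i x \<in> carrier DL"
  using carrier_DL by blast

lemma mem_cl: "(j, y) \<in> cl i x \<Longrightarrow> j \<in> I \<and> y \<in> carrier (Gs j) \<and> cl j y = cl i x"
proof -
  assume "(j, y) \<in> cl i x"
  then have "((i, x), (j, y)) \<in> R" by (simp add: cl_def)
  then show ?thesis unfolding cl_def using equiv_class_eq[OF equiv_R] R_iff by metis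
qed

lemma self_mem_cl: "i \<in> I \<Longrightarrow> x \<in> carrier (Gs i) \<Longrightarrow> (i, x) \<in> cl i x"
  unfolding cl_def using r_refl by (auto simp: R_iff)

text \<open>Neither the representatives nor the common upper bound matter: all equalities and both
  products are pushed to one index, where both products become the same element.\<close>

lemma mult_wd:
  assumes "i \<in> I" "j \<in> I" "i' \<in> I" "j' \<in> I"
    and "x \<in> carrier (Gs i)" "y \<in> carrier (Gs j)" "x' \<in> carrier (Gs i')" "y' \<in> carrier (Gs j')"
    and "cl i x = cl i' x'" "cl j y = cl j' y'"
    and k: "(i, k) \<in> r" "(j, k) \<in> r" and k': "(i', k') \<in> r" "(j', k') \<in> r"
  shows "cl k (\<phi> i k x \<otimes>\<^bsub>Gs k\<^esub> \<phi> j k y) = cl k' (\<phi> i' k' x' \<otimes>\<^bsub>Gs k'\<^esub> \<phi> j' k' y')"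
proof -
  obtain l where l: "l \<in> I" "(i, l) \<in> r" "(i', l) \<in> r" "\<phi> i l x = \<phi> i' l x'"
    by (rule cl_eqE[OF assms(9,1,3,5,7)])
  obtain m where m: "m \<in> I" "(j, m) \<in> r" "(j', m) \<in> r" "\<phi> j m y = \<phi> j' m y'"
    by (rule cl_eqE[OF assms(10,2,4,6,8)])
  have kI: "k \<in> I" "k' \<in> I" using r_mem[OF k(1)] r_mem[OF k'(1)] by auto
  \<comment> \<open>The index \<open>n\<close> must dominate four others: \<open>l\<close> and
    \<open>m\<close>, where the representatives agree, and \<open>k\<close> and \<open>k'\<close>,
    where the products are formed.\<close>
  obtain a where a: "a \<in> I" "(l, a) \<in> r" "(m, a) \<in> r" using dir[OF l(1) m(1)] by blast
  obtain b where b: "b \<in> I" "(k, b) \<in> r" "(k', b) \<in> r" using dir[OF kI] by blast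
  obtain n where n0: "n \<in> I" "(a, n) \<in> r" "(b, n) \<in> r" using dir[OF a(1) b(1)] by blast
  have n: "(l, n) \<in> r" "(m, n) \<in> r" "(k, n) \<in> r" "(k', n) \<in> r"
    using r_trans[OF a(2) n0(2)] r_trans[OF a(3) n0(2)] r_trans[OF b(2) n0(3)] r_trans[OF b(3) n0(3)]
    by simp_all
  interpret k: group "Gs k" using grp kI(1) .
  interpret k': group "Gs k'" using grp kI(2) .
  note kc = map_closed[OF k(1) assms(5)] map_closed[OF k(2) assms(6)]
  note kc' = map_closed[OF k'(1) assms(7)] map_closed[OF k'(2) assms(8)]
  have "\<phi> i n x = \<phi> i' n x'"
    using map_comp[OF l(2) n(1) assms(5)] map_comp[OF l(3) n(1) assms(7)] l(4) by simp
  moreover have "\<phi> j n y = \<phi> j' n y'"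
    using map_comp[OF m(2) n(2) assms(6)] map_comp[OF m(3) n(2) assms(8)] m(4) by simp
  moreover have "\<phi> k n (\<phi> i k x \<otimes>\<^bsub>Gs k\<^esub> \<phi> j k y) = \<phi> i n x \<otimes>\<^bsub>Gs n\<^esub> \<phi> j n y"
    using hom_mult[OF hom[OF n(3)] kc] map_comp[OF k(1) n(3) assms(5)] map_comp[OF k(2) n(3) assms(6)]
    by simp
  moreover have "\<phi> k' n (\<phi> i' k' x' \<otimes>\<^bsub>Gs k'\<^esub> \<phi> j' k' y') = \<phi> i' n x' \<otimes>\<^bsub>Gs n\<^esub> \<phi> j' n y'"
    using hom_mult[OF hom[OF n(4)] kc'] map_comp[OF k'(1) n(4) assms(7)] map_comp[OF k'(2) n(4) assms(8)]
    by simp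
  ultimately show ?thesis
    by (intro cl_eqI[OF n(3,4)]) (use kc kc' in simp_all)
qed

lemma cl_mult:
  assumes "(i, k) \<in> r" "(j, k) \<in> r" "x \<in> carrier (Gs i)" "y \<in> carrier (Gs j)"
  shows "cl i x \<otimes>\<^bsub>DL\<^esub> cl j y = cl k (\<phi> i k x \<otimes>\<^bsub>Gs k\<^esub> \<phi> j k y)"
proof -
  have I: "i \<in> I" "j \<in> I" "k \<in> I" using r_mem assms by auto
  have eq: "cl k' (\<phi> i' k' x' \<otimes>\<^bsub>Gs k'\<^esub> \<phi> j' k' y') = cl k (\<phi> i k x \<otimes>\<^bsub>Gs k\<^esub> \<phi> j k y)"
    if "(i', x') \<in> cl i x" "(j', y') \<in> cl j y" "(i', k') \<in> r" "(j', k') \<in> r" for i' x' j' y' k'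
    using mult_wd[of i' j' i j x' y' x y k' k] mem_cl[OF that(1)] mem_cl[OF that(2)] that(3,4) I assms
    by blast
  have "cl i x \<otimes>\<^bsub>DL\<^esub> cl j y = (\<Union>(i', x')\<in>cl i x. \<Union>(j', y')\<in>cl j y.
      \<Union>k'\<in>{k' \<in> I. (i', k') \<in> r \<and> (j', k') \<in> r}. cl k' (\<phi> i' k' x' \<otimes>\<^bsub>Gs k'\<^esub> \<phi> j' k' y'))"
    (is "_ = ?U") by (simp add: direct_limit_def cl_def)
  \<comment> \<open>All members of the union are one class by \<open>eq\<close>; the reverse
    inclusion says that the union is not empty, as each representative lies in its own
    class.\<close>
  also have "?U = cl k (\<phi> i k x \<otimes>\<^bsub>Gs k\<^esub> \<phi> j k y)"
  proof
    show "?U \<subseteq> cl k (\<phi> i k x \<otimes>\<^bsub>Gs k\<^esub> \<phi> j k y)" using eq by blast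
    show "cl k (\<phi> i k x \<otimes>\<^bsub>Gs k\<^esub> \<phi> j k y) \<subseteq> ?U"
      using self_mem_cl[OF I(1) assms(3)] self_mem_cl[OF I(2) assms(4)] assms(1,2) I(3) by blast
  qed
  finally show ?thesis .
qed

lemma cl_mult_same:
  assumes "i \<in> I" "x \<in> carrier (Gs i)" "y \<in> carrier (Gs i)"
  shows "cl i x \<otimes>\<^bsub>DL\<^esub> cl i y = cl i (x \<otimes>\<^bsub>Gs i\<^esub> y)"
  using cl_mult[OF r_refl[OF assms(1)] r_refl[OF assms(1)] assms(2,3)]
  by (simp add: map_id[OF assms(1,2)] map_id[OF assms(1,3)])

lemma cl_one_eq:
  assumes "i \<in> I" "j \<in> I"
  shows "cl i \<one>\<^bsub>Gs i\<^esub> = cl j \<one>\<^bsub>Gs j\<^esub>"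
proof -
  obtain k where k: "k \<in> I" "(i, k) \<in> r" "(j, k) \<in> r" using dir assms by blast
  have "\<phi> i k \<one>\<^bsub>Gs i\<^esub> = \<one>\<^bsub>Gs k\<^esub>" "\<phi> j k \<one>\<^bsub>Gs j\<^esub> = \<one>\<^bsub>Gs k\<^esub>"
    using hom_one[OF hom[OF k(2)] grp[OF assms(1)] grp[OF k(1)]]
      hom_one[OF hom[OF k(3)] grp[OF assms(2)] grp[OF k(1)]] by auto
  moreover have "\<one>\<^bsub>Gs i\<^esub> \<in> carrier (Gs i)" "\<one>\<^bsub>Gs j\<^esub> \<in> carrier (Gs j)"
    using grp assms by (simp_all add: group.is_monoid monoid.one_closed)
  ultimately show ?thesis by (intro cl_eqI[OF k(2,3)]) simp_all
qed

lemma one_DL: "i \<in> I \<Longrightarrow> \<one>\<^bsub>DL\<^esub> = cl i \<one>\<^bsub>Gs i\<^esub>"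
proof -
  assume "i \<in> I"
  have "\<one>\<^bsub>DL\<^esub> = (\<Union>j\<in>I. cl j \<one>\<^bsub>Gs j\<^esub>)" by (simp add: direct_limit_def cl_def)
  also have "\<dots> = cl i \<one>\<^bsub>Gs i\<^esub>" using cl_one_eq \<open>i \<in> I\<close> by blast
  finally show ?thesis .
qed

lemma cl_common:
  assumes "A \<in> carrier DL" "B \<in> carrier DL"
  obtains k x y where "k \<in> I" "x \<in> carrier (Gs k)" "y \<in> carrier (Gs k)" "A = cl k x" "B = cl k y"
proof -
  obtain i x j y where *: "A = cl i x" "i \<in> I" "x \<in> carrier (Gs i)" "B = cl j y" "j \<in> I" "y \<in> carrier (Gs j)"
    using assms unfolding carrier_DL by blast
  then obtain k where "k \<in> I" "(i, k) \<in> r" "(j, k) \<in> r" using dir by blast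
  then show ?thesis
    using that[of k "\<phi> i k x" "\<phi> j k y"] cl_map map_closed * by simp
qed

lemma group_DL: "group DL"
proof (rule groupI)
  show "A \<otimes>\<^bsub>DL\<^esub> B \<in> carrier DL" if AB: "A \<in> carrier DL" "B \<in> carrier DL" for A B
  proof -
    obtain k x y where k: "k \<in> I" "x \<in> carrier (Gs k)" "y \<in> carrier (Gs k)" "A = cl k x" "B = cl k y"
      by (rule cl_common[OF AB])
    interpret k: group "Gs k" using grp k by blast
    show ?thesis using k cl_mult_same cl_carrier by simp
  qed
  show "A \<otimes>\<^bsub>DL\<^esub> B \<otimes>\<^bsub>DL\<^esub> C = A \<otimes>\<^bsub>DL\<^esub> (B \<otimes>\<^bsub>DL\<^esub> C)"
    if ABC: "A \<in> carrier DL" "B \<in> carrier DL" "C \<in> carrier DL" for A B C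
  proof -
    obtain k x y where k: "k \<in> I" "x \<in> carrier (Gs k)" "y \<in> carrier (Gs k)" "A = cl k x" "B = cl k y"
      by (rule cl_common[OF ABC(1,2)])
    obtain l z where l: "l \<in> I" "z \<in> carrier (Gs l)" "C = cl l z"
      using ABC unfolding carrier_DL by blast
    obtain m where m: "m \<in> I" "(k, m) \<in> r" "(l, m) \<in> r" using dir k l by blast
    interpret m: group "Gs m" using grp m by blast
    have "A = cl m (\<phi> k m x)" "B = cl m (\<phi> k m y)" "C = cl m (\<phi> l m z)"
      using cl_map m k l by auto
    then show ?thesis using cl_mult_same m map_closed k l by (simp add: m.m_assoc)
  qed
  obtain i where i: "i \<in> I" using ne by blast
  interpret i: group "Gs i" using grp i by blast
  show "\<one>\<^bsub>DL\<^esub> \<in> carrier DL" using one_DL i cl_carrier by simp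
  show "\<one>\<^bsub>DL\<^esub> \<otimes>\<^bsub>DL\<^esub> A = A" if A: "A \<in> carrier DL" for A
  proof -
    obtain k x where k: "k \<in> I" "x \<in> carrier (Gs k)" "A = cl k x"
      using A unfolding carrier_DL by blast
    interpret k: group "Gs k" using grp k by blast
    show ?thesis using k one_DL cl_mult_same by simp
  qed
  show "\<exists>B\<in>carrier DL. B \<otimes>\<^bsub>DL\<^esub> A = \<one>\<^bsub>DL\<^esub>" if A: "A \<in> carrier DL" for A
  proof -
    obtain k x where k: "k \<in> I" "x \<in> carrier (Gs k)" "A = cl k x"
      using A unfolding carrier_DL by blast
    interpret k: group "Gs k" using grp k by blast
    show ?thesis using k one_DL cl_mult_same cl_carrier by (intro bexI[of _ "cl k (inv\<^bsub>Gs k\<^esub> x)"]) auto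
  qed
qed

lemma cl_hom: "i \<in> I \<Longrightarrow> cl i \<in> hom (Gs i) DL"
  by (auto simp: hom_def cl_mult_same cl_carrier)

text \<open>Recognizes a direct limit from inside: a compatible family of homomorphisms that jointly
  cover \<open>L\<close> and identify two elements only if the system already does so at some
  stage.\<close>

lemma iso_direct_limit:
  assumes L: "group L" and f: "\<And>i. i \<in> I \<Longrightarrow> f i \<in> hom (Gs i) L"
    and comp: "\<And>i j x. (i, j) \<in> r \<Longrightarrow> x \<in> carrier (Gs i) \<Longrightarrow> f j (\<phi> i j x) = f i x"
    and onto: "(\<Union>i\<in>I. f i ` carrier (Gs i)) = carrier L"
    and inj: "\<And>i j x y. \<lbrakk>i \<in> I; j \<in> I; x \<in> carrier (Gs i); y \<in> carrier (Gs j); f i x = f j y\<rbrakk>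
      \<Longrightarrow> \<exists>k\<in>I. (i, k) \<in> r \<and> (j, k) \<in> r \<and> \<phi> i k x = \<phi> j k y"
  shows "L \<cong> DL"
proof -
  \<comment> \<open>The fibre over \<open>l\<close> in the disjoint union is itself an equivalence
    class, so no choice of preimages is involved.\<close>
  define \<Phi> where "\<Phi> l = {(i, x). i \<in> I \<and> x \<in> carrier (Gs i) \<and> f i x = l}" for l
  have \<Phi>: "\<Phi> (f i x) = cl i x" if "i \<in> I" "x \<in> carrier (Gs i)" for i x
  proof -
    have "((i, x), (j, y)) \<in> R \<longleftrightarrow> j \<in> I \<and> y \<in> carrier (Gs j) \<and> f j y = f i x" for j y
      proof
      assume "((i, x), (j, y)) \<in> R"
      then obtain k where "j \<in> I" "y \<in> carrier (Gs j)" "(i, k) \<in> r" "(j, k) \<in> r" "\<phi> i k x = \<phi> j k y"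
        unfolding R_iff by blast
      then show "j \<in> I \<and> y \<in> carrier (Gs j) \<and> f j y = f i x"
        using comp[of i k x] comp[of j k y] that by simp
    next
      assume "j \<in> I \<and> y \<in> carrier (Gs j) \<and> f j y = f i x"
      then show "((i, x), (j, y)) \<in> R" unfolding R_iff using that inj[of i j x y] by auto
    qed
    then show ?thesis unfolding \<Phi>_def cl_def by auto
  qed
  have ex: "\<exists>i x. i \<in> I \<and> x \<in> carrier (Gs i) \<and> l = f i x" if "l \<in> carrier L" for l
    using that onto by blast
  have fc: "f i x \<in> carrier L" if "i \<in> I" "x \<in> carrier (Gs i)" for i x
    using f that by (auto simp: hom_def)
  have "\<Phi> \<in> iso L DL"
  proof (rule isoI)
    show "\<Phi> \<in> hom L DL"
    proof (rule homI)
      show "\<Phi> l \<in> carrier DL" if "l \<in> carrier L" for l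
        using ex[OF that] \<Phi> cl_carrier by auto
      show "\<Phi> (l \<otimes>\<^bsub>L\<^esub> m) = \<Phi> l \<otimes>\<^bsub>DL\<^esub> \<Phi> m" if lm: "l \<in> carrier L" "m \<in> carrier L" for l m
      proof -
        obtain i x j y where i: "i \<in> I" "x \<in> carrier (Gs i)" "l = f i x"
          and j: "j \<in> I" "y \<in> carrier (Gs j)" "m = f j y" using ex lm by meson
        obtain k where k: "k \<in> I" "(i, k) \<in> r" "(j, k) \<in> r" using dir i j by blast
        interpret k: group "Gs k" using grp k by blast
        note c = map_closed[OF k(2) i(2)] map_closed[OF k(3) j(2)]
        have "l \<otimes>\<^bsub>L\<^esub> m = f k (\<phi> i k x \<otimes>\<^bsub>Gs k\<^esub> \<phi> j k y)"
          using hom_mult[OF f[OF k(1)] c] comp[OF k(2) i(2)] comp[OF k(3) j(2)] i j by simp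
        then show ?thesis
          using \<Phi>[OF k(1)] \<Phi>[OF i(1,2)] \<Phi>[OF j(1,2)] i(3) j(3) c cl_mult[OF k(2,3) i(2) j(2)] by simp
      qed
    qed
    show "bij_betw \<Phi> (carrier L) (carrier DL)"
    proof (rule bij_betw_imageI)
      show "inj_on \<Phi> (carrier L)"
      proof (rule inj_onI)
        fix l m assume lm: "l \<in> carrier L" "m \<in> carrier L" "\<Phi> l = \<Phi> m"
        obtain i x where "i \<in> I" "x \<in> carrier (Gs i)" "l = f i x" using ex[OF lm(1)] by blast
        then have "(i, x) \<in> \<Phi> l" "l = f i x" by (simp_all add: \<Phi>_def)
        then show "l = m" unfolding lm(3) by (simp add: \<Phi>_def)
      qed
      show "\<Phi> ` carrier L = carrier DL"
      proof
        show "\<Phi> ` carrier L \<subseteq> carrier DL" using ex \<Phi> cl_carrier by force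
        show "carrier DL \<subseteq> \<Phi> ` carrier L"
          unfolding carrier_DL using \<Phi>[symmetric] fc by blast
      qed
    qed
  qed
  then show ?thesis by (rule is_isoI)
qed

end

text \<open>\<open>elementary_closure\<close> has a rule for direct limits only; this presents an
  increasing union as the limit of its members under inclusions.\<close>

lemma iso_direct_limit_union:
  fixes M :: "'a monoid" and K :: "'i::linorder \<Rightarrow> 'a set"
  assumes M: "group M" and K: "\<And>n. subgroup (K n) M" "mono K" "(\<Union>n. K n) = carrier M"
  shows "directed_system UNIV {(i, j). i \<le> j} (\<lambda>n. M\<lparr>carrier := K n\<rparr>) (\<lambda>i j x. x)"
    and "M \<cong> direct_limit UNIV {(i, j). i \<le> j} (\<lambda>n. M\<lparr>carrier := K n\<rparr>) (\<lambda>i j x. x)"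
proof -
  have ub: "\<exists>k\<ge>i. j \<le> k" for i j :: 'i by (metis linear)
  show sys: "directed_system UNIV {(i, j). i \<le> j} (\<lambda>n. M\<lparr>carrier := K n\<rparr>) (\<lambda>i j x. x)"
    using K(2) group.subgroup_imp_group[OF M K(1)]
    by (auto simp: directed_system_def preorder_on_def refl_on_def trans_def hom_def mono_def
        intro: ub)
  interpret direct_sys UNIV "{(i, j). i \<le> j}" "\<lambda>n. M\<lparr>carrier := K n\<rparr>" "\<lambda>i j x. x"
    by (unfold_locales) (rule sys)
  show "M \<cong> direct_limit UNIV {(i, j). i \<le> j} (\<lambda>n. M\<lparr>carrier := K n\<rparr>) (\<lambda>i j x. x)"
    by (rule iso_direct_limit[OF M, where f = "\<lambda>i x. x"])
      (use K subgroup.mem_carrier[OF K(1)] in \<open>auto simp: hom_def intro: ub\<close>)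
qed


section \<open>Amenability\<close>

text \<open>Zorn's lemma for proper filters below \<open>F0\<close>, with finer filters counted as
  larger. A chain is a filter base for its infimum, so the infimum is proper. A finest proper filter
  decides every predicate, because restricting it to a set that it does not refute changes
  nothing.\<close>

lemma ultrafilter_exists:
  fixes F0 :: "'a filter"
  assumes "F0 \<noteq> bot"
  shows "\<exists>U. U \<noteq> bot \<and> U \<le> F0 \<and> (\<forall>P. eventually P U \<or> eventually (\<lambda>x. \<not> P x) U)"
proof -
  define S where "S = {F. F \<noteq> bot \<and> F \<le> F0}"
  have "\<exists>m\<in>S. \<forall>a\<in>S. m \<ge> a \<longrightarrow> a = m"
  proof (rule predicate_Zorn)
    show "partial_order_on S (relation_of (\<lambda>x y. x \<ge> y) S)"
      by (rule partial_order_on_relation_ofI) auto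
    fix C assume C: "C \<in> Chains (relation_of (\<lambda>x y. x \<ge> y) S)"
    then have CS: "C \<subseteq> S" by (auto simp: Chains_def relation_of_def)
    have tot: "x \<le> y \<or> y \<le> x" if "x \<in> C" "y \<in> C" for x y
      using C that by (auto simp: Chains_def relation_of_def)
    show "\<exists>u\<in>S. \<forall>a\<in>C. a \<ge> u"
    proof (cases "C = {}")
      case True
      then show ?thesis using assms by (auto simp: S_def)
    next
      case False
      have "eventually (\<lambda>_. False) (Inf C) \<longleftrightarrow> (\<exists>b\<in>C. eventually (\<lambda>_. False) b)"
        by (rule eventually_Inf_base[OF False]) (metis tot inf.order_iff inf.commute order_refl)
      then have "Inf C \<noteq> bot"
        using CS by (auto simp: S_def trivial_limit_def)
      moreover have "Inf C \<le> F0"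
        using CS False by (metis (lifting) Inf_lower S_def dual_order.trans ex_in_conv mem_Collect_eq subsetD)
      ultimately show ?thesis by (auto simp: S_def Inf_lower intro!: bexI[of _ "Inf C"])
    qed
  qed
  then obtain U where U: "U \<noteq> bot" "U \<le> F0" and min: "\<And>F. F \<noteq> bot \<Longrightarrow> F \<le> F0 \<Longrightarrow> F \<le> U \<Longrightarrow> F = U"
    by (auto simp: S_def)
  have "eventually P U \<or> eventually (\<lambda>x. \<not> P x) U" for P
  proof (cases "inf U (principal {x. P x}) = bot")
    case True
    then show ?thesis by (auto simp: trivial_limit_def eventually_inf_principal)
  next
    case False
    then have "inf U (principal {x. P x}) = U"
      using min U by (meson inf_le1 order_trans)
    then have "eventually P U"
      using eventually_inf_principal[of P U "{x. P x}"] by simp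
    then show ?thesis ..
  qed
  then show ?thesis using U by blast
qed

text \<open>
  One free ultrafilter on the natural numbers serves all limit arguments: it averages
  over intervals of the integers, and it glues measures or cones chosen independently along a chain.
\<close>

definition ultra :: "nat filter" where
  "ultra = (SOME U. U \<noteq> bot \<and> U \<le> sequentially \<and> (\<forall>P. eventually P U \<or> eventually (\<lambda>x. \<not> P x) U))"

lemma ultra_ne_bot: "ultra \<noteq> bot"
  and ultra_le: "ultra \<le> sequentially"
  and ultra_cases: "eventually P ultra \<or> eventually (\<lambda>x. \<not> P x) ultra"
  using someI_ex[OF ultrafilter_exists[OF trivial_limit_sequentially]] unfolding ultra_def[symmetric]
  by auto

lemma eventually_ultra: "eventually P sequentially \<Longrightarrow> eventually P ultra"
  using ultra_le by (simp add: le_filter_def)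

lemma tendsto_ultra: "(f \<longlongrightarrow> l) sequentially \<Longrightarrow> (f \<longlongrightarrow> l) ultra"
  using ultra_le tendsto_mono by blast

text \<open>The limit is the supremum of the numbers that are lower bounds eventually. A number
  above it fails to be an eventual lower bound, and since the ultrafilter decides every predicate,
  it is then an eventual strict upper bound.\<close>

lemma ultra_limit:
  fixes f :: "nat \<Rightarrow> real"
  assumes "\<And>n. a \<le> f n" "\<And>n. f n \<le> b"
  shows "(f \<longlongrightarrow> Lim ultra f) ultra"
proof -
  define T where "T = {t. eventually (\<lambda>n. t \<le> f n) ultra}"
  have aT: "a \<in> T" using assms(1) by (simp add: T_def)
  have "t \<le> b" if "t \<in> T" for t
  proof (rule ccontr)
    assume "\<not> t \<le> b"
    then have "\<not> t \<le> f n" for n using assms(2)[of n] by linarith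
    then show False using that ultra_ne_bot by (simp add: T_def)
  qed
  then have bdd: "bdd_above T" by (auto simp: bdd_above_def)
  have "(f \<longlongrightarrow> Sup T) ultra"
  proof (rule order_tendstoI)
    fix y assume "y < Sup T"
    then obtain t where "t \<in> T" "y < t" using less_cSup_iff[OF _ bdd] aT by blast
    then show "eventually (\<lambda>n. y < f n) ultra"
      unfolding T_def by (auto elim: eventually_mono)
  next
    fix y assume "Sup T < y"
    then have "y \<notin> T" using cSup_upper[OF _ bdd] by force
    then have "eventually (\<lambda>n. \<not> y \<le> f n) ultra"
      using ultra_cases by (auto simp: T_def)
    then show "eventually (\<lambda>n. f n < y) ultra" by (simp add: not_le)
  qed
  then show ?thesis using tendsto_Lim[OF ultra_ne_bot] by metis
qed

section \<open>Integration against a finitely additive probability measure\<close>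

locale fin_additive =
  fixes \<Omega> :: "'a set" and \<mu> :: "'a set \<Rightarrow> real"
  assumes nonneg: "A \<subseteq> \<Omega> \<Longrightarrow> 0 \<le> \<mu> A"
    and total: "\<mu> \<Omega> = 1"
    and add: "\<lbrakk>A \<subseteq> \<Omega>; B \<subseteq> \<Omega>; A \<inter> B = {}\<rbrakk> \<Longrightarrow> \<mu> (A \<union> B) = \<mu> A + \<mu> B"
begin

lemma null: "\<mu> {} = 0"
  using add[of "{}" "{}"] by simp

lemma mono: "A \<subseteq> B \<Longrightarrow> B \<subseteq> \<Omega> \<Longrightarrow> \<mu> A \<le> \<mu> B"
proof -
  assume AB: "A \<subseteq> B" "B \<subseteq> \<Omega>"
  then have "\<mu> (A \<union> (B - A)) = \<mu> A + \<mu> (B - A)" by (intro add) auto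
  moreover have "A \<union> (B - A) = B" using AB by blast
  ultimately show ?thesis using nonneg[of "B - A"] AB by auto
qed

lemma le_one: "A \<subseteq> \<Omega> \<Longrightarrow> \<mu> A \<le> 1"
  using mono[of A \<Omega>] total by simp

lemma Union:
  assumes "finite F" "\<And>i. i \<in> F \<Longrightarrow> A i \<subseteq> \<Omega>" "disjoint_family_on A F"
  shows "\<mu> (\<Union>i\<in>F. A i) = (\<Sum>i\<in>F. \<mu> (A i))"
  using assms
proof (induction F rule: finite_induct)
  case empty
  then show ?case using null by simp
next
  case (insert x F)
  have "\<mu> (A x \<union> (\<Union>i\<in>F. A i)) = \<mu> (A x) + \<mu> (\<Union>i\<in>F. A i)"
    using insert by (intro add) (auto simp: disjoint_family_on_def)
  then show ?case using insert by (simp add: disjoint_family_on_def)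
qed

definition simple_int :: "('a \<Rightarrow> real) \<Rightarrow> real" where
  "simple_int f = (\<Sum>v\<in>f ` \<Omega>. v * \<mu> {x \<in> \<Omega>. f x = v})"

text \<open>The level sets of \<open>c\<close> refine those of \<open>g \<circ> c\<close>, so the
  sum may be taken over the finer partition and grouped by the value of \<open>g\<close>.\<close>

lemma simple_int_comp:
  assumes fin: "finite (c ` \<Omega>)"
  shows "simple_int (\<lambda>x. g (c x)) = (\<Sum>z\<in>c ` \<Omega>. g z * \<mu> {x \<in> \<Omega>. c x = z})"
proof -
  have "v * \<mu> {x \<in> \<Omega>. g (c x) = v} =
      (\<Sum>z | z \<in> c ` \<Omega> \<and> g z = v. g z * \<mu> {x \<in> \<Omega>. c x = z})" for v
  proof -
    have "{x \<in> \<Omega>. g (c x) = v} = (\<Union>z\<in>{z \<in> c ` \<Omega>. g z = v}. {x \<in> \<Omega>. c x = z})" by auto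
    then have "\<mu> {x \<in> \<Omega>. g (c x) = v} = (\<Sum>z\<in>{z \<in> c ` \<Omega>. g z = v}. \<mu> {x \<in> \<Omega>. c x = z})"
      using fin by (simp only:) (rule Union; auto simp: disjoint_family_on_def)
    then show ?thesis by (simp add: sum_distrib_left)
  qed
  then have "simple_int (\<lambda>x. g (c x)) =
      (\<Sum>v\<in>g ` c ` \<Omega>. \<Sum>z | z \<in> c ` \<Omega> \<and> g z = v. g z * \<mu> {x \<in> \<Omega>. c x = z})"
    by (simp add: simple_int_def image_image)
  also have "\<dots> = (\<Sum>z\<in>c ` \<Omega>. g z * \<mu> {x \<in> \<Omega>. c x = z})"
    using fin by (intro sum.group) auto
  finally show ?thesis .
qed

text \<open>Expresses integrals involving two functions over their common refinement, which reduces
  additivity and monotonicity to termwise comparison of sums.\<close>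

lemma simple_int_pair:
  fixes f g :: "'a \<Rightarrow> real"
  assumes "finite (f ` \<Omega>)" "finite (g ` \<Omega>)"
  shows "simple_int (\<lambda>x. k (f x) (g x)) =
    (\<Sum>z\<in>(\<lambda>x. (f x, g x)) ` \<Omega>. k (fst z) (snd z) * \<mu> {x \<in> \<Omega>. (f x, g x) = z})"
proof -
  have "finite ((\<lambda>x. (f x, g x)) ` \<Omega>)"
    by (rule finite_subset[OF _ finite_cartesian_product[OF assms]]) auto
  from simple_int_comp[OF this, of "\<lambda>z. k (fst z) (snd z)"] show ?thesis by simp
qed

lemma simple_int_add:
  assumes "finite (f ` \<Omega>)" "finite (g ` \<Omega>)"
  shows "simple_int (\<lambda>x. f x + g x) = simple_int f + simple_int g"
  using simple_int_pair[OF assms, of "\<lambda>a b. a + b"] simple_int_pair[OF assms, of "\<lambda>a b. a"]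
    simple_int_pair[OF assms, of "\<lambda>a b. b"]
  by (simp add: algebra_simps sum.distrib)

lemma simple_int_mono:
  assumes "finite (f ` \<Omega>)" "finite (g ` \<Omega>)" "\<And>x. x \<in> \<Omega> \<Longrightarrow> f x \<le> g x"
  shows "simple_int f \<le> simple_int g"
  using simple_int_pair[OF assms(1,2), of "\<lambda>a b. a"] simple_int_pair[OF assms(1,2), of "\<lambda>a b. b"]
  by (auto intro!: sum_mono mult_right_mono nonneg assms(3))

lemma simple_int_const: "simple_int (\<lambda>x. c) = c"
proof -
  have "\<Omega> \<noteq> {}" using total null by auto
  then show ?thesis by (simp add: simple_int_def image_constant_conv total)
qed

lemma simple_int_cong: "(\<And>x. x \<in> \<Omega> \<Longrightarrow> f x = g x) \<Longrightarrow> simple_int f = simple_int g"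
  unfolding simple_int_def by (intro sum.cong arg_cong2[where f = "(*)"] arg_cong[where f = \<mu>]) auto

text \<open>Rounding down to multiples of \<open>1 / n\<close> makes a bounded function finitely
  valued. For \<open>n = 0\<close> division by zero gives the value \<open>0\<close>, which still
  lies in the unit interval.\<close>

definition disc :: "nat \<Rightarrow> ('a \<Rightarrow> real) \<Rightarrow> 'a \<Rightarrow> real" where
  "disc n F x = of_int \<lfloor>real n * F x\<rfloor> / real n"

text \<open>Meant for functions with values between 0 and 1. Along \<open>ultra\<close>, boundedness
  alone makes the limit exist.\<close>

definition integral :: "('a \<Rightarrow> real) \<Rightarrow> real" where
  "integral F = Lim ultra (\<lambda>n. simple_int (disc n F))"

lemma disc_bounds:
  assumes "0 \<le> F x" "F x \<le> 1"
  shows "0 \<le> disc n F x" "disc n F x \<le> 1"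
proof -
  have "real_of_int \<lfloor>real n * F x\<rfloor> \<le> real n * F x" by simp
  also have "\<dots> \<le> real n" using assms by (simp add: mult_left_le)
  finally show "disc n F x \<le> 1" by (cases "n = 0") (simp_all add: disc_def)
qed (use assms in \<open>simp add: disc_def\<close>)

lemma disc_finite:
  assumes "\<And>x. x \<in> \<Omega> \<Longrightarrow> 0 \<le> F x \<and> F x \<le> 1"
  shows "finite (disc n F ` \<Omega>)"
proof (rule finite_subset)
  show "disc n F ` \<Omega> \<subseteq> (\<lambda>k. of_int k / real n) ` {0..int n}"
  proof
    fix y assume "y \<in> disc n F ` \<Omega>"
    then obtain x where x: "x \<in> \<Omega>" "y = disc n F x" by blast
    have "real n * F x \<le> real n" using assms[OF x(1)] by (simp add: mult_left_le)
    then have "\<lfloor>real n * F x\<rfloor> \<in> {0..int n}" using assms[OF x(1)] by (simp add: floor_le_iff)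
    then show "y \<in> (\<lambda>k. of_int k / real n) ` {0..int n}" using x(2) by (auto simp: disc_def)
  qed
qed simp

lemma simple_int_disc_bounds:
  assumes "\<And>x. x \<in> \<Omega> \<Longrightarrow> 0 \<le> F x \<and> F x \<le> 1"
  shows "0 \<le> simple_int (disc n F)" "simple_int (disc n F) \<le> 1"
proof -
  have fin: "finite ((\<lambda>x. c) ` \<Omega>)" for c :: real by (rule finite_subset[of _ "{c}"]) auto
  show "0 \<le> simple_int (disc n F)"
    using simple_int_mono[OF fin disc_finite, of F 0 n] disc_bounds assms simple_int_const by simp
  show "simple_int (disc n F) \<le> 1"
    using simple_int_mono[OF disc_finite fin, of F n 1] disc_bounds assms simple_int_const by simp
qed

lemma integral_limit:
  assumes "\<And>x. x \<in> \<Omega> \<Longrightarrow> 0 \<le> F x \<and> F x \<le> 1"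
  shows "((\<lambda>n. simple_int (disc n F)) \<longlongrightarrow> integral F) ultra"
  unfolding integral_def using simple_int_disc_bounds[of F] assms by (intro ultra_limit[of 0 _ 1]) auto

lemma integral_nonneg:
  assumes "\<And>x. x \<in> \<Omega> \<Longrightarrow> 0 \<le> F x \<and> F x \<le> 1"
  shows "0 \<le> integral F"
  by (rule tendsto_lowerbound[OF integral_limit[OF assms] _ ultra_ne_bot])
    (use simple_int_disc_bounds[of F] assms in auto)

lemma integral_one: "integral (\<lambda>x. 1) = 1"
proof -
  have "eventually (\<lambda>n. simple_int (disc n (\<lambda>x. 1)) = 1) sequentially"
    by (rule eventually_mono[OF eventually_gt_at_top[of 0]])
      (use simple_int_const[of 1] in \<open>simp add: disc_def[abs_def]\<close>)
  then have "eventually (\<lambda>n. simple_int (disc n (\<lambda>x. 1)) = 1) ultra" by (rule eventually_ultra)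
  then have "((\<lambda>n. simple_int (disc n (\<lambda>x. 1))) \<longlongrightarrow> 1) ultra" by (rule tendsto_eventually)
  then show ?thesis unfolding integral_def by (rule tendsto_Lim[OF ultra_ne_bot])
qed

lemma integral_cong:
  assumes "\<And>x. x \<in> \<Omega> \<Longrightarrow> F x = G x"
  shows "integral F = integral G"
proof -
  have "simple_int (disc n F) = simple_int (disc n G)" for n
    by (rule simple_int_cong) (simp add: disc_def assms)
  then show ?thesis by (simp add: integral_def)
qed

text \<open>Rounding is additive up to one step, so the integrals of the roundings at stage
  \<open>n\<close> are additive up to \<open>1 / n\<close>, an error that vanishes in the
  limit.\<close>

lemma integral_add:
  assumes F: "\<And>x. x \<in> \<Omega> \<Longrightarrow> 0 \<le> F x" and G: "\<And>x. x \<in> \<Omega> \<Longrightarrow> 0 \<le> G x"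
    and FG: "\<And>x. x \<in> \<Omega> \<Longrightarrow> F x + G x \<le> 1"
  shows "integral (\<lambda>x. F x + G x) = integral F + integral G"
proof -
  have bF: "0 \<le> F x \<and> F x \<le> 1" and bG: "0 \<le> G x \<and> G x \<le> 1"
    and bS: "0 \<le> F x + G x \<and> F x + G x \<le> 1" if "x \<in> \<Omega>" for x
    using F[OF that] G[OF that] FG[OF that] by auto
  let ?j = "\<lambda>n F. simple_int (disc n F)"
  have bound: "\<bar>?j n (\<lambda>x. F x + G x) - (?j n F + ?j n G)\<bar> \<le> 1 / real n" for n
  proof -
    have fl: "of_int \<lfloor>a\<rfloor> + of_int \<lfloor>b\<rfloor> \<le> real_of_int \<lfloor>a + b\<rfloor>"
      "real_of_int \<lfloor>a + b\<rfloor> \<le> of_int \<lfloor>a\<rfloor> + of_int \<lfloor>b\<rfloor> + 1" for a b :: real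
      by (simp_all add: floor_add)
    have d: "disc n F x + disc n G x \<le> disc n (\<lambda>x. F x + G x) x"
      "disc n (\<lambda>x. F x + G x) x \<le> (disc n F x + disc n G x) + 1 / real n" for x
      unfolding disc_def add_divide_distrib[symmetric] distrib_left
      by (rule divide_right_mono[OF fl(1)], simp, rule divide_right_mono[OF fl(2)], simp)
    note fin = disc_finite[OF bF, where n = n] disc_finite[OF bG, where n = n] disc_finite[OF bS, where n = n]
    have fin2: "finite ((\<lambda>x. disc n F x + disc n G x) ` \<Omega>)"
      by (rule finite_subset[OF _ finite_imageI[OF finite_cartesian_product[OF fin(1,2)], where h = "\<lambda>(a, b). a + b"]])
        auto
    have fin3: "finite ((\<lambda>x. (disc n F x + disc n G x) + 1 / real n) ` \<Omega>)"
      using finite_imageI[OF fin2, where h = "\<lambda>y. y + 1 / real n"] by (simp add: image_image)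
    have \<Omega>: "finite ((\<lambda>x. 1 / real n) ` \<Omega>)" by (rule finite_subset[of _ "{1 / real n}"]) auto
    have "?j n F + ?j n G = simple_int (\<lambda>x. disc n F x + disc n G x)"
      using simple_int_add[OF fin(1,2)] by simp
    moreover have "simple_int (\<lambda>x. disc n F x + disc n G x) \<le> ?j n (\<lambda>x. F x + G x)"
      by (rule simple_int_mono[OF fin2 fin(3) d(1)])
    moreover have "?j n (\<lambda>x. F x + G x) \<le> simple_int (\<lambda>x. (disc n F x + disc n G x) + 1 / real n)"
      by (rule simple_int_mono[OF fin(3) fin3 d(2)])
    moreover have "simple_int (\<lambda>x. (disc n F x + disc n G x) + 1 / real n) =
        simple_int (\<lambda>x. disc n F x + disc n G x) + 1 / real n"
      using simple_int_add[OF fin2 \<Omega>] simple_int_const by simp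
    ultimately show ?thesis by linarith
  qed
  have "((\<lambda>n. ?j n (\<lambda>x. F x + G x) - (?j n F + ?j n G)) \<longlongrightarrow> 0) ultra"
    by (rule tendsto_ultra, rule tendsto_0_le[OF lim_1_over_n, where K = 1])
      (use bound in \<open>simp add: norm_divide\<close>)
  moreover have "((\<lambda>n. ?j n (\<lambda>x. F x + G x) - (?j n F + ?j n G)) \<longlongrightarrow>
      integral (\<lambda>x. F x + G x) - (integral F + integral G)) ultra"
    by (intro tendsto_intros integral_limit bF bG bS)
  ultimately have "integral (\<lambda>x. F x + G x) - (integral F + integral G) = 0"
    using tendsto_unique ultra_ne_bot by blast
  then show ?thesis by simp
qed

lemma integral_invariant:
  assumes T: "T ` \<Omega> = \<Omega>" and inv: "\<And>A. A \<subseteq> \<Omega> \<Longrightarrow> \<mu> {x \<in> \<Omega>. T x \<in> A} = \<mu> A"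
  shows "integral (\<lambda>x. F (T x)) = integral F"
proof -
  have *: "simple_int (\<lambda>x. f (T x)) = simple_int f" for f
  proof -
    have "{x \<in> \<Omega>. f (T x) = v} = {x \<in> \<Omega>. T x \<in> {y \<in> \<Omega>. f y = v}}" for v using T by auto
    then have "\<mu> {x \<in> \<Omega>. f (T x) = v} = \<mu> {x \<in> \<Omega>. f x = v}" for v
      using inv[of "{y \<in> \<Omega>. f y = v}"] by simp
    moreover have "(\<lambda>x. f (T x)) ` \<Omega> = f ` \<Omega>" using T by (metis image_image)
    ultimately show ?thesis by (simp add: simple_int_def)
  qed
  have "simple_int (disc n (\<lambda>x. F (T x))) = simple_int (disc n F)" for n
    using *[of "disc n F"] by (simp add: disc_def[abs_def])
  then show ?thesis by (simp add: integral_def)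
qed

end

section \<open>Permanence properties of amenability\<close>

lemma fin_additive_iff:
  "fin_additive \<Omega> \<mu> \<longleftrightarrow> (\<forall>A. A \<subseteq> \<Omega> \<longrightarrow> 0 \<le> \<mu> A) \<and> \<mu> \<Omega> = 1 \<and>
     (\<forall>A B. A \<subseteq> \<Omega> \<and> B \<subseteq> \<Omega> \<and> A \<inter> B = {} \<longrightarrow> \<mu> (A \<union> B) = \<mu> A + \<mu> B)"
  unfolding fin_additive_def by (intro conj_cong refl) blast

lemma amenable_iff:
  "amenable G \<longleftrightarrow> group G \<and> (\<exists>\<mu>. fin_additive (carrier G) \<mu> \<and>
     (\<forall>g\<in>carrier G. \<forall>A. A \<subseteq> carrier G \<longrightarrow> \<mu> (g <#\<^bsub>G\<^esub> A) = \<mu> A))"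
  unfolding amenable_def fin_additive_iff conj_assoc ..

lemma l_coset_eq: "g <#\<^bsub>G\<^esub> A = (\<lambda>x. g \<otimes>\<^bsub>G\<^esub> x) ` A"
  by (auto simp: l_coset_def)

lemma amenable_iso:
  assumes "group G" "group H" "G \<cong> H" "amenable G"
  shows "amenable H"
proof -
  obtain \<mu> where \<mu>: "fin_additive (carrier G) \<mu>"
    and inv: "\<And>g A. g \<in> carrier G \<Longrightarrow> A \<subseteq> carrier G \<Longrightarrow> \<mu> (g <#\<^bsub>G\<^esub> A) = \<mu> A"
    using assms(4) unfolding amenable_iff by blast
  interpret fin_additive "carrier G" \<mu> by fact
  obtain f where f: "f \<in> iso H G"
    using group.iso_sym[OF assms(1,3)] by (auto simp: is_iso_def)
  then have bij: "inj_on f (carrier H)" "f ` carrier H = carrier G" and h: "f \<in> hom H G"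
    by (auto simp: iso_def bij_betw_def)
  have "fin_additive (carrier H) (\<lambda>A. \<mu> (f ` A))"
  proof
    have im: "f ` A \<subseteq> carrier G" if "A \<subseteq> carrier H" for A
      using that unfolding bij(2)[symmetric] by (rule image_mono)
    show "0 \<le> \<mu> (f ` A)" if "A \<subseteq> carrier H" for A
      by (rule nonneg[OF im[OF that]])
    show "\<mu> (f ` carrier H) = 1" by (simp only: bij(2) total)
    show "\<mu> (f ` (A \<union> B)) = \<mu> (f ` A) + \<mu> (f ` B)"
      if "A \<subseteq> carrier H" "B \<subseteq> carrier H" "A \<inter> B = {}" for A B
      using add[OF im[OF that(1)] im[OF that(2)]] that(3) inj_on_image_Int[OF bij(1) that(1,2)]
      by (simp add: image_Un)
  qed
  moreover have "\<mu> (f ` (g <#\<^bsub>H\<^esub> A)) = \<mu> (f ` A)" if "g \<in> carrier H" "A \<subseteq> carrier H" for g A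
  proof -
    have "f ` (g <#\<^bsub>H\<^esub> A) = f g <#\<^bsub>G\<^esub> (f ` A)"
      unfolding l_coset_eq image_image using that by (auto intro!: image_cong hom_mult[OF h])
    moreover have "f g \<in> carrier G" "f ` A \<subseteq> carrier G" using that bij(2) by blast+
    ultimately show ?thesis using inv by simp
  qed
  ultimately show ?thesis using assms(2) unfolding amenable_iff by blast
qed

text \<open>The measure of \<open>A\<close> is the ultralimit of the measures of
  \<open>A \<inter> K n\<close>. A fixed \<open>g\<close> lies in \<open>K n\<close> for all large
  \<open>n\<close>, and there translating by \<open>g\<close> commutes with intersecting with
  \<open>K n\<close>, which gives invariance although the chosen measures need not be
  compatible.\<close>

lemma amenable_union:
  assumes G: "group G" and K: "\<And>n::nat. subgroup (K n) G" "incseq K" "(\<Union>n. K n) = carrier G"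
    and am: "\<And>n. amenable (G\<lparr>carrier := K n\<rparr>)"
  shows "amenable G"
proof -
  have "\<forall>n. \<exists>\<mu>. fin_additive (K n) \<mu> \<and> (\<forall>g\<in>K n. \<forall>A. A \<subseteq> K n \<longrightarrow> \<mu> (g <#\<^bsub>G\<^esub> A) = \<mu> A)"
    using am unfolding amenable_iff by (simp add: l_coset_eq)
  then obtain m where fa: "\<And>n. fin_additive (K n) (m n)"
    and inv: "\<And>n g A. g \<in> K n \<Longrightarrow> A \<subseteq> K n \<Longrightarrow> m n (g <#\<^bsub>G\<^esub> A) = m n A" by metis
  define \<mu> where "\<mu> A = Lim ultra (\<lambda>n. m n (A \<inter> K n))" for A
  have lim: "((\<lambda>n. m n (A \<inter> K n)) \<longlongrightarrow> \<mu> A) ultra" for A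
    unfolding \<mu>_def using fin_additive.nonneg[OF fa] fin_additive.le_one[OF fa]
    by (intro ultra_limit[of 0 _ 1]) auto
  have eqI: "\<mu> A = l" if "((\<lambda>n. m n (A \<inter> K n)) \<longlongrightarrow> l) ultra" for A l
    using tendsto_unique[OF ultra_ne_bot lim that] .
  have "fin_additive (carrier G) \<mu>"
  proof
    show "0 \<le> \<mu> A" for A
      by (rule tendsto_lowerbound[OF lim _ ultra_ne_bot]) (simp add: fin_additive.nonneg[OF fa])
    have "carrier G \<inter> K n = K n" for n using K(3) by blast
    then show "\<mu> (carrier G) = 1"
      by (intro eqI) (simp add: fin_additive.total[OF fa])
    show "\<mu> (A \<union> B) = \<mu> A + \<mu> B" if "A \<inter> B = {}" for A B
    proof (rule eqI)
      have "m n ((A \<union> B) \<inter> K n) = m n (A \<inter> K n) + m n (B \<inter> K n)" for n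
        unfolding Int_Un_distrib2 by (rule fin_additive.add[OF fa]) (use that in auto)
      then show "((\<lambda>n. m n ((A \<union> B) \<inter> K n)) \<longlongrightarrow> \<mu> A + \<mu> B) ultra"
        using tendsto_add[OF lim[of A] lim[of B]] by simp
    qed
  qed
  moreover have "\<mu> (g <#\<^bsub>G\<^esub> A) = \<mu> A" if g: "g \<in> carrier G" and A: "A \<subseteq> carrier G" for g A
  proof (rule eqI)
    interpret group G by fact
    obtain n0 where n0: "g \<in> K n0" using g K(3) by blast
    have "m n ((g <#\<^bsub>G\<^esub> A) \<inter> K n) = m n (A \<inter> K n)" if n: "n \<ge> n0" for n
    proof -
      interpret Kn: subgroup "K n" G by (rule K(1))
      have gn: "g \<in> K n" using n0 n K(2) by (meson incseqD subsetD)
      have "x \<in> K n" if "x \<in> A" "g \<otimes>\<^bsub>G\<^esub> x \<in> K n" for x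
      proof -
        have "inv\<^bsub>G\<^esub> g \<otimes>\<^bsub>G\<^esub> (g \<otimes>\<^bsub>G\<^esub> x) \<in> K n" using gn that by blast
        then show ?thesis using g A that by (simp add: m_assoc[symmetric] subset_iff)
      qed
      then have "(g <#\<^bsub>G\<^esub> A) \<inter> K n = g <#\<^bsub>G\<^esub> (A \<inter> K n)"
        unfolding l_coset_eq using gn by auto
      then show ?thesis using inv[OF gn] by simp
    qed
    then have "eventually (\<lambda>n. m n (A \<inter> K n) = m n ((g <#\<^bsub>G\<^esub> A) \<inter> K n)) ultra"
      by (intro eventually_ultra eventually_sequentiallyI[of n0]) simp
    then show "((\<lambda>n. m n ((g <#\<^bsub>G\<^esub> A) \<inter> K n)) \<longlongrightarrow> \<mu> A) ultra"
      by (rule Lim_transform_eventually[OF lim[of A]])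
  qed
  ultimately show ?thesis using G unfolding amenable_iff by blast
qed

text \<open>The classical product formula: measure each coset of the kernel by \<open>\<nu>\<close>,
  translated to that coset, and integrate the resulting function on the quotient against
  \<open>\<mu>\<close>.\<close>

lemma amenable_ext:
  assumes G: "group G" and Q: "group Q" and h: "h \<in> hom G Q" "h ` carrier G = carrier Q"
    and aN: "amenable (G\<lparr>carrier := kernel G Q h\<rparr>)" and aQ: "amenable Q"
  shows "amenable G"
proof -
  interpret group_hom G Q h using group_homI[OF G Q h(1)] .
  define N where "N = kernel G Q h"
  have N_iff: "n \<in> N \<longleftrightarrow> n \<in> carrier G \<and> h n = \<one>\<^bsub>Q\<^esub>" for n by (auto simp: N_def kernel_def)
  obtain \<nu> where \<nu>: "fin_additive N \<nu>"
    and \<nu>inv: "\<And>g A. g \<in> N \<Longrightarrow> A \<subseteq> N \<Longrightarrow> \<nu> (g <#\<^bsub>G\<^esub> A) = \<nu> A"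
    using aN unfolding amenable_iff by (auto simp: l_coset_eq N_def)
  obtain \<mu> where \<mu>: "fin_additive (carrier Q) \<mu>"
    and \<mu>inv: "\<And>g A. g \<in> carrier Q \<Longrightarrow> A \<subseteq> carrier Q \<Longrightarrow> \<mu> (g <#\<^bsub>Q\<^esub> A) = \<mu> A"
    using aQ unfolding amenable_iff by blast
  interpret n: fin_additive N \<nu> by fact
  interpret m: fin_additive "carrier Q" \<mu> by fact
  define s where "s q = (SOME x. x \<in> carrier G \<and> h x = q)" for q
  have s: "s q \<in> carrier G \<and> h (s q) = q" if "q \<in> carrier Q" for q
  proof -
    have "\<exists>x. x \<in> carrier G \<and> h x = q" using that unfolding h(2)[symmetric] by blast
    then show ?thesis unfolding s_def by (rule someI_ex)
  qed
  \<comment> \<open>the measure of the part of \<open>A\<close> in the coset over \<open>q\<close>; it does not depend on the choice of \<open>s q\<close>\<close>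
  define \<Phi> where "\<Phi> A q = \<nu> {n \<in> N. s q \<otimes>\<^bsub>G\<^esub> n \<in> A}" for A q
  have \<Phi>: "\<Phi> A (h x) = \<nu> {n \<in> N. x \<otimes>\<^bsub>G\<^esub> n \<in> A}" if x: "x \<in> carrier G" for A x
  proof -
    \<comment> \<open>\<open>?m\<close> lies in the kernel and \<open>x\<close> times
      \<open>?m\<close> is \<open>?y\<close>. Left translation by \<open>?m\<close> thus carries the
      part of \<open>A\<close> seen from \<open>?y\<close> to the part seen from \<open>x\<close>,
      and left invariance of \<open>\<nu>\<close> equates their measures.\<close>
    let ?y = "s (h x)" and ?m = "inv\<^bsub>G\<^esub> x \<otimes>\<^bsub>G\<^esub> s (h x)"
    have y: "?y \<in> carrier G" "h ?y = h x" using s[of "h x"] x by auto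
    then have m: "?m \<in> N" "?m \<in> carrier G" using x by (auto simp: N_iff)
    have "?m <#\<^bsub>G\<^esub> {n \<in> N. ?y \<otimes>\<^bsub>G\<^esub> n \<in> A} = {n \<in> N. x \<otimes>\<^bsub>G\<^esub> n \<in> A}"
    proof
      show "?m <#\<^bsub>G\<^esub> {n \<in> N. ?y \<otimes>\<^bsub>G\<^esub> n \<in> A} \<subseteq> {n \<in> N. x \<otimes>\<^bsub>G\<^esub> n \<in> A}"
      proof
        fix k assume "k \<in> ?m <#\<^bsub>G\<^esub> {n \<in> N. ?y \<otimes>\<^bsub>G\<^esub> n \<in> A}"
        then obtain n where n: "n \<in> N" "?y \<otimes>\<^bsub>G\<^esub> n \<in> A" "k = ?m \<otimes>\<^bsub>G\<^esub> n"
          unfolding l_coset_eq by blast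
        then have nG: "n \<in> carrier G" "h n = \<one>\<^bsub>Q\<^esub>" by (simp_all add: N_iff)
        have "x \<otimes>\<^bsub>G\<^esub> (?m \<otimes>\<^bsub>G\<^esub> n) = ?y \<otimes>\<^bsub>G\<^esub> n"
          using x y(1) nG(1) by (simp add: G.m_assoc[symmetric])
        moreover have "?m \<otimes>\<^bsub>G\<^esub> n \<in> N"
          using m nG unfolding N_iff by (simp only: hom_mult G.m_closed H.l_one H.one_closed)
        ultimately show "k \<in> {n \<in> N. x \<otimes>\<^bsub>G\<^esub> n \<in> A}" using n by simp
      qed
      show "{n \<in> N. x \<otimes>\<^bsub>G\<^esub> n \<in> A} \<subseteq> ?m <#\<^bsub>G\<^esub> {n \<in> N. ?y \<otimes>\<^bsub>G\<^esub> n \<in> A}"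
      proof
        fix n assume n: "n \<in> {n \<in> N. x \<otimes>\<^bsub>G\<^esub> n \<in> A}"
        then have nG: "n \<in> carrier G" by (simp add: N_iff)
        have "n = ?m \<otimes>\<^bsub>G\<^esub> (inv\<^bsub>G\<^esub> ?m \<otimes>\<^bsub>G\<^esub> n)"
          using nG m(2) by (simp add: G.m_assoc[symmetric] del: G.inv_mult_group)
        moreover have "inv\<^bsub>G\<^esub> ?m \<otimes>\<^bsub>G\<^esub> n \<in> N" using n m by (simp add: N_iff)
        moreover have "?y \<otimes>\<^bsub>G\<^esub> (inv\<^bsub>G\<^esub> ?m \<otimes>\<^bsub>G\<^esub> n) = x \<otimes>\<^bsub>G\<^esub> n"
          using x y nG by (simp add: G.inv_mult_group G.m_assoc[symmetric])
        ultimately show "n \<in> ?m <#\<^bsub>G\<^esub> {n \<in> N. ?y \<otimes>\<^bsub>G\<^esub> n \<in> A}"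
          unfolding l_coset_eq using n by auto
      qed
    qed
    then show ?thesis unfolding \<Phi>_def using \<nu>inv[OF m(1), of "{n \<in> N. ?y \<otimes>\<^bsub>G\<^esub> n \<in> A}"] by auto
  qed
  have \<Phi>01: "0 \<le> \<Phi> A q" "\<Phi> A q \<le> 1" for A q
    unfolding \<Phi>_def by (auto intro!: n.nonneg n.le_one)
  have \<Phi>add: "\<Phi> (A \<union> B) q = \<Phi> A q + \<Phi> B q" if "A \<inter> B = {}" for A B q
  proof -
    have "{n \<in> N. s q \<otimes>\<^bsub>G\<^esub> n \<in> A \<union> B} = {n \<in> N. s q \<otimes>\<^bsub>G\<^esub> n \<in> A} \<union> {n \<in> N. s q \<otimes>\<^bsub>G\<^esub> n \<in> B}" by auto
    then show ?thesis unfolding \<Phi>_def using that by (simp only:) (rule n.add; auto)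
  qed
  have "fin_additive (carrier G) (\<lambda>A. m.integral (\<Phi> A))"
  proof
    show "0 \<le> m.integral (\<Phi> A)" for A by (rule m.integral_nonneg) (simp add: \<Phi>01)
    have "\<Phi> (carrier G) q = 1" if "q \<in> carrier Q" for q
    proof -
      have "{n \<in> N. s q \<otimes>\<^bsub>G\<^esub> n \<in> carrier G} = N" using s[OF that] by (auto simp: N_iff)
      then show ?thesis by (simp add: \<Phi>_def n.total)
    qed
    then show "m.integral (\<Phi> (carrier G)) = 1"
      using m.integral_cong[of "\<Phi> (carrier G)" "\<lambda>_. 1"] m.integral_one by simp
    show "m.integral (\<Phi> (A \<union> B)) = m.integral (\<Phi> A) + m.integral (\<Phi> B)" if "A \<inter> B = {}" for A B
      using m.integral_add[of "\<Phi> A" "\<Phi> B"] \<Phi>01 \<Phi>add[OF that, symmetric] by simp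
  qed
  moreover have "m.integral (\<Phi> (g <#\<^bsub>G\<^esub> A)) = m.integral (\<Phi> A)"
    if g: "g \<in> carrier G" and A: "A \<subseteq> carrier G" for g A
  proof -
    \<comment> \<open>Asking whether \<open>x \<otimes> n\<close> lies in the translate of
      \<open>A\<close> by \<open>g\<close> is asking whether
      \<open>inv g \<otimes> x \<otimes> n\<close> lies in \<open>A\<close>. Translating
      \<open>A\<close> therefore only moves the argument in the quotient, and invariance of
      \<open>\<mu>\<close> absorbs that.\<close>
    let ?T = "\<lambda>q. h (inv\<^bsub>G\<^esub> g) \<otimes>\<^bsub>Q\<^esub> q"
    have "\<Phi> (g <#\<^bsub>G\<^esub> A) q = \<Phi> A (?T q)" if q: "q \<in> carrier Q" for q
    proof -
      obtain x where x: "x \<in> carrier G" "q = h x" using q h(2) by blast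
      have "x \<otimes>\<^bsub>G\<^esub> n \<in> g <#\<^bsub>G\<^esub> A \<longleftrightarrow> (inv\<^bsub>G\<^esub> g \<otimes>\<^bsub>G\<^esub> x) \<otimes>\<^bsub>G\<^esub> n \<in> A" if n: "n \<in> N" for n
      proof -
        have nG: "n \<in> carrier G" using n by (simp add: N_iff)
        have "x \<otimes>\<^bsub>G\<^esub> n = g \<otimes>\<^bsub>G\<^esub> ((inv\<^bsub>G\<^esub> g \<otimes>\<^bsub>G\<^esub> x) \<otimes>\<^bsub>G\<^esub> n)" using x g nG by (simp add: G.m_assoc[symmetric])
        moreover have "inv\<^bsub>G\<^esub> g \<otimes>\<^bsub>G\<^esub> (g \<otimes>\<^bsub>G\<^esub> a) = a" if "a \<in> A" for a
          using that A g by (simp add: G.m_assoc[symmetric] subset_iff)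
        ultimately show ?thesis unfolding l_coset_eq using x g nG by (auto simp: G.m_assoc)
      qed
      then have "{n \<in> N. x \<otimes>\<^bsub>G\<^esub> n \<in> g <#\<^bsub>G\<^esub> A} = {n \<in> N. (inv\<^bsub>G\<^esub> g \<otimes>\<^bsub>G\<^esub> x) \<otimes>\<^bsub>G\<^esub> n \<in> A}" by auto
      then show ?thesis using \<Phi>[of x] \<Phi>[of "inv\<^bsub>G\<^esub> g \<otimes>\<^bsub>G\<^esub> x"] x g by simp
    qed
    then have "m.integral (\<Phi> (g <#\<^bsub>G\<^esub> A)) = m.integral (\<lambda>q. \<Phi> A (?T q))"
      by (rule m.integral_cong)
    also have "\<dots> = m.integral (\<Phi> A)"
    proof (rule m.integral_invariant)
      have gQ: "h (inv\<^bsub>G\<^esub> g) \<in> carrier Q" "h g \<in> carrier Q" using g by auto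
      show "?T ` carrier Q = carrier Q" by (rule H.surj_const_mult[OF gQ(1)])
      fix B assume B: "B \<subseteq> carrier Q"
      have "{q \<in> carrier Q. ?T q \<in> B} = h g <#\<^bsub>Q\<^esub> B"
      proof
        show "{q \<in> carrier Q. ?T q \<in> B} \<subseteq> h g <#\<^bsub>Q\<^esub> B"
        proof
          fix q assume q: "q \<in> {q \<in> carrier Q. ?T q \<in> B}"
          then have "q = h g \<otimes>\<^bsub>Q\<^esub> ?T q" using g gQ by (simp add: H.m_assoc[symmetric])
          then show "q \<in> h g <#\<^bsub>Q\<^esub> B" unfolding l_coset_eq using q by blast
        qed
        show "h g <#\<^bsub>Q\<^esub> B \<subseteq> {q \<in> carrier Q. ?T q \<in> B}"
          unfolding l_coset_eq using B g gQ by (auto simp: H.m_assoc[symmetric] subset_iff)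
      qed
      then show "\<mu> {q \<in> carrier Q. ?T q \<in> B} = \<mu> B" using \<mu>inv[OF gQ(2) B] by simp
    qed
    finally show ?thesis .
  qed
  ultimately show ?thesis using G unfolding amenable_iff by blast
qed

text \<open>The measure is the density in the intervals from \<open>0\<close> to
  \<open>n - 1\<close>, taken along \<open>ultra\<close>. Moving a set by one changes its count in
  such an interval by at most one, which vanishes after division by \<open>n\<close>.\<close>

lemma amenable_integers: "amenable integer_group"
proof -
  define d where "d A n = real (card {i. i < n \<and> int i \<in> A}) / real n" for A :: "int set" and n
  define \<mu> where "\<mu> A = Lim ultra (d A)" for A
  have d01: "0 \<le> d A n" "d A n \<le> 1" for A n
  proof -
    have "card {i. i < n \<and> int i \<in> A} \<le> card {..<n}" by (rule card_mono) auto
    then show "d A n \<le> 1" by (cases "n = 0") (simp_all add: d_def)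
  qed (simp add: d_def)
  have lim: "(d A \<longlongrightarrow> \<mu> A) ultra" for A
    unfolding \<mu>_def using d01 by (intro ultra_limit) auto
  have eqI: "\<mu> A = l" if "(d A \<longlongrightarrow> l) ultra" for A l
    using tendsto_unique[OF ultra_ne_bot lim that] .
  have "fin_additive UNIV \<mu>"
  proof
    show "0 \<le> \<mu> A" for A
      by (rule tendsto_lowerbound[OF lim _ ultra_ne_bot]) (simp add: d01)
    have "eventually (\<lambda>n. d UNIV n = 1) ultra"
      by (intro eventually_ultra eventually_sequentiallyI[of 1]) (simp add: d_def)
    then show "\<mu> UNIV = 1" by (intro eqI tendsto_eventually)
    show "\<mu> (A \<union> B) = \<mu> A + \<mu> B" if "A \<inter> B = {}" for A B
    proof (rule eqI)
      have "d (A \<union> B) n = d A n + d B n" for n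
      proof -
        have "{i. i < n \<and> int i \<in> A \<union> B} = {i. i < n \<and> int i \<in> A} \<union> {i. i < n \<and> int i \<in> B}" by auto
        moreover have "card \<dots> = card {i. i < n \<and> int i \<in> A} + card {i. i < n \<and> int i \<in> B}"
          by (rule card_Un_disjoint) (use that in auto)
        ultimately show ?thesis by (simp add: d_def add_divide_distrib)
      qed
      then have "d (A \<union> B) = (\<lambda>n. d A n + d B n)" by auto
      then show "(d (A \<union> B) \<longlongrightarrow> \<mu> A + \<mu> B) ultra" using tendsto_add[OF lim lim] by simp
    qed
  qed
  moreover have "\<mu> ((\<lambda>x. g + x) ` A) = \<mu> A" for g A
  proof -
    have shift1: "\<mu> ((\<lambda>x. 1 + x) ` A) = \<mu> A" for A
    proof -
      let ?B = "(\<lambda>x. 1 + x) ` A"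
      have "\<bar>d ?B n - d A n\<bar> \<le> 1 / real n" for n
      proof -
        let ?a = "{i. i < n \<and> int i \<in> A}" and ?b = "{i. i < n \<and> int i \<in> ?B}"
        \<comment> \<open>The point \<open>0\<close> enters the window from \<open>-1\<close>, which
          the window does not see.\<close>
        have "?b \<subseteq> insert 0 (Suc ` ?a)"
        proof
          fix i assume i: "i \<in> ?b"
          show "i \<in> insert 0 (Suc ` ?a)" using i by (cases i) (auto simp: image_iff)
        qed
        then have "card ?b \<le> card (insert 0 (Suc ` ?a))" by (intro card_mono) auto
        also have "\<dots> \<le> Suc (card ?a)" by (simp add: card_image)
        finally have 1: "card ?b \<le> Suc (card ?a)" .
        \<comment> \<open>The last point \<open>n - 1\<close> may leave the window, to
          \<open>n\<close>.\<close>
        have "Suc ` ?a \<subseteq> insert n ?b" by (auto simp: image_iff)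
        then have "card (Suc ` ?a) \<le> card (insert n ?b)" by (intro card_mono) auto
        also have "\<dots> \<le> Suc (card ?b)" by (rule card_insert_le_m1) auto
        finally have 2: "card ?a \<le> Suc (card ?b)" by (simp add: card_image)
        have "\<bar>d ?B n - d A n\<bar> = \<bar>real (card ?b) - real (card ?a)\<bar> / real n"
          by (simp add: d_def diff_divide_distrib[symmetric])
        also have "\<dots> \<le> 1 / real n" by (rule divide_right_mono) (use 1 2 in auto)
        finally show ?thesis .
      qed
      then have "((\<lambda>n. d ?B n - d A n) \<longlongrightarrow> 0) ultra"
        by (intro tendsto_ultra tendsto_0_le[OF lim_1_over_n, where K = 1]) (simp add: norm_divide)
      from tendsto_add[OF this lim[of A]] have "(d ?B \<longlongrightarrow> \<mu> A) ultra" by simp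
      then show ?thesis by (rule eqI)
    qed
    have shiftn: "\<mu> ((\<lambda>x. int n + x) ` A) = \<mu> A" for n A
    proof (induction n)
      case (Suc n)
      have "(\<lambda>x. int (Suc n) + x) ` A = (\<lambda>x. 1 + x) ` (\<lambda>x. int n + x) ` A"
        by (simp add: image_image add.assoc)
      then show ?case using shift1 Suc by simp
    qed simp
    show ?thesis
    proof (cases "g \<ge> 0")
      case True
      then show ?thesis using shiftn[of "nat g" A] by simp
    next
      case False
      \<comment> \<open>For negative \<open>g\<close>, the set is recovered from its translate by a
        shift in the positive direction, where invariance is already known.\<close>
      then have "(\<lambda>x. int (nat (- g)) + x) ` (\<lambda>x. g + x) ` A = A" by (simp add: image_image)
      then show ?thesis using shiftn[of "nat (- g)" "(\<lambda>x. g + x) ` A"] by simp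
    qed
  qed
  ultimately show ?thesis
    unfolding amenable_iff by (auto simp: l_coset_eq)
qed

interpretation amenable: extension_closed_class amenable
  by unfold_locales (rule amenable_iso amenable_union amenable_ext; assumption)+

section \<open>Torsion-freeness and local indicability\<close>

lemma torsion_free_pullback:
  assumes "group H" "f \<in> hom H G" "inj_on f (carrier H)" "torsion_free_group G"
  shows "torsion_free_group H"
proof -
  have G: "group G" using assms(4) by (simp add: torsion_free_group_def)
  interpret group_hom H G f using group_homI[OF assms(1) G assms(2)] .
  have "x = \<one>\<^bsub>H\<^esub>" if "x \<in> carrier H" "n > 0" "x [^]\<^bsub>H\<^esub> n = \<one>\<^bsub>H\<^esub>" for x and n :: nat
  proof -
    have "f x [^]\<^bsub>G\<^esub> n = \<one>\<^bsub>G\<^esub>" using that hom_nat_pow[of x n] by simp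
    then have "f x = f \<one>\<^bsub>H\<^esub>" using assms(4) that by (auto simp: torsion_free_group_def)
    then show ?thesis using inj_onD[OF assms(3)] that by simp
  qed
  then show ?thesis using assms(1) by (auto simp: torsion_free_group_def)
qed

text \<open>A torsion element has a torsion image, which is trivial; so it lies in the kernel, where
  torsion is excluded as well.\<close>

lemma torsion_free_ext:
  assumes "group G" "group Q" "h \<in> hom G Q"
    "torsion_free_group (G\<lparr>carrier := kernel G Q h\<rparr>)" "torsion_free_group Q"
  shows "torsion_free_group G"
proof -
  interpret group_hom G Q h using group_homI[OF assms(1-3)] .
  have "x = \<one>\<^bsub>G\<^esub>" if x: "x \<in> carrier G" "n > 0" "x [^]\<^bsub>G\<^esub> n = \<one>\<^bsub>G\<^esub>" for x and n :: nat
  proof -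
    have "h x [^]\<^bsub>Q\<^esub> n = \<one>\<^bsub>Q\<^esub>" using that hom_nat_pow[of x n] by simp
    then have "h x = \<one>\<^bsub>Q\<^esub>" using assms(5) that by (auto simp: torsion_free_group_def)
    then have "x \<in> kernel G Q h" using x by (simp add: kernel_def)
    then show ?thesis
      using assms(4) x by (auto simp: torsion_free_group_def monoid.nat_pow_consistent[OF G.is_monoid, symmetric])
  qed
  then show ?thesis using assms(1) by (auto simp: torsion_free_group_def)
qed

lemma torsion_free_union:
  assumes "group G" "(\<Union>n::nat. K n) = carrier G"
    and "\<And>n. torsion_free_group (G\<lparr>carrier := K n\<rparr>)"
  shows "torsion_free_group G"
proof -
  have "x = \<one>\<^bsub>G\<^esub>" if x: "x \<in> carrier G" "n > 0" "x [^]\<^bsub>G\<^esub> n = \<one>\<^bsub>G\<^esub>" for x and n :: nat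
  proof -
    obtain m where "x \<in> K m" using x assms(2) by blast
    then show ?thesis
      using assms(3)[of m] x
      by (auto simp: torsion_free_group_def monoid.nat_pow_consistent[OF group.is_monoid[OF assms(1)], symmetric])
  qed
  then show ?thesis using assms(1) by (auto simp: torsion_free_group_def)
qed

lemma torsion_free_integers: "torsion_free_group integer_group"
  by (auto simp add: torsion_free_group_def)

lemma iso_pullback:
  assumes "group G" "G \<cong> H"
  shows "\<exists>f. f \<in> hom H G \<and> inj_on f (carrier H)"
  using group.iso_sym[OF assms] by (auto simp: is_iso_def iso_def bij_betw_def)

lemma torsion_free_iso:
  assumes "group G" "group H" "G \<cong> H" "torsion_free_group G"
  shows "torsion_free_group H"
proof -
  obtain f where "f \<in> hom H G" "inj_on f (carrier H)" using iso_pullback[OF assms(1,3)] by blast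
  then show ?thesis by (rule torsion_free_pullback[OF assms(2) _ _ assms(4)])
qed

interpretation torsion_free: extension_closed_class torsion_free_group
  by unfold_locales (rule torsion_free_iso, assumption+, rule torsion_free_union, assumption+, rule torsion_free_ext, assumption+)

section \<open>Local indicability\<close>

lemma group_hom_vanish:
  assumes "group_hom G H h" "S \<subseteq> carrier G" "\<And>s. s \<in> S \<Longrightarrow> h s = \<one>\<^bsub>H\<^esub>" "x \<in> generate G S"
  shows "h x = \<one>\<^bsub>H\<^esub>"
proof -
  interpret group_hom G H h by fact
  have "generate G S \<subseteq> kernel G H h"
    by (rule G.generate_subgroup_incl[OF _ subgroup_kernel]) (use assms(2,3) in \<open>auto simp: kernel_def\<close>)
  then show ?thesis using assms(4) by (auto simp: kernel_def)
qed

text \<open>The image is a nonzero subgroup of \<int>, hence consists of the multiples of its least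
  positive element \<open>d\<close>; dividing by \<open>d\<close> makes the homomorphism
  surjective.\<close>

lemma hom_onto_integers:
  assumes "group K" "h \<in> hom K integer_group" "x \<in> carrier K" "h x \<noteq> 0"
  shows "\<exists>g. g \<in> hom K integer_group \<and> g ` carrier K = UNIV"
proof -
  interpret group_hom K integer_group h using group_homI[OF assms(1) group_integer_group assms(2)] .
  define I where "I = h ` carrier K"
  have I0: "0 \<in> I" unfolding I_def using hom_one by (metis G.one_closed image_eqI one_integer_group)
  have Im: "- a \<in> I" if a: "a \<in> I" for a
  proof -
    obtain u where "u \<in> carrier K" "a = h u" using a unfolding I_def by blast
    then have "- a = h (inv\<^bsub>K\<^esub> u)" "inv\<^bsub>K\<^esub> u \<in> carrier K" by simp_all
    then show ?thesis unfolding I_def by blast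
  qed
  have Ia: "a + b \<in> I" if ab: "a \<in> I" "b \<in> I" for a b
  proof -
    obtain u v where "u \<in> carrier K" "v \<in> carrier K" "a = h u" "b = h v" using ab unfolding I_def by blast
    then have "a + b = h (u \<otimes>\<^bsub>K\<^esub> v)" "u \<otimes>\<^bsub>K\<^esub> v \<in> carrier K" by simp_all
    then show ?thesis unfolding I_def by blast
  qed
  have In: "int n * a \<in> I" if "a \<in> I" for n a
    by (induction n) (use I0 Ia that in \<open>simp_all add: distrib_right\<close>)
  have Iz: "n * a \<in> I" if "a \<in> I" for n a
    using In[OF that, of "nat n"] In[OF Im[OF that], of "nat (- n)"] by (cases "n \<ge> 0") auto
  have hx: "h x \<in> I" using assms(3) by (simp add: I_def)
  have "\<exists>n::nat. n > 0 \<and> int n \<in> I"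
  proof (cases "h x > 0")
    case True
    then show ?thesis using hx by (intro exI[of _ "nat (h x)"]) simp
  next
    case False
    then show ?thesis using Im[OF hx] assms(4) by (intro exI[of _ "nat (- h x)"]) simp
  qed
  then obtain d :: nat where d: "d > 0" "int d \<in> I" and least: "\<And>n. n > 0 \<and> int n \<in> I \<Longrightarrow> d \<le> n"
    using exists_least_iff[of "\<lambda>n::nat. n > 0 \<and> int n \<in> I"] by (metis not_le)
  have dvd: "int d dvd a" if "a \<in> I" for a
  proof -
    \<comment> \<open>The remainder modulo \<open>d\<close> stays in the image and is smaller than
      \<open>d\<close>, so minimality makes it zero.\<close>
    have "a mod int d = a + (- (a div int d)) * int d" by (simp add: minus_div_mult_eq_mod[symmetric])
    then have m: "a mod int d \<in> I" using Ia[OF that Iz[OF d(2), of "- (a div int d)"]] by metis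
    have b: "0 \<le> a mod int d" "a mod int d < int d" using d(1) by simp_all
    have "nat (a mod int d) = 0"
    proof (rule ccontr)
      assume "nat (a mod int d) \<noteq> 0"
      then have "d \<le> nat (a mod int d)" using m b by (intro least) auto
      then show False using b by linarith
    qed
    then show ?thesis using b by (simp add: dvd_eq_mod_eq_0)
  qed
  have mult: "(a + b) div int d = a div int d + b div int d" if "a \<in> I" "b \<in> I" for a b
    using dvd[OF that(1)] by (rule div_plus_div_distrib_dvd_left)
  have "(\<lambda>x. h x div int d) \<in> hom K integer_group"
  proof (rule homI)
    fix u v assume "u \<in> carrier K" "v \<in> carrier K"
    then show "h (u \<otimes>\<^bsub>K\<^esub> v) div int d = (h u div int d) \<otimes>\<^bsub>integer_group\<^esub> (h v div int d)"
      using mult[of "h u" "h v"] by (simp add: I_def)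
  qed simp
  moreover have "(\<lambda>x. h x div int d) ` carrier K = UNIV"
  proof -
    have "n \<in> (\<lambda>x. h x div int d) ` carrier K" for n
    proof -
      obtain u where "u \<in> carrier K" "h u = n * int d" using Iz[OF d(2), of n] by (force simp: I_def)
      then show ?thesis using d(1) by (intro image_eqI[of _ _ u]) simp_all
    qed
    then show ?thesis by auto
  qed
  ultimately show ?thesis by blast
qed

lemma indicable_iff:
  assumes "group K"
  shows "indicable K \<longleftrightarrow> (\<exists>h\<in>hom K integer_group. h ` carrier K = UNIV)"
proof
  assume "indicable K"
  then obtain N f where N: "N \<lhd> K" and f: "f \<in> iso (K Mod N) integer_group"
    by (auto simp: indicable_def is_iso_def)
  have "(\<lambda>a. f (N #>\<^bsub>K\<^esub> a)) \<in> hom K integer_group"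
    using Group.hom_compose[OF normal.r_coset_hom_Mod[OF N], of f integer_group] f
    by (simp add: iso_def comp_def)
  moreover have "(\<lambda>a. f (N #>\<^bsub>K\<^esub> a)) ` carrier K = UNIV"
  proof -
    have "(\<lambda>a. f (N #>\<^bsub>K\<^esub> a)) ` carrier K = f ` carrier (K Mod N)"
      by (auto simp: carrier_FactGroup)
    then show ?thesis using f by (simp add: iso_def bij_betw_def)
  qed
  ultimately show "\<exists>h\<in>hom K integer_group. h ` carrier K = UNIV" by blast
next
  assume "\<exists>h\<in>hom K integer_group. h ` carrier K = UNIV"
  then obtain h where h: "h \<in> hom K integer_group" "h ` carrier K = UNIV" by blast
  interpret group_hom K integer_group h using group_homI[OF assms group_integer_group h(1)] .
  show "indicable K"
    unfolding indicable_def using assms normal_kernel FactGroup_iso h(2) by (metis carrier_integer_group)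
qed

text \<open>Replaces infinite cyclic quotients of subgroups by integer-valued homomorphisms that do
  not vanish on a given finite set. A nonzero homomorphism can be made surjective by rescaling, and
  it cannot vanish on all generators. In this form the property passes easily along
  homomorphisms.\<close>

lemma locally_indicable_iff:
  "locally_indicable G \<longleftrightarrow> group G \<and>
    (\<forall>S. finite S \<and> S \<subseteq> carrier G \<and> \<not> S \<subseteq> {\<one>\<^bsub>G\<^esub>} \<longrightarrow>
      (\<exists>h\<in>hom (G\<lparr>carrier := generate G S\<rparr>) integer_group. \<exists>s\<in>S. h s \<noteq> 0))"
proof (cases "group G")
  case True
  then interpret group G .
  show ?thesis
  proof
    assume li: "locally_indicable G"
    have "\<exists>h\<in>hom (G\<lparr>carrier := generate G S\<rparr>) integer_group. \<exists>s\<in>S. h s \<noteq> 0"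
      if S: "finite S" "S \<subseteq> carrier G" "\<not> S \<subseteq> {\<one>\<^bsub>G\<^esub>}" for S
    proof -
      let ?K = "generate G S"
      have sub: "subgroup ?K G" by (rule generate_is_subgroup[OF S(2)])
      have SK: "S \<subseteq> ?K" by (auto intro: generate.incl)
      have gK: "group (G\<lparr>carrier := ?K\<rparr>)" using group.subgroup_imp_group[OF True sub] .
      have gen: "generate (G\<lparr>carrier := ?K\<rparr>) S = ?K" by (rule generate_consistent[OF SK sub])
      have "finitely_generated_group (G\<lparr>carrier := ?K\<rparr>)"
        unfolding finitely_generated_group_def using gK S(1) SK gen by (intro conjI exI[of _ S]) simp_all
      moreover have "?K \<noteq> {\<one>\<^bsub>G\<^esub>}" using SK S(3) by auto
      ultimately have "indicable (G\<lparr>carrier := ?K\<rparr>)"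
        using li sub by (simp add: locally_indicable_def)
      then obtain h where h: "h \<in> hom (G\<lparr>carrier := ?K\<rparr>) integer_group" "h ` ?K = UNIV"
        unfolding indicable_iff[OF gK] by auto
      have "\<exists>s\<in>S. h s \<noteq> 0"
      proof (rule ccontr)
        assume "\<not> ?thesis"
        then have "h x = 0" if "x \<in> ?K" for x
          using group_hom_vanish[OF group_homI[OF gK group_integer_group h(1)], of S x] SK that gen by simp
        then have "h ` ?K \<subseteq> {0}" by auto
        moreover have "(1::int) \<in> h ` ?K" using h(2) by simp
        ultimately show False by auto
      qed
      then show ?thesis using h(1) by blast
    qed
    then show "group G \<and> (\<forall>S. finite S \<and> S \<subseteq> carrier G \<and> \<not> S \<subseteq> {\<one>\<^bsub>G\<^esub>} \<longrightarrow>
      (\<exists>h\<in>hom (G\<lparr>carrier := generate G S\<rparr>) integer_group. \<exists>s\<in>S. h s \<noteq> 0))"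
      using True by simp
  next
    assume R: "group G \<and> (\<forall>S. finite S \<and> S \<subseteq> carrier G \<and> \<not> S \<subseteq> {\<one>\<^bsub>G\<^esub>} \<longrightarrow>
      (\<exists>h\<in>hom (G\<lparr>carrier := generate G S\<rparr>) integer_group. \<exists>s\<in>S. h s \<noteq> 0))"
    have "indicable (G\<lparr>carrier := K\<rparr>)"
      if K: "subgroup K G" "K \<noteq> {\<one>\<^bsub>G\<^esub>}" "finitely_generated_group (G\<lparr>carrier := K\<rparr>)" for K
    proof -
      have gK: "group (G\<lparr>carrier := K\<rparr>)" using group.subgroup_imp_group[OF True K(1)] .
      obtain S where S: "finite S" "S \<subseteq> K" "generate (G\<lparr>carrier := K\<rparr>) S = K"
        using K(3) by (auto simp: finitely_generated_group_def)
      have gen: "generate G S = K" using generate_consistent[OF S(2) K(1)] S(3) by simp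
      have SG: "S \<subseteq> carrier G" using S(2) subgroup.subset[OF K(1)] by blast
      have "\<not> S \<subseteq> {\<one>\<^bsub>G\<^esub>}"
      proof
        assume "S \<subseteq> {\<one>\<^bsub>G\<^esub>}"
        then have "K \<subseteq> {\<one>\<^bsub>G\<^esub>}" using generate_subgroup_incl[OF _ triv_subgroup] gen by blast
        then show False using K(2) subgroup.one_closed[OF K(1)] by blast
      qed
      then obtain h s where h: "h \<in> hom (G\<lparr>carrier := K\<rparr>) integer_group" "s \<in> S" "h s \<noteq> 0"
        using R S(1) SG gen by metis
      then show ?thesis
        unfolding indicable_iff[OF gK] using hom_onto_integers[OF gK h(1), of s] S(2) by auto
    qed
    then show "locally_indicable G" using True by (simp add: locally_indicable_def)
  qed
qed (simp add: locally_indicable_def)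

lemma locally_indicableD:
  assumes "locally_indicable G" "finite S" "S \<subseteq> carrier G" "\<not> S \<subseteq> {\<one>\<^bsub>G\<^esub>}"
  obtains h s where "h \<in> hom (G\<lparr>carrier := generate G S\<rparr>) integer_group" "s \<in> S" "h s \<noteq> 0"
  using assms unfolding locally_indicable_iff by blast

lemma indicable_via_hom:
  assumes "group G" "group Q" "h \<in> hom G Q" "locally_indicable Q" "finite S" "S \<subseteq> carrier G" "\<not> h ` S \<subseteq> {\<one>\<^bsub>Q\<^esub>}"
  shows "\<exists>g\<in>hom (G\<lparr>carrier := generate G S\<rparr>) integer_group. \<exists>s\<in>S. g s \<noteq> 0"
proof -
  interpret group_hom G Q h using group_homI[OF assms(1-3)] .
  have hS: "h ` S \<subseteq> carrier Q" using assms(6) by auto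
  obtain g s where g: "g \<in> hom (Q\<lparr>carrier := generate Q (h ` S)\<rparr>) integer_group" "s \<in> h ` S" "g s \<noteq> 0"
    by (rule locally_indicableD[OF assms(4) finite_imageI[OF assms(5)] hS assms(7)])
  have "h \<in> hom (G\<lparr>carrier := generate G S\<rparr>) (Q\<lparr>carrier := generate Q (h ` S)\<rparr>)"
    using hom_subgroup_restrict[OF assms(3) G.generate_is_subgroup[OF assms(6)]]
      generate_img[OF assms(6)] by simp
  then have "g \<circ> h \<in> hom (G\<lparr>carrier := generate G S\<rparr>) integer_group"
    using g(1) by (rule Group.hom_compose)
  then show ?thesis using g(2,3) by (intro bexI[of _ "g \<circ> h"]) auto
qed

lemma locally_indicable_pullback:
  assumes "group H" "f \<in> hom H G" "inj_on f (carrier H)" "locally_indicable G"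
  shows "locally_indicable H"
proof -
  have G: "group G" using assms(4) by (simp add: locally_indicable_def)
  interpret group_hom H G f using group_homI[OF assms(1) G assms(2)] .
  have "\<not> f ` S \<subseteq> {\<one>\<^bsub>G\<^esub>}" if S: "S \<subseteq> carrier H" "\<not> S \<subseteq> {\<one>\<^bsub>H\<^esub>}" for S
  proof -
    obtain s where s: "s \<in> S" "s \<noteq> \<one>\<^bsub>H\<^esub>" using S by blast
    then have "f s \<noteq> f \<one>\<^bsub>H\<^esub>" using inj_onD[OF assms(3)] S(1) by blast
    then show ?thesis using s by auto
  qed
  then show ?thesis
    unfolding locally_indicable_iff using assms(1) indicable_via_hom[OF assms(1) G assms(2,4)] by simp
qed

lemma locally_indicable_subgroupD:
  assumes "group G" "subgroup K G" "locally_indicable (G\<lparr>carrier := K\<rparr>)" "finite S" "S \<subseteq> K" "\<not> S \<subseteq> {\<one>\<^bsub>G\<^esub>}"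
  shows "\<exists>g\<in>hom (G\<lparr>carrier := generate G S\<rparr>) integer_group. \<exists>s\<in>S. g s \<noteq> 0"
proof -
  have "generate (G\<lparr>carrier := K\<rparr>) S = generate G S"
    by (rule group.generate_consistent[OF assms(1,5,2)])
  then show ?thesis
    using locally_indicableD[OF assms(3,4)] assms(5,6) by simp metis
qed

text \<open>Either the finite set lies in the kernel, or its image is nontrivial and a homomorphism
  on the subgroup generated by the image pulls back.\<close>

lemma locally_indicable_ext:
  assumes "group G" "group Q" "h \<in> hom G Q"
    "locally_indicable (G\<lparr>carrier := kernel G Q h\<rparr>)" "locally_indicable Q"
  shows "locally_indicable G"
proof -
  have "\<exists>g\<in>hom (G\<lparr>carrier := generate G S\<rparr>) integer_group. \<exists>s\<in>S. g s \<noteq> 0"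
    if S: "finite S" "S \<subseteq> carrier G" "\<not> S \<subseteq> {\<one>\<^bsub>G\<^esub>}" for S
  proof (cases "h ` S \<subseteq> {\<one>\<^bsub>Q\<^esub>}")
    case True
    then have "S \<subseteq> kernel G Q h" using S(2) by (auto simp: kernel_def)
    then show ?thesis
      using locally_indicable_subgroupD[OF assms(1) subgroup_hom_kernel[OF assms(1-3)] assms(4) S(1)] S(3)
      by blast
  next
    case False
    then show ?thesis using indicable_via_hom[OF assms(1-3,5) S(1,2)] by blast
  qed
  then show ?thesis unfolding locally_indicable_iff using assms(1) by simp
qed

lemma locally_indicable_union:
  assumes "group G" "\<And>n. subgroup (K n) G" "incseq K" "(\<Union>n::nat. K n) = carrier G"
    and "\<And>n. locally_indicable (G\<lparr>carrier := K n\<rparr>)"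
  shows "locally_indicable G"
proof -
  have "\<exists>g\<in>hom (G\<lparr>carrier := generate G S\<rparr>) integer_group. \<exists>s\<in>S. g s \<noteq> 0"
    if S: "finite S" "S \<subseteq> carrier G" "\<not> S \<subseteq> {\<one>\<^bsub>G\<^esub>}" for S
  proof -
    have "\<exists>n. S \<subseteq> K n"
      using S(1,2)
    proof (induction S rule: finite_induct)
      case (insert x S)
      then obtain n where n: "S \<subseteq> K n" by auto
      obtain m where m: "x \<in> K m" using insert.prems assms(4) by blast
      have "K n \<subseteq> K (max n m)" "K m \<subseteq> K (max n m)"
        using incseqD[OF assms(3)] by simp_all
      then show ?case using n m by blast
    qed simp
    then obtain n where "S \<subseteq> K n" by blast
    then show ?thesis using locally_indicable_subgroupD[OF assms(1,2) assms(5) S(1)] S(3) by blast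
  qed
  then show ?thesis unfolding locally_indicable_iff using assms(1) by simp
qed

lemma locally_indicable_integers: "locally_indicable integer_group"
proof -
  have "(\<lambda>x. x) \<in> hom (integer_group\<lparr>carrier := K\<rparr>) integer_group" for K
    by (simp add: hom_def)
  then show ?thesis unfolding locally_indicable_iff by auto
qed

lemma locally_indicable_iso:
  assumes "group G" "group H" "G \<cong> H" "locally_indicable G"
  shows "locally_indicable H"
proof -
  obtain f where "f \<in> hom H G" "inj_on f (carrier H)" using iso_pullback[OF assms(1,3)] by blast
  then show ?thesis by (rule locally_indicable_pullback[OF assms(2) _ _ assms(4)])
qed

interpretation locally_indicable: extension_closed_class locally_indicable
  by unfold_locales (rule locally_indicable_iso, assumption+, rule locally_indicable_union, assumption+, rule locally_indicable_ext, assumption+)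


section \<open>Orderability\<close>

text \<open>The set of elements above the unit. That it never contains an element together with its
  inverse follows from closure under products and the absence of the unit.\<close>

definition pos_cone :: "'a monoid \<Rightarrow> 'a set \<Rightarrow> bool" where
  "pos_cone G C \<longleftrightarrow> C \<subseteq> carrier G \<and> \<one>\<^bsub>G\<^esub> \<notin> C \<and> (\<forall>x\<in>C. \<forall>y\<in>C. x \<otimes>\<^bsub>G\<^esub> y \<in> C) \<and>
     (\<forall>x\<in>carrier G. x \<noteq> \<one>\<^bsub>G\<^esub> \<longrightarrow> x \<in> C \<or> inv\<^bsub>G\<^esub> x \<in> C)"

definition normal_cone :: "'a monoid \<Rightarrow> 'a set \<Rightarrow> bool" where
  "normal_cone G C \<longleftrightarrow> pos_cone G C \<and>
     (\<forall>g\<in>carrier G. \<forall>x\<in>C. g \<otimes>\<^bsub>G\<^esub> x \<otimes>\<^bsub>G\<^esub> inv\<^bsub>G\<^esub> g \<in> C)"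

text \<open>The inverse stands on the right because the quotient of \<open>y \<otimes> z\<close> by
  \<open>x \<otimes> z\<close> is then that of \<open>y\<close> by \<open>x\<close>: right
  invariance is automatic.\<close>

definition cone_order :: "'a monoid \<Rightarrow> 'a set \<Rightarrow> 'a rel" where
  "cone_order G C = {(x, y). x \<in> carrier G \<and> y \<in> carrier G \<and> (x = y \<or> y \<otimes>\<^bsub>G\<^esub> inv\<^bsub>G\<^esub> x \<in> C)}"

lemma cone_order_linear:
  fixes G :: "'a monoid" (structure)
  assumes "group G" "pos_cone G C"
  shows "linear_order_on (carrier G) (cone_order G C)"
    and "\<lbrakk>(x, y) \<in> cone_order G C; z \<in> carrier G\<rbrakk> \<Longrightarrow> (x \<otimes> z, y \<otimes> z) \<in> cone_order G C"
proof -
  interpret group G by fact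
  have C: "C \<subseteq> carrier G" "\<one> \<notin> C" "\<And>x y. x \<in> C \<Longrightarrow> y \<in> C \<Longrightarrow> x \<otimes> y \<in> C"
    "\<And>x. x \<in> carrier G \<Longrightarrow> x \<noteq> \<one> \<Longrightarrow> x \<in> C \<or> inv x \<in> C"
    using assms(2) by (auto simp: pos_cone_def)
  have "trans (cone_order G C)"
  proof (rule transI)
    fix x y z assume xyz: "(x, y) \<in> cone_order G C" "(y, z) \<in> cone_order G C"
    then have mem: "x \<in> carrier G" "y \<in> carrier G" "z \<in> carrier G" by (auto simp: cone_order_def)
    have "(z \<otimes> inv y) \<otimes> (y \<otimes> inv x) = z \<otimes> inv x"
      using mem by (simp add: m_assoc) (simp add: m_assoc[symmetric])
    then show "(x, z) \<in> cone_order G C"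
      using xyz C(3)[of "z \<otimes> inv y" "y \<otimes> inv x"] by (auto simp: cone_order_def)
  qed
  moreover have "antisym (cone_order G C)"
  proof (rule antisymI)
    fix x y assume xy: "(x, y) \<in> cone_order G C" "(y, x) \<in> cone_order G C"
    then have mem: "x \<in> carrier G" "y \<in> carrier G" by (auto simp: cone_order_def)
    have "(x \<otimes> inv y) \<otimes> (y \<otimes> inv x) = \<one>"
      using mem by (simp add: m_assoc) (simp add: m_assoc[symmetric])
    then show "x = y"
      using xy C(2) C(3)[of "x \<otimes> inv y" "y \<otimes> inv x"] by (auto simp: cone_order_def)
  qed
  moreover have "total_on (carrier G) (cone_order G C)"
  proof (rule total_onI)
    fix x y assume xy: "x \<in> carrier G" "y \<in> carrier G" "x \<noteq> y"
    have "y \<otimes> inv x \<noteq> \<one>"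
      using xy by (metis inv_closed inv_inv inv_equality)
    moreover have "inv (y \<otimes> inv x) = x \<otimes> inv y" using xy by (simp add: inv_mult_group)
    ultimately show "(x, y) \<in> cone_order G C \<or> (y, x) \<in> cone_order G C"
      using C(4)[of "y \<otimes> inv x"] xy by (auto simp: cone_order_def)
  qed
  ultimately show "linear_order_on (carrier G) (cone_order G C)"
    by (auto simp: order_on_defs refl_on_def cone_order_def)
  assume xy: "(x, y) \<in> cone_order G C" and z: "z \<in> carrier G"
  then have mem: "x \<in> carrier G" "y \<in> carrier G" by (auto simp: cone_order_def)
  have "(y \<otimes> z) \<otimes> inv (x \<otimes> z) = y \<otimes> (z \<otimes> inv z) \<otimes> inv x"
    using mem z by (simp only: inv_mult_group m_assoc m_closed inv_closed)
  then have "(y \<otimes> z) \<otimes> inv (x \<otimes> z) = y \<otimes> inv x" using mem z by simp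
  then show "(x \<otimes> z, y \<otimes> z) \<in> cone_order G C"
    using xy z by (auto simp: cone_order_def)
qed

lemma order_cone:
  fixes G :: "'a monoid" (structure)
  assumes "group G" "linear_order_on (carrier G) r"
    and right: "\<And>x y z. \<lbrakk>x \<in> carrier G; y \<in> carrier G; z \<in> carrier G; (x, y) \<in> r\<rbrakk> \<Longrightarrow> (x \<otimes> z, y \<otimes> z) \<in> r"
  shows "pos_cone G {x \<in> carrier G. x \<noteq> \<one> \<and> (\<one>, x) \<in> r}"
proof -
  interpret group G by fact
  have r: "antisym r" "trans r" "total_on (carrier G) r"
    using assms(2) by (auto simp: order_on_defs)
  have mult: "x \<otimes> y \<noteq> \<one> \<and> (\<one>, x \<otimes> y) \<in> r"
    if x: "x \<in> carrier G" "x \<noteq> \<one>" "(\<one>, x) \<in> r" and y: "y \<in> carrier G" "y \<noteq> \<one>" "(\<one>, y) \<in> r" for x y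
  proof -
    have "(y, x \<otimes> y) \<in> r" using right[OF one_closed x(1) y(1) x(3)] y(1) by simp
    then show ?thesis using y transD[OF r(2) y(3)] antisymD[OF r(1) y(3)] by metis
  qed
  moreover have "(\<one>, x) \<in> r \<or> (\<one>, inv x) \<in> r" if x: "x \<in> carrier G" "x \<noteq> \<one>" for x
    using r(3)[unfolded total_on_def, rule_format, OF x(1) one_closed x(2)] right[OF x(1) one_closed inv_closed[OF x(1)]] x(1) by auto
  moreover have "inv x \<noteq> \<one>" if "x \<in> carrier G" "x \<noteq> \<one>" for x
    using that by (metis inv_inv inv_one)
  ultimately show ?thesis unfolding pos_cone_def by auto
qed

text \<open>Cones are sets of elements and are easier than relations to pull back, to combine along
  extensions and to glue along chains.\<close>

lemma right_orderable_iff: "right_orderable G \<longleftrightarrow> group G \<and> (\<exists>C. pos_cone G C)"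
proof
  assume "right_orderable G"
  then show "group G \<and> (\<exists>C. pos_cone G C)"
    unfolding right_orderable_def using order_cone[of G] by blast
next
  assume "group G \<and> (\<exists>C. pos_cone G C)"
  then show "right_orderable G"
    unfolding right_orderable_def using cone_order_linear[of G] by blast
qed

text \<open>Multiplying \<open>x\<close> and \<open>y\<close> by \<open>z\<close> on the left
  conjugates \<open>y \<otimes> inv x\<close> by \<open>z\<close>, so left invariance of the cone
  order amounts to closure of the cone under conjugation.\<close>

lemma orderable_iff: "orderable G \<longleftrightarrow> group G \<and> (\<exists>C. normal_cone G C)"
proof
  assume "orderable G"
  then obtain r where G: "group G" and r: "linear_order_on (carrier G) r"
    and inv: "\<And>x y z. \<lbrakk>x \<in> carrier G; y \<in> carrier G; z \<in> carrier G; (x, y) \<in> r\<rbrakk> \<Longrightarrow>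
      (x \<otimes>\<^bsub>G\<^esub> z, y \<otimes>\<^bsub>G\<^esub> z) \<in> r \<and> (z \<otimes>\<^bsub>G\<^esub> x, z \<otimes>\<^bsub>G\<^esub> y) \<in> r"
    unfolding orderable_def by blast
  interpret group G by fact
  have "g \<otimes>\<^bsub>G\<^esub> x \<otimes>\<^bsub>G\<^esub> inv\<^bsub>G\<^esub> g \<noteq> \<one>\<^bsub>G\<^esub> \<and> (\<one>\<^bsub>G\<^esub>, g \<otimes>\<^bsub>G\<^esub> x \<otimes>\<^bsub>G\<^esub> inv\<^bsub>G\<^esub> g) \<in> r"
    if g: "g \<in> carrier G" and x: "x \<in> carrier G" "x \<noteq> \<one>\<^bsub>G\<^esub>" "(\<one>\<^bsub>G\<^esub>, x) \<in> r" for g x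
  proof
    have "(g, g \<otimes>\<^bsub>G\<^esub> x) \<in> r" using inv[OF one_closed x(1) g x(3)] g by simp
    then have "(g \<otimes>\<^bsub>G\<^esub> inv\<^bsub>G\<^esub> g, g \<otimes>\<^bsub>G\<^esub> x \<otimes>\<^bsub>G\<^esub> inv\<^bsub>G\<^esub> g) \<in> r"
      using inv[OF g m_closed[OF g x(1)] inv_closed[OF g]] by blast
    then show "(\<one>\<^bsub>G\<^esub>, g \<otimes>\<^bsub>G\<^esub> x \<otimes>\<^bsub>G\<^esub> inv\<^bsub>G\<^esub> g) \<in> r" using g by simp
    show "g \<otimes>\<^bsub>G\<^esub> x \<otimes>\<^bsub>G\<^esub> inv\<^bsub>G\<^esub> g \<noteq> \<one>\<^bsub>G\<^esub>"
    proof
      assume "g \<otimes>\<^bsub>G\<^esub> x \<otimes>\<^bsub>G\<^esub> inv\<^bsub>G\<^esub> g = \<one>\<^bsub>G\<^esub>"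
      then have "g \<otimes>\<^bsub>G\<^esub> x = g" using g x(1)
        by (metis inv_closed inv_equality inv_inv m_closed)
      then show False using g x by simp
    qed
  qed
  moreover have "pos_cone G {x \<in> carrier G. x \<noteq> \<one>\<^bsub>G\<^esub> \<and> (\<one>\<^bsub>G\<^esub>, x) \<in> r}"
    using order_cone[OF G r] inv by blast
  ultimately have "normal_cone G {x \<in> carrier G. x \<noteq> \<one>\<^bsub>G\<^esub> \<and> (\<one>\<^bsub>G\<^esub>, x) \<in> r}"
    by (auto simp: normal_cone_def)
  then show "group G \<and> (\<exists>C. normal_cone G C)" using G by blast
next
  assume "group G \<and> (\<exists>C. normal_cone G C)"
  then obtain C where G: "group G" and C: "pos_cone G C"
    and conj: "\<And>g x. g \<in> carrier G \<Longrightarrow> x \<in> C \<Longrightarrow> g \<otimes>\<^bsub>G\<^esub> x \<otimes>\<^bsub>G\<^esub> inv\<^bsub>G\<^esub> g \<in> C"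
    by (auto simp: normal_cone_def)
  interpret group G by fact
  have "(z \<otimes>\<^bsub>G\<^esub> x, z \<otimes>\<^bsub>G\<^esub> y) \<in> cone_order G C" if xy: "(x, y) \<in> cone_order G C" and z: "z \<in> carrier G" for x y z
  proof -
    have mem: "x \<in> carrier G" "y \<in> carrier G" using xy by (auto simp: cone_order_def)
    have "(z \<otimes>\<^bsub>G\<^esub> y) \<otimes>\<^bsub>G\<^esub> inv\<^bsub>G\<^esub> (z \<otimes>\<^bsub>G\<^esub> x) = z \<otimes>\<^bsub>G\<^esub> (y \<otimes>\<^bsub>G\<^esub> inv\<^bsub>G\<^esub> x) \<otimes>\<^bsub>G\<^esub> inv\<^bsub>G\<^esub> z"
      using mem z by (simp only: inv_mult_group m_assoc m_closed inv_closed)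
    then show ?thesis using xy z conj[OF z, of "y \<otimes>\<^bsub>G\<^esub> inv\<^bsub>G\<^esub> x"] by (auto simp: cone_order_def)
  qed
  then show "orderable G"
    unfolding orderable_def using G cone_order_linear[OF G C]
    by (intro conjI exI[of _ "cone_order G C"]) auto
qed

lemma cone_pullback:
  assumes "group H" "group G" "f \<in> hom H G" "inj_on f (carrier H)"
  shows "pos_cone G C \<Longrightarrow> pos_cone H {y \<in> carrier H. f y \<in> C}"
    and "normal_cone G C \<Longrightarrow> normal_cone H {y \<in> carrier H. f y \<in> C}"
proof -
  interpret group_hom H G f using group_homI[OF assms(1-3)] .
  have "f x \<noteq> \<one>\<^bsub>G\<^esub>" if "x \<in> carrier H" "x \<noteq> \<one>\<^bsub>H\<^esub>" for x
    using inj_onD[OF assms(4), of x "\<one>\<^bsub>H\<^esub>"] that by auto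
  then show pos: "pos_cone G C \<Longrightarrow> pos_cone H {y \<in> carrier H. f y \<in> C}"
    by (auto simp: pos_cone_def)
  show "normal_cone G C \<Longrightarrow> normal_cone H {y \<in> carrier H. f y \<in> C}"
    using pos by (auto simp: normal_cone_def)
qed

lemma right_orderable_pullback:
  assumes "group H" "f \<in> hom H G" "inj_on f (carrier H)" "right_orderable G"
  shows "right_orderable H"
  using assms cone_pullback[OF assms(1) _ assms(2,3)] unfolding right_orderable_iff by blast

lemma orderable_pullback:
  assumes "group H" "f \<in> hom H G" "inj_on f (carrier H)" "orderable G"
  shows "orderable H"
  using assms cone_pullback[OF assms(1) _ assms(2,3)] unfolding orderable_iff by blast

lemma cone_subgroup:
  assumes "group G" "subgroup K G"
  shows "pos_cone (G\<lparr>carrier := K\<rparr>) C \<longleftrightarrow> C \<subseteq> K \<and> \<one>\<^bsub>G\<^esub> \<notin> C \<and> (\<forall>x\<in>C. \<forall>y\<in>C. x \<otimes>\<^bsub>G\<^esub> y \<in> C) \<and>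
     (\<forall>x\<in>K. x \<noteq> \<one>\<^bsub>G\<^esub> \<longrightarrow> x \<in> C \<or> inv\<^bsub>G\<^esub> x \<in> C)"
    and "normal_cone (G\<lparr>carrier := K\<rparr>) C \<longleftrightarrow> pos_cone (G\<lparr>carrier := K\<rparr>) C \<and>
     (\<forall>g\<in>K. \<forall>x\<in>C. g \<otimes>\<^bsub>G\<^esub> x \<otimes>\<^bsub>G\<^esub> inv\<^bsub>G\<^esub> g \<in> C)"
  by (simp_all add: pos_cone_def normal_cone_def group.m_inv_consistent[OF assms])

text \<open>The lexicographic cone, with the quotient deciding first. Conjugation by elements
  outside the kernel may disturb the cone \<open>A\<close>, which is why this construction does not
  yield two-sided orders.\<close>

lemma right_orderable_ext:
  assumes "group G" "group Q" "h \<in> hom G Q"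
    "right_orderable (G\<lparr>carrier := kernel G Q h\<rparr>)" "right_orderable Q"
  shows "right_orderable G"
proof -
  interpret group_hom G Q h using group_homI[OF assms(1-3)] .
  obtain A where A: "A \<subseteq> kernel G Q h" "\<one>\<^bsub>G\<^esub> \<notin> A" "\<And>x y. x \<in> A \<Longrightarrow> y \<in> A \<Longrightarrow> x \<otimes>\<^bsub>G\<^esub> y \<in> A"
    "\<And>x. x \<in> kernel G Q h \<Longrightarrow> x \<noteq> \<one>\<^bsub>G\<^esub> \<Longrightarrow> x \<in> A \<or> inv\<^bsub>G\<^esub> x \<in> A"
    using assms(4) unfolding right_orderable_iff cone_subgroup(1)[OF assms(1) subgroup_kernel] by blast
  obtain B where B: "B \<subseteq> carrier Q" "\<one>\<^bsub>Q\<^esub> \<notin> B" "\<And>x y. x \<in> B \<Longrightarrow> y \<in> B \<Longrightarrow> x \<otimes>\<^bsub>Q\<^esub> y \<in> B"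
    "\<And>x. x \<in> carrier Q \<Longrightarrow> x \<noteq> \<one>\<^bsub>Q\<^esub> \<Longrightarrow> x \<in> B \<or> inv\<^bsub>Q\<^esub> x \<in> B"
    using assms(5) unfolding right_orderable_iff pos_cone_def by blast
  have A': "x \<in> carrier G" "h x = \<one>\<^bsub>Q\<^esub>" if "x \<in> A" for x using A(1) that by (auto simp: kernel_def)
  define C where "C = {x \<in> carrier G. h x \<in> B \<or> x \<in> A}"
  have "x \<otimes>\<^bsub>G\<^esub> y \<in> C" if xy: "x \<in> C" "y \<in> C" for x y
  proof -
    have mem: "x \<in> carrier G" "y \<in> carrier G" "h x \<in> carrier Q" "h y \<in> carrier Q"
      using xy by (auto simp: C_def)
    consider "h x \<in> B" "h y \<in> B" | "h x \<in> B" "y \<in> A" | "x \<in> A" "h y \<in> B" | "x \<in> A" "y \<in> A"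
      using xy by (auto simp: C_def)
    then show ?thesis
      by cases (use mem A' A(3) B(3) in \<open>auto simp: C_def\<close>)
  qed
  moreover have "x \<in> C \<or> inv\<^bsub>G\<^esub> x \<in> C" if x: "x \<in> carrier G" "x \<noteq> \<one>\<^bsub>G\<^esub>" for x
  proof (cases "h x = \<one>\<^bsub>Q\<^esub>")
    case True
    then show ?thesis using A(4)[of x] x by (auto simp: C_def kernel_def)
  next
    case False
    then show ?thesis using B(4)[of "h x"] x by (auto simp: C_def)
  qed
  moreover have "\<one>\<^bsub>G\<^esub> \<notin> C" using A(2) B(2) by (simp add: C_def)
  ultimately have "pos_cone G C" by (auto simp: pos_cone_def C_def)
  then show ?thesis using assms(1) unfolding right_orderable_iff by blast
qed

text \<open>An element is positive if it is so at \<open>ultra\<close>-almost all levels. The cones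
  at different levels may disagree; the ultrafilter still decides for each nontrivial element
  whether it or its inverse wins.\<close>

lemma cone_union:
  assumes G: "group G" and K: "\<And>n::nat. subgroup (K n) G" "incseq K" "(\<Union>n. K n) = carrier G"
    and C: "\<And>n. pos_cone (G\<lparr>carrier := K n\<rparr>) (C n)"
  defines "D \<equiv> {x \<in> carrier G. eventually (\<lambda>n. x \<in> C n) ultra}"
  shows "pos_cone G D"
    and "(\<And>n. normal_cone (G\<lparr>carrier := K n\<rparr>) (C n)) \<Longrightarrow> normal_cone G D"
proof -
  interpret group G by fact
  have ev: "eventually (\<lambda>n. x \<in> K n) ultra" if "x \<in> carrier G" for x
  proof -
    have "x \<in> (\<Union>n. K n)" using that by (simp add: K(3))
    then obtain m where "x \<in> K m" by blast
    then have "x \<in> K n" if "n \<ge> m" for n using incseqD[OF K(2) that] by blast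
    then show ?thesis by (intro eventually_ultra eventually_sequentiallyI)
  qed
  note C' = C[unfolded cone_subgroup(1)[OF G K(1)]]
  have "\<one>\<^bsub>G\<^esub> \<notin> D" using C' ultra_ne_bot by (simp add: D_def)
  moreover have "x \<otimes>\<^bsub>G\<^esub> y \<in> D" if "x \<in> D" "y \<in> D" for x y
  proof -
    have "eventually (\<lambda>n. x \<in> C n \<and> y \<in> C n) ultra"
      using that by (auto simp: D_def eventually_conj_iff)
    then have "eventually (\<lambda>n. x \<otimes>\<^bsub>G\<^esub> y \<in> C n) ultra"
      by (rule eventually_mono) (use C' in blast)
    then show ?thesis using that by (simp add: D_def)
  qed
  moreover have "x \<in> D \<or> inv\<^bsub>G\<^esub> x \<in> D" if x: "x \<in> carrier G" "x \<noteq> \<one>\<^bsub>G\<^esub>" for x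
  proof (cases "x \<in> D")
    case False
    then have "eventually (\<lambda>n. x \<notin> C n) ultra"
      using ultra_cases[of "\<lambda>n. x \<in> C n"] x by (auto simp: D_def)
    then have "eventually (\<lambda>n. x \<notin> C n \<and> x \<in> K n) ultra"
      using ev[OF x(1)] by (simp add: eventually_conj_iff)
    then have "eventually (\<lambda>n. inv\<^bsub>G\<^esub> x \<in> C n) ultra"
      by (rule eventually_mono) (use C' x in blast)
    then show ?thesis using x by (simp add: D_def)
  qed simp
  ultimately show pos: "pos_cone G D" by (auto simp: pos_cone_def D_def)
  assume N: "\<And>n. normal_cone (G\<lparr>carrier := K n\<rparr>) (C n)"
  have "g \<otimes>\<^bsub>G\<^esub> x \<otimes>\<^bsub>G\<^esub> inv\<^bsub>G\<^esub> g \<in> D" if g: "g \<in> carrier G" and x: "x \<in> D" for g x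
  proof -
    have "eventually (\<lambda>n. x \<in> C n \<and> g \<in> K n) ultra"
      using x ev[OF g] by (auto simp: D_def eventually_conj_iff)
    then have "eventually (\<lambda>n. g \<otimes>\<^bsub>G\<^esub> x \<otimes>\<^bsub>G\<^esub> inv\<^bsub>G\<^esub> g \<in> C n) ultra"
      by (rule eventually_mono) (use N[unfolded cone_subgroup(2)[OF G K(1)]] in blast)
    then show ?thesis using x g by (simp add: D_def)
  qed
  then show "normal_cone G D" using pos by (simp add: normal_cone_def)
qed

lemma right_orderable_union:
  assumes "group G" "\<And>n::nat. subgroup (K n) G" "incseq K" "(\<Union>n. K n) = carrier G"
    and "\<And>n. right_orderable (G\<lparr>carrier := K n\<rparr>)"
  shows "right_orderable G"
proof -
  obtain C where "\<And>n. pos_cone (G\<lparr>carrier := K n\<rparr>) (C n)"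
    using assms(5) unfolding right_orderable_iff by metis
  then show ?thesis using cone_union(1)[OF assms(1-4)] assms(1) unfolding right_orderable_iff by blast
qed

lemma orderable_union:
  assumes "group G" "\<And>n::nat. subgroup (K n) G" "incseq K" "(\<Union>n. K n) = carrier G"
    and "\<And>n. orderable (G\<lparr>carrier := K n\<rparr>)"
  shows "orderable G"
proof -
  obtain C where C: "\<And>n. normal_cone (G\<lparr>carrier := K n\<rparr>) (C n)"
    using assms(5) unfolding orderable_iff by metis
  then have "\<And>n. pos_cone (G\<lparr>carrier := K n\<rparr>) (C n)" by (simp add: normal_cone_def)
  then show ?thesis using cone_union(2)[OF assms(1-4) _ C] assms(1) unfolding orderable_iff by blast
qed

lemma right_orderable_integers: "right_orderable integer_group"
proof -
  have "pos_cone integer_group {0<..}" by (auto simp: pos_cone_def)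
  then show ?thesis unfolding right_orderable_iff by auto
qed

lemma right_orderable_iso:
  assumes "group G" "group H" "G \<cong> H" "right_orderable G"
  shows "right_orderable H"
proof -
  obtain f where "f \<in> hom H G" "inj_on f (carrier H)" using iso_pullback[OF assms(1,3)] by blast
  then show ?thesis by (rule right_orderable_pullback[OF assms(2) _ _ assms(4)])
qed

interpretation right_orderable: extension_closed_class right_orderable
  by unfold_locales (rule right_orderable_iso, assumption+, rule right_orderable_union, assumption+, rule right_orderable_ext, assumption+)

lemma orderable_iso:
  assumes "group G" "group H" "G \<cong> H" "orderable G"
  shows "orderable H"
proof -
  obtain f where "f \<in> hom H G" "inj_on f (carrier H)" using iso_pullback[OF assms(1,3)] by blast
  then show ?thesis by (rule orderable_pullback[OF assms(2) _ _ assms(4)])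
qed

interpretation orderable: union_closed_class orderable
  by unfold_locales (rule orderable_iso, assumption+, rule orderable_union, assumption+)


section \<open>Elementary closures\<close>

lemma elementary_closure_group: "elementary_closure B G \<Longrightarrow> group G"
  by (induction rule: elementary_closure.induct) (auto intro: group.subgroup_imp_group)

text \<open>The rules of \<open>elementary_closure\<close> speak of normal subgroups and factor
  groups, the closure locales of surjective homomorphisms; this lemma and the next translate between
  the two.\<close>

lemma kernel_quotient_iso:
  assumes "group G" "group Q" "h \<in> hom G Q" "h ` carrier G = carrier Q"
  shows "kernel G Q h \<lhd> G" "Q \<cong> G Mod kernel G Q h"
proof -
  interpret group_hom G Q h using group_homI[OF assms(1-3)] .
  show "kernel G Q h \<lhd> G" by (rule normal_kernel)
  show "Q \<cong> G Mod kernel G Q h"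
    by (rule group.iso_sym[OF normal.factorgroup_is_group[OF normal_kernel] FactGroup_iso[OF assms(4)]])
qed

lemma quotient_hom:
  assumes "N \<lhd> G" "group Q" "Q \<cong> G Mod N"
  shows "\<exists>h. h \<in> hom G Q \<and> h ` carrier G = carrier Q \<and> kernel G Q h = N"
proof -
  interpret normal N G by fact
  obtain f where f: "f \<in> iso (G Mod N) Q"
    using group.iso_sym[OF assms(2,3)] by (auto simp: is_iso_def)
  let ?h = "\<lambda>a. f (N #>\<^bsub>G\<^esub> a)"
  have "?h \<in> hom G Q"
    using Group.hom_compose[OF r_coset_hom_Mod, of f Q] f by (simp add: iso_def comp_def)
  moreover have onto: "?h ` carrier G = carrier Q"
  proof -
    have "?h ` carrier G = f ` carrier (G Mod N)" by (auto simp: carrier_FactGroup)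
    then show ?thesis using f by (simp add: iso_def bij_betw_def)
  qed
  moreover have "kernel G Q ?h = N"
  proof -
    have f1: "f \<one>\<^bsub>G Mod N\<^esub> = \<one>\<^bsub>Q\<^esub>"
      using f hom_one[OF _ factorgroup_is_group assms(2)] by (simp add: iso_def)
    have inj: "inj_on f (carrier (G Mod N))" using f by (simp add: iso_def bij_betw_def)
    have "?h a = \<one>\<^bsub>Q\<^esub> \<longleftrightarrow> a \<in> N" if a: "a \<in> carrier G" for a
    proof -
      have c: "N #>\<^bsub>G\<^esub> a \<in> carrier (G Mod N)" using a by (auto simp: carrier_FactGroup)
      have o: "\<one>\<^bsub>G Mod N\<^esub> \<in> carrier (G Mod N)"
        by (rule monoid.one_closed[OF group.is_monoid[OF factorgroup_is_group]])
      have "?h a = \<one>\<^bsub>Q\<^esub> \<longleftrightarrow> N #>\<^bsub>G\<^esub> a = \<one>\<^bsub>G Mod N\<^esub>"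
        using inj_on_eq_iff[OF inj c o] f1 by simp
      also have "\<dots> \<longleftrightarrow> N #>\<^bsub>G\<^esub> a = N" by simp
      also have "\<dots> \<longleftrightarrow> a \<in> N"
        using coset_join1[OF _ a] coset_join2[OF a] is_subgroup subset by blast
      finally show ?thesis .
    qed
    then show ?thesis by (auto simp: kernel_def)
  qed
  ultimately show ?thesis by (intro exI[of _ ?h]) simp
qed

lemma elementary_closure_image:
  assumes "elementary_closure B G" "group Q" "h \<in> hom G Q" "h ` carrier G = carrier Q"
  shows "elementary_closure B Q"
  using elementary_closure.quotient[OF assms(1) kernel_quotient_iso(1) assms(2) kernel_quotient_iso(2)]
    elementary_closure_group[OF assms(1)] assms(2-4) by blast

lemma elementary_closure_iso:
  assumes "group G" "group H" "G \<cong> H" "elementary_closure B G"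
  shows "elementary_closure B H"
proof -
  obtain f where "f \<in> iso G H" using assms(3) by (auto simp: is_iso_def)
  then show ?thesis
    using elementary_closure_image[OF assms(4,2), of f] by (simp add: iso_def bij_betw_def)
qed

lemma elementary_closure_ext:
  assumes "group G" "group Q" "h \<in> hom G Q" "h ` carrier G = carrier Q"
    and "elementary_closure B (G\<lparr>carrier := kernel G Q h\<rparr>)" "elementary_closure B Q"
  shows "elementary_closure B G"
  by (rule elementary_closure.extension[OF assms(1) kernel_quotient_iso(1)[OF assms(1-4)] assms(5,6)
        kernel_quotient_iso(2)[OF assms(1-4)]])

text \<open>For a group on \<open>nat\<close>, the index set of the chain has the type that the rule
  \<open>direct_limit\<close> demands.\<close>

lemma elementary_closure_union:
  fixes G :: "nat monoid"
  assumes "group G" "\<And>n::nat. subgroup (K n) G" "incseq K" "(\<Union>n. K n) = carrier G"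
    and "\<And>n. elementary_closure B (G\<lparr>carrier := K n\<rparr>)"
  shows "elementary_closure B G"
  by (rule elementary_closure.direct_limit[OF iso_direct_limit_union(1)[OF assms(1-4)] assms(5) assms(1)
        iso_direct_limit_union(2)[OF assms(1-4)]])

interpretation elementary_closure: extension_closed_class "elementary_closure B" for B
  by unfold_locales (rule elementary_closure_iso, assumption+, rule elementary_closure_union, assumption+,
      rule elementary_closure_ext, assumption+)

lemma copy_elementary_subgroup:
  assumes "has_copy (elementary_closure B) G" "subgroup K G"
  shows "has_copy (elementary_closure B) (G\<lparr>carrier := K\<rparr>)"
proof -
  note G = has_copyD[OF assms(1)]
  let ?e = "to_nat_on (carrier G)"
  have e: "?e \<in> iso G (nat_copy G)" and M: "group (nat_copy G)"
    using nat_copy_iso nat_copy_group G by blast+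
  have "subgroup (?e ` K) (nat_copy G)"
    using subgroup_hom_image[OF G(1) M _ assms(2)] e by (simp add: iso_def)
  then have "elementary_closure B ((nat_copy G)\<lparr>carrier := ?e ` K\<rparr>)"
    by (rule elementary_closure.subgroup[OF G(3)])
  then show ?thesis using elementary_closure.copy_subgroup_iff[OF G(1) M e assms(2)] by blast
qed

lemma copy_elementary_image:
  assumes "has_copy (elementary_closure B) G" "group Q" "h \<in> hom G Q" "h ` carrier G = carrier Q"
  shows "has_copy (elementary_closure B) Q"
proof -
  note G = has_copyD[OF assms(1)]
  have cQ: "countable (carrier Q)" using G(2) assms(4) by (metis countable_image)
  let ?i = "inv_into (carrier G) (to_nat_on (carrier G))" and ?d = "to_nat_on (carrier Q)"
  have i: "?i \<in> iso (nat_copy G) G"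
    by (rule group.iso_set_sym[OF G(1) nat_copy_iso[OF G(1,2)]])
  have d: "?d \<in> iso Q (nat_copy Q)" by (rule nat_copy_iso[OF assms(2) cQ])
  have "?d \<circ> (h \<circ> ?i) \<in> hom (nat_copy G) (nat_copy Q)"
    by (rule Group.hom_compose[OF Group.hom_compose[OF _ assms(3)]]) (use i d in \<open>auto simp: iso_def\<close>)
  moreover have "(?d \<circ> (h \<circ> ?i)) ` carrier (nat_copy G) = carrier (nat_copy Q)"
    using i d assms(4) by (simp add: iso_def bij_betw_def image_comp[symmetric] del: comp_apply)
  ultimately have "elementary_closure B (nat_copy Q)"
    using elementary_closure_image[OF G(3) nat_copy_group[OF assms(2) cQ]] by blast
  then show ?thesis using assms(2) cQ by (simp add: has_copy_def)
qed

section \<open>From derivations on an arbitrary type to derivations on the natural numbers\<close>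

text \<open>Every element is the value of a word in the generators and their inverses, and a
  countable alphabet has countably many words.\<close>

lemma countable_generate:
  assumes "group G" "S \<subseteq> carrier G" "countable S"
  shows "countable (generate G S)"
proof -
  interpret group G by fact
  let ?T = "S \<union> (\<lambda>x. inv\<^bsub>G\<^esub> x) ` S"
  let ?w = "\<lambda>xs. foldr (\<otimes>\<^bsub>G\<^esub>) xs \<one>\<^bsub>G\<^esub>"
  have T: "?T \<subseteq> carrier G" using assms(2) by auto
  have closed: "?w xs \<in> carrier G" if "xs \<in> lists ?T" for xs
    using that by (induction rule: lists.induct) (use T in \<open>auto simp: subset_iff\<close>)
  have app: "?w (xs @ ys) = ?w xs \<otimes>\<^bsub>G\<^esub> ?w ys" if "xs \<in> lists ?T" "ys \<in> lists ?T" for xs ys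
    using that(1)
  proof (induction rule: lists.induct)
    case (Cons a l)
    then have "a \<in> carrier G" using T by blast
    then show ?case using Cons closed[of l] closed[OF that(2)] by (simp add: m_assoc)
  qed (use closed[OF that(2)] in simp)
  have "generate G S \<subseteq> ?w ` lists ?T"
  proof
    fix x assume "x \<in> generate G S"
    then show "x \<in> ?w ` lists ?T"
    proof induction
      case one
      show ?case by (rule image_eqI[of _ _ "[]"]) auto
    next
      case (incl h)
      then show ?case using assms(2) by (intro image_eqI[of _ _ "[h]"]) auto
    next
      case (inv h)
      then show ?case using assms(2) by (intro image_eqI[of _ _ "[inv\<^bsub>G\<^esub> h]"]) auto
    next
      case (eng h1 h2)
      then obtain xs ys where "xs \<in> lists ?T" "ys \<in> lists ?T" "h1 = ?w xs" "h2 = ?w ys" by blast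
      then show ?case using app by (intro image_eqI[of _ _ "xs @ ys"]) auto
    qed
  qed
  moreover have "countable (lists ?T)" using assms(3) by (intro countable_lists) auto
  ultimately show ?thesis by (meson countable_image countable_subset)
qed

text \<open>The invariant for the induction on derivations: an uncountable group has no copy on the
  natural numbers, but its countable subgroups do.\<close>

definition locally_in :: "(nat monoid \<Rightarrow> bool) \<Rightarrow> 'a monoid \<Rightarrow> bool" where
  "locally_in B G \<longleftrightarrow>
     (\<forall>K. subgroup K G \<and> countable K \<longrightarrow> has_copy (elementary_closure B) (G\<lparr>carrier := K\<rparr>))"

lemma locally_inD:
  "locally_in B G \<Longrightarrow> subgroup K G \<Longrightarrow> countable K \<Longrightarrow> has_copy (elementary_closure B) (G\<lparr>carrier := K\<rparr>)"
  by (simp add: locally_in_def)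

text \<open>A countable subgroup of the image lifts: chosen preimages of its elements generate a
  countable subgroup of \<open>G\<close> that maps onto it.\<close>

lemma locally_in_image:
  assumes G: "group G" "locally_in B G" and L: "group L" and h: "h \<in> hom G L"
    and K: "subgroup K L" "countable K" "K \<subseteq> h ` carrier G"
  shows "has_copy (elementary_closure B) (L\<lparr>carrier := K\<rparr>)"
proof -
  interpret group_hom G L h using group_homI[OF G(1) L h] .
  have "\<forall>k\<in>K. \<exists>x. x \<in> carrier G \<and> h x = k" using K(3) by blast
  then obtain s where s: "\<And>k. k \<in> K \<Longrightarrow> s k \<in> carrier G \<and> h (s k) = k" by metis
  define K' where "K' = generate G (s ` K)"
  have sK: "s ` K \<subseteq> carrier G" using s by blast
  have sub: "subgroup K' G" unfolding K'_def by (rule G.generate_is_subgroup[OF sK])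
  have "countable K'"
    unfolding K'_def by (rule countable_generate[OF G(1) sK countable_image[OF K(2)]])
  then have c: "has_copy (elementary_closure B) (G\<lparr>carrier := K'\<rparr>)"
    using locally_inD[OF G(2) sub] by blast
  have "h ` s ` K = K" using s by (force simp: image_image)
  then have "h ` K' = generate L K" unfolding K'_def using generate_img[OF sK] by simp
  also have "generate L K = K"
    by (rule H.generateI[OF K(1), symmetric]) simp_all
  finally have hK: "h ` K' = K" .
  show ?thesis
  proof (rule copy_elementary_image[OF c group.subgroup_imp_group[OF L K(1)]])
    show "h \<in> hom (G\<lparr>carrier := K'\<rparr>) (L\<lparr>carrier := K\<rparr>)"
      using hom_subgroup_restrict[OF h sub] hK by simp
  qed (simp add: hK)
qed

text \<open>
  The induction passes from derivations on an arbitrary type, whose intermediate groups may be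
  uncountable, to derivations on the natural numbers. In the case of a direct limit, a countable
  subgroup need not be a limit of subgroups of the system, but each of its finitely generated
  subgroups is the image of a subgroup of one group of the system.
\<close>

lemma elementary_closure_locally_in:
  assumes "elementary_closure A G" "\<And>G. group G \<Longrightarrow> A G \<Longrightarrow> locally_in B G"
  shows "locally_in B G"
  using assms(1)
proof (induction rule: elementary_closure.induct)
  case (base G)
  then show ?case using assms(2) by blast
next
  case (subgroup G H)
  note gG = elementary_closure_group[OF subgroup.hyps(1)]
  show ?case
    unfolding locally_in_def
    using locally_inD[OF subgroup.IH] group.incl_subgroup[OF gG subgroup.hyps(2)] by simp
next
  case (quotient G N Q)
  note gG = elementary_closure_group[OF quotient.hyps(1)]
  obtain h where h: "h \<in> hom G Q" "h ` carrier G = carrier Q"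
    using quotient_hom[OF quotient.hyps(2-4)] by blast
  show ?case
    unfolding locally_in_def
    using locally_in_image[OF gG quotient.IH quotient.hyps(3) h(1)] h(2) subgroup.subset by metis
next
  case (extension G N Q)
  note gQ = elementary_closure_group[OF extension.hyps(4)]
  obtain h where h: "h \<in> hom G Q" "h ` carrier G = carrier Q" "kernel G Q h = N"
    using quotient_hom[OF extension.hyps(2) gQ extension.hyps(5)] by blast
  have sN: "subgroup N G" using extension.hyps(2) by (rule normal_imp_subgroup)
  have "has_copy (elementary_closure B) (G\<lparr>carrier := K\<rparr>)" if K: "subgroup K G" "countable K" for K
  proof (rule elementary_closure.copy_ext)
    show gK: "group (G\<lparr>carrier := K\<rparr>)" by (rule group.subgroup_imp_group[OF extension.hyps(1) K(1)])
    show "countable (carrier (G\<lparr>carrier := K\<rparr>))" using K(2) by simp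
    show "h \<in> hom (G\<lparr>carrier := K\<rparr>) (Q\<lparr>carrier := h ` K\<rparr>)" by (rule hom_subgroup_restrict[OF h(1) K(1)])
    show "h ` carrier (G\<lparr>carrier := K\<rparr>) = carrier (Q\<lparr>carrier := h ` K\<rparr>)" by simp
    show "has_copy (elementary_closure B) (Q\<lparr>carrier := h ` K\<rparr>)"
      by (rule locally_inD[OF extension.IH(2) subgroup_hom_image[OF extension.hyps(1) gQ h(1) K(1)]])
        (use K(2) in simp)
    have ker: "kernel (G\<lparr>carrier := K\<rparr>) (Q\<lparr>carrier := h ` K\<rparr>) h = K \<inter> N"
      using h(3) subgroup.subset[OF K(1)] by (auto simp: kernel_def)
    have "subgroup (K \<inter> N) (G\<lparr>carrier := N\<rparr>)"
      by (rule group.subgroup_incl[OF extension.hyps(1)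
            group.subgroups_Inter_pair[OF extension.hyps(1) K(1) sN] sN]) simp
    then have "has_copy (elementary_closure B) (G\<lparr>carrier := K \<inter> N\<rparr>)"
      using locally_inD[OF extension.IH(1), of "K \<inter> N"] K(2) by simp
    then show "has_copy (elementary_closure B)
        (G\<lparr>carrier := K, carrier := kernel (G\<lparr>carrier := K\<rparr>) (Q\<lparr>carrier := h ` K\<rparr>) h\<rparr>)"
      by (simp add: ker)
  qed
  then show ?case by (simp add: locally_in_def)
next
  case (direct_limit I r Gs \<phi> L)
  interpret direct_sys I r Gs \<phi> by unfold_locales (rule direct_limit.hyps(1))
  note gL = direct_limit.hyps(3)
  interpret L: group L by (rule gL)
  obtain f where f: "f \<in> iso DL L"
    using group.iso_sym[OF direct_limit.hyps(3,4)] by (auto simp: is_iso_def)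
  \<comment> \<open>The canonical map of the \<open>i\<close>-th group into the limit, read in
    \<open>L\<close>.\<close>
  define \<psi> where "\<psi> i x = f (cl i x)" for i x
  have \<psi>: "\<psi> i \<in> hom (Gs i) L" if "i \<in> I" for i
    using Group.hom_compose[OF cl_hom[OF that], of f L] f by (simp add: iso_def comp_def \<psi>_def[abs_def])
  have fim: "f ` carrier DL = carrier L" using f by (simp add: iso_def bij_betw_def)
  have ex: "\<exists>i\<in>I. y \<in> \<psi> i ` carrier (Gs i)" if "y \<in> carrier L" for y
    using that unfolding fim[symmetric] carrier_DL by (auto simp: \<psi>_def)
  have up: "\<psi> i ` carrier (Gs i) \<subseteq> \<psi> j ` carrier (Gs j)" if ij: "(i, j) \<in> r" for i j
  proof
    fix y assume "y \<in> \<psi> i ` carrier (Gs i)"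
    then obtain x where x: "x \<in> carrier (Gs i)" "y = \<psi> i x" by blast
    then have "y = \<psi> j (\<phi> i j x)" using cl_map[OF ij] by (simp add: \<psi>_def)
    then show "y \<in> \<psi> j ` carrier (Gs j)" using map_closed[OF ij x(1)] by blast
  qed
  have "has_copy (elementary_closure B) (L\<lparr>carrier := K\<rparr>)" if K: "subgroup K L" "countable K" for K
  proof -
    have Kne: "K \<noteq> {}" using subgroup.one_closed[OF K(1)] by blast
    have KL: "K \<subseteq> carrier L" by (rule subgroup.subset[OF K(1)])
    define k where "k = from_nat_into K"
    have rk: "range k = K" unfolding k_def by (rule range_from_nat_into[OF Kne K(2)])
    \<comment> \<open>\<open>K\<close> is exhausted by the subgroups \<open>J n\<close> generated by
      initial segments of an enumeration, which may repeat elements.\<close>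
    define S where "S n = k ` {..n}" for n
    have SK: "S n \<subseteq> K" for n using rk by (auto simp: S_def)
    have SL: "S n \<subseteq> carrier L" for n using SK KL by blast
    define J where "J n = generate L (S n)" for n
    have sJ: "subgroup (J n) L" for n unfolding J_def by (rule L.generate_is_subgroup[OF SL])
    have JK: "J n \<subseteq> K" for n unfolding J_def by (rule L.generate_subgroup_incl[OF SK K(1)])
    \<comment> \<open>Directedness lets one group of the system reach all of a finite set, and hence
      the subgroup that it generates.\<close>
    have cov: "\<exists>i\<in>I. S n \<subseteq> \<psi> i ` carrier (Gs i)" for n
    proof (induction n)
      case 0
      have "k 0 \<in> carrier L" using rk KL by blast
      then show ?case using ex by (auto simp: S_def)
    next
      case (Suc n)
      then obtain i where i: "i \<in> I" "S n \<subseteq> \<psi> i ` carrier (Gs i)" by blast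
      have "k (Suc n) \<in> carrier L" using rk KL by blast
      then obtain j where j: "j \<in> I" "k (Suc n) \<in> \<psi> j ` carrier (Gs j)" using ex by blast
      obtain l where l: "l \<in> I" "(i, l) \<in> r" "(j, l) \<in> r" using dir[OF i(1) j(1)] by blast
      have "S (Suc n) = insert (k (Suc n)) (S n)" by (auto simp: S_def atMost_Suc)
      then have "S (Suc n) \<subseteq> \<psi> l ` carrier (Gs l)" using i(2) j(2) up[OF l(2)] up[OF l(3)] by auto
      then show ?case using l(1) by blast
    qed
    have copyJ: "has_copy (elementary_closure B) (L\<lparr>carrier := J n\<rparr>)" for n
    proof -
      obtain i where i: "i \<in> I" "S n \<subseteq> \<psi> i ` carrier (Gs i)" using cov by blast
      have "subgroup (\<psi> i ` carrier (Gs i)) L"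
        by (rule group_hom.img_is_subgroup[OF group_homI[OF grp[OF i(1)] gL \<psi>[OF i(1)]]])
      then have "J n \<subseteq> \<psi> i ` carrier (Gs i)"
        unfolding J_def using L.generate_subgroup_incl[OF i(2)] by blast
      moreover have "countable (J n)" using JK K(2) by (rule countable_subset)
      ultimately show ?thesis
        using locally_in_image[OF grp[OF i(1)] direct_limit.IH[OF i(1)] gL \<psi>[OF i(1)] sJ] by blast
    qed
    show ?thesis
    proof (rule elementary_closure.copy_union[where K = J])
      show "group (L\<lparr>carrier := K\<rparr>)" by (rule group.subgroup_imp_group[OF gL K(1)])
      show "subgroup (J n) (L\<lparr>carrier := K\<rparr>)" for n
        by (rule L.subgroup_incl[OF sJ K(1) JK])
      show "incseq J"
        unfolding J_def by (intro monoI L.mono_generate) (auto simp: S_def)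
      have "k n \<in> J n" for n unfolding J_def by (rule generate.incl) (simp add: S_def)
      then have "K \<subseteq> (\<Union>n. J n)" unfolding rk[symmetric] by blast
      then show "(\<Union>n. J n) = carrier (L\<lparr>carrier := K\<rparr>)" using JK by auto
    qed (simp add: copyJ)
  qed
  then show ?case by (simp add: locally_in_def)
qed

lemma copy_elementary_closure:
  assumes "elementary_closure A G" "countable (carrier G)" "\<And>G. group G \<Longrightarrow> A G \<Longrightarrow> locally_in B G"
  shows "elementary_closure B (nat_copy G)"
proof -
  have "locally_in B G" using elementary_closure_locally_in[OF assms(1,3)] .
  moreover have "subgroup (carrier G) G"
    by (rule group.subgroup_self[OF elementary_closure_group[OF assms(1)]])
  ultimately have "has_copy (elementary_closure B) (G\<lparr>carrier := carrier G\<rparr>)"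
    using locally_inD assms(2) by blast
  then show ?thesis by (simp add: has_copy_def)
qed

section \<open>The two base classes\<close>

lemma finite_or_comm_copy:
  assumes "group G" "countable (carrier G)" "finite (carrier G) \<or> comm_group G"
  shows "finite (carrier (nat_copy G)) \<or> comm_group (nat_copy G)"
  using assms iso_finite[OF nat_copy_is_iso] comm_group.iso_imp_comm_group[OF _ nat_copy_is_iso]
    group.is_monoid[OF nat_copy_group] by blast

text \<open>Finiteness and commutativity pass to subgroups and to copies, so each countable subgroup
  of a base group has a copy in the base class itself.\<close>

lemma elementary_amenable_copy:
  assumes "elementary_amenable G" "countable (carrier G)"
  shows "elementary_amenable (nat_copy G)"
  unfolding elementary_amenable_def
proof (rule copy_elementary_closure[OF assms(1)[unfolded elementary_amenable_def] assms(2)])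
  fix G :: "'a monoid"
  assume G: "group G" "finite (carrier G) \<or> comm_group G"
  interpret group G by (rule G(1))
  show "locally_in (\<lambda>G. finite (carrier G) \<or> comm_group G) G"
    unfolding locally_in_def
  proof (intro allI impI, elim conjE)
    fix K assume K: "subgroup K G" "countable K"
    have gK: "group (G\<lparr>carrier := K\<rparr>)" by (rule group.subgroup_imp_group[OF G(1) K(1)])
    have "comm_group (G\<lparr>carrier := K\<rparr>)" if "comm_group G"
      by (rule group.group_comm_groupI[OF gK])
        (use comm_groupE(4)[OF that] subgroup.subset[OF K(1)] in \<open>auto simp: subset_iff\<close>)
    moreover have "finite K" if "finite (carrier G)"
      using finite_subset[OF subgroup.subset[OF K(1)] that] .
    ultimately have "finite (carrier (G\<lparr>carrier := K\<rparr>)) \<or> comm_group (G\<lparr>carrier := K\<rparr>)"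
      using G(2) by auto
    then show "has_copy (elementary_closure (\<lambda>G. finite (carrier G) \<or> comm_group G)) (G\<lparr>carrier := K\<rparr>)"
      unfolding has_copy_def using gK K(2) nat_copy_group[OF gK] finite_or_comm_copy[OF gK]
      by (simp add: elementary_closure.base)
  qed
qed

lemma word_ball_subset:
  assumes "group G" "S \<subseteq> carrier G"
  shows "word_ball G S n \<subseteq> carrier G"
proof -
  interpret group G by fact
  show ?thesis
    by (induction n) (use assms(2) in \<open>auto simp: set_mult_def SET_INV_def\<close>)
qed

text \<open>Homomorphisms carry the alphabet, with its unit and inverses, to the alphabet of the
  image. An isomorphism thus preserves ball sizes.\<close>

lemma word_ball_hom:
  assumes "group_hom G H f" "S \<subseteq> carrier G"
  shows "word_ball H (f ` S) n = f ` word_ball G S n"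
proof -
  interpret group_hom G H f by fact
  let ?A = "insert \<one>\<^bsub>G\<^esub> (S \<union> set_inv\<^bsub>G\<^esub> S)"
  have A: "?A \<subseteq> carrier G" using assms(2) by (auto simp: SET_INV_def)
  have fA: "insert \<one>\<^bsub>H\<^esub> (f ` S \<union> set_inv\<^bsub>H\<^esub> (f ` S)) = f ` ?A"
  proof -
    have "set_inv\<^bsub>G\<^esub> S = (\<lambda>x. inv\<^bsub>G\<^esub> x) ` S" "set_inv\<^bsub>H\<^esub> (f ` S) = (\<lambda>x. inv\<^bsub>H\<^esub> f x) ` S"
      by (auto simp: SET_INV_def)
    moreover have "f ` (\<lambda>x. inv\<^bsub>G\<^esub> x) ` S = (\<lambda>x. inv\<^bsub>H\<^esub> f x) ` S"
      unfolding image_image by (rule image_cong) (use assms(2) in auto)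
    ultimately show ?thesis by (simp only: image_insert image_Un hom_one)
  qed
  show ?thesis
  proof (induction n)
    case (Suc n)
    have "f ` (word_ball G S n <#>\<^bsub>G\<^esub> ?A) = f ` word_ball G S n <#>\<^bsub>H\<^esub> f ` ?A"
      by (rule set_mult_hom[OF homh word_ball_subset[OF G.is_group assms(2)] A])
    then show ?case using Suc fA by simp
  qed simp
qed

lemma fg_subexponential_growth_iso:
  assumes "group G" "group H" "G \<cong> H" "fg_subexponential_growth G"
  shows "fg_subexponential_growth H"
proof -
  obtain f where f: "f \<in> iso G H" using assms(3) by (auto simp: is_iso_def)
  then have f': "f \<in> hom G H" "inj_on f (carrier G)" "f ` carrier G = carrier H"
    by (auto simp: iso_def bij_betw_def)
  interpret group_hom G H f using group_homI[OF assms(1,2) f'(1)] .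
  obtain S where S: "finite S" "S \<subseteq> carrier G" "generate G S = carrier G"
    "(\<lambda>n. root n (real (card (word_ball G S n)))) \<longlonglongrightarrow> 1"
    using assms(4) unfolding fg_subexponential_growth_def by blast
  have "card (word_ball H (f ` S) n) = card (word_ball G S n)" for n
    unfolding word_ball_hom[OF group_hom_axioms S(2)]
    by (rule card_image[OF inj_on_subset[OF f'(2) word_ball_subset[OF assms(1) S(2)]]])
  then have "(\<lambda>n. root n (real (card (word_ball H (f ` S) n)))) \<longlonglongrightarrow> 1" using S(4) by simp
  moreover have "generate H (f ` S) = carrier H" using generate_img[OF S(2)] S(3) f'(3) by simp
  ultimately show ?thesis
    unfolding fg_subexponential_growth_def using assms(2) S(1,2) by (intro conjI exI[of _ "f ` S"]) auto
qed

text \<open>A finitely generated group is countable, so a base group has a copy in the base class.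
  Its subgroups need not be finitely generated and are reached through the rule
  \<open>subgroup\<close> on the natural numbers.\<close>

lemma subexponentially_amenable_copy:
  assumes "subexponentially_amenable G" "countable (carrier G)"
  shows "subexponentially_amenable (nat_copy G)"
  unfolding subexponentially_amenable_def
proof (rule copy_elementary_closure[OF assms(1)[unfolded subexponentially_amenable_def] assms(2)])
  fix G :: "'a monoid"
  assume G: "group G" "fg_subexponential_growth G"
  obtain S where "finite S" "S \<subseteq> carrier G" "generate G S = carrier G"
    using G(2) unfolding fg_subexponential_growth_def by blast
  then have cG: "countable (carrier G)"
    using countable_generate[OF G(1), of S] countable_finite[of S] by simp
  have "fg_subexponential_growth (nat_copy G)"
    by (rule fg_subexponential_growth_iso[OF G(1) nat_copy_group[OF G(1) cG] nat_copy_is_iso[OF G(1) cG] G(2)])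
  then have "has_copy (elementary_closure fg_subexponential_growth) G"
    unfolding has_copy_def using G(1) cG nat_copy_group[OF G(1) cG] by (simp add: elementary_closure.base)
  then show "locally_in fg_subexponential_growth G"
    unfolding locally_in_def using copy_elementary_subgroup by blast
qed

lemma elementary_amenable_integers: "elementary_amenable integer_group"
  unfolding elementary_amenable_def
  by (rule elementary_closure.base) (simp_all add: abelian_integer_group)

lemma subexponential_growth_integers: "fg_subexponential_growth integer_group"
proof -
  have gen: "x \<in> generate integer_group {1}" for x
  proof (induction x rule: int_induct[of _ 0])
    case base
    show ?case using generate.one[of integer_group "{1}"] by simp
  next
    case (step1 i)
    then show ?case
      using generate.eng[of i integer_group "{1}" 1] generate.incl[of 1 "{1}" integer_group] by simp
  next
    case (step2 i)
    then show ?case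
      using generate.eng[of i integer_group "{1}" "-1"] generate.inv[of 1 "{1}" integer_group] by simp
  qed
  have ball: "word_ball integer_group {1} n \<subseteq> {- int n..int n}" for n
    by (induction n) (force simp: set_mult_def SET_INV_def)+
  have one: "0 \<in> word_ball integer_group {1} n" for n
    by (induction n) (auto simp: set_mult_def)
  define c where "c n = real (card (word_ball integer_group {1} n))" for n
  have c1: "1 \<le> c n" for n
  proof -
    have "card {0::int} \<le> card (word_ball integer_group {1} n)"
      by (rule card_mono[OF finite_subset[OF ball]]) (use one in auto)
    then show ?thesis by (simp add: c_def)
  qed
  \<comment> \<open>The interval has \<open>2 * n + 1\<close> points, at most \<open>3 * n\<close>
    for positive \<open>n\<close>; the \<open>n\<close>-th root of that bound tends to
    \<open>1\<close>.\<close>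
  have c2: "c n \<le> 3 * real n" if "n > 0" for n
  proof -
    have "card (word_ball integer_group {1} n) \<le> card {- int n..int n}"
      by (rule card_mono[OF _ ball]) simp
    then show ?thesis using that by (simp add: c_def)
  qed
  have "(\<lambda>n. root n (c n)) \<longlonglongrightarrow> 1"
  proof (rule tendsto_sandwich)
    show "eventually (\<lambda>n. 1 \<le> root n (c n)) sequentially"
      by (rule eventually_mono[OF eventually_gt_at_top[of 0]]) (use c1 in simp)
    show "eventually (\<lambda>n. root n (c n) \<le> root n 3 * root n (real n)) sequentially"
      by (rule eventually_mono[OF eventually_gt_at_top[of 0]])
        (use c2 in \<open>simp add: real_root_mult[symmetric]\<close>)
    show "(\<lambda>n. root n 3 * root n (real n)) \<longlonglongrightarrow> 1"
      using tendsto_mult[OF LIMSEQ_root_const[of 3] LIMSEQ_root] by simp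
  qed simp
  then show ?thesis
    unfolding fg_subexponential_growth_def using gen
    by (intro conjI exI[of _ "{1}"]) (auto simp: c_def)
qed

lemma subexponentially_amenable_integers: "subexponentially_amenable integer_group"
  unfolding subexponentially_amenable_def
  by (rule elementary_closure.base) (simp_all add: subexponential_growth_integers)


section \<open>The shift extension\<close>

text \<open>
  Pairs of a function from the integers to \<open>G\<close> that is trivial near minus infinity and constant
  near plus infinity, and an integer that acts by translation. The function with value \<open>x\<close> on the
  half line of nonnegative integers and its translate differ exactly at \<open>0\<close>, which makes the point
  mass \<open>x\<close> at \<open>0\<close> a commutator.
\<close>

definition ray_funs :: "'a monoid \<Rightarrow> (int \<Rightarrow> 'a) set" where
  "ray_funs G = {f. (\<forall>k. f k \<in> carrier G) \<and> (\<forall>\<^sub>F k in at_bot. f k = \<one>\<^bsub>G\<^esub>) \<and>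
     (\<exists>c. \<forall>\<^sub>F k in at_top. f k = c)}"

definition ray_group :: "'a monoid \<Rightarrow> ((int \<Rightarrow> 'a) \<times> int) monoid" where
  "ray_group G = \<lparr>carrier = ray_funs G \<times> UNIV,
     monoid.mult = (\<lambda>(f, m) (g, n). (\<lambda>k. f k \<otimes>\<^bsub>G\<^esub> g (k - m), m + n)), one = (\<lambda>k. \<one>\<^bsub>G\<^esub>, 0)\<rparr>"

lemma ray_group_simps [simp]:
  "carrier (ray_group G) = ray_funs G \<times> UNIV"
  "(f, m) \<otimes>\<^bsub>ray_group G\<^esub> (g, n) = (\<lambda>k. f k \<otimes>\<^bsub>G\<^esub> g (k - m), m + n)"
  "\<one>\<^bsub>ray_group G\<^esub> = (\<lambda>k. \<one>\<^bsub>G\<^esub>, 0)"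
  by (simp_all add: ray_group_def)

lemma ray_closed: "f \<in> ray_funs G \<Longrightarrow> f k \<in> carrier G"
  by (simp add: ray_funs_def)

lemma eventually_shift_at_top: "eventually P at_top \<Longrightarrow> eventually (\<lambda>k. P (k + n)) at_top" for n :: int
  unfolding eventually_at_top_linorder by (metis diff_le_eq)

lemma eventually_shift_at_bot: "eventually P at_bot \<Longrightarrow> eventually (\<lambda>k. P (k + n)) at_bot" for n :: int
  unfolding eventually_at_bot_linorder by (metis le_diff_eq)

lemma ray_shift:
  assumes "f \<in> ray_funs G"
  shows "(\<lambda>k. f (k + n)) \<in> ray_funs G"
  using assms eventually_shift_at_top[of "\<lambda>k. f k = _" n] eventually_shift_at_bot[of "\<lambda>k. f k = _" n]
  unfolding ray_funs_def by blast

definition ray_embed :: "'a monoid \<Rightarrow> 'a \<Rightarrow> (int \<Rightarrow> 'a) \<times> int" where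
  "ray_embed G x = (\<lambda>k. if k = 0 then x else \<one>\<^bsub>G\<^esub>, 0)"

definition ray_end :: "(int \<Rightarrow> 'a) \<Rightarrow> 'a" where
  "ray_end f = (THE c. \<forall>\<^sub>F k in at_top. f k = c)"

text \<open>Two eventual values agree because \<open>at_top\<close> on the integers is a proper
  filter.\<close>

lemma ray_end_eq:
  assumes "\<forall>\<^sub>F k in at_top. f k = c"
  shows "ray_end f = c"
  unfolding ray_end_def
proof (rule the_equality)
  show "\<forall>\<^sub>F k in at_top. f k = c" by (rule assms)
  fix d assume "\<forall>\<^sub>F k in at_top. f k = d"
  with assms have "\<forall>\<^sub>F k in (at_top :: int filter). d = c" by eventually_elim simp
  then show "d = c" by simp
qed

text \<open>For finite \<open>F\<close> this is the power of \<open>G\<close> with exponent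
  \<open>F\<close>, realized inside the shift extension.\<close>

definition supp_sub :: "'a monoid \<Rightarrow> int set \<Rightarrow> ((int \<Rightarrow> 'a) \<times> int) set" where
  "supp_sub G F = {(f, 0) |f. f \<in> ray_funs G \<and> (\<forall>k. k \<notin> F \<longrightarrow> f k = \<one>\<^bsub>G\<^esub>)}"

context
  fixes G :: "'a monoid"
  assumes group_G: "group G"
begin

interpretation group G by (rule group_G)

lemma ray_const: "(\<lambda>k. \<one>\<^bsub>G\<^esub>) \<in> ray_funs G"
  by (auto simp: ray_funs_def)

lemma ray_mult:
  assumes "f \<in> ray_funs G" "g \<in> ray_funs G"
  shows "(\<lambda>k. f k \<otimes>\<^bsub>G\<^esub> g k) \<in> ray_funs G"
proof -
  have "\<forall>\<^sub>F k in at_bot. f k \<otimes>\<^bsub>G\<^esub> g k = \<one>\<^bsub>G\<^esub>"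
  proof -
    have "\<forall>\<^sub>F k in at_bot. f k = \<one>\<^bsub>G\<^esub>" "\<forall>\<^sub>F k in at_bot. g k = \<one>\<^bsub>G\<^esub>"
      using assms by (auto simp: ray_funs_def)
    then show ?thesis by eventually_elim simp
  qed
  moreover have "\<exists>c. \<forall>\<^sub>F k in at_top. f k \<otimes>\<^bsub>G\<^esub> g k = c"
  proof -
    obtain c d where "\<forall>\<^sub>F k in at_top. f k = c" "\<forall>\<^sub>F k in at_top. g k = d"
      using assms by (auto simp: ray_funs_def)
    then have "\<forall>\<^sub>F k in at_top. f k \<otimes>\<^bsub>G\<^esub> g k = c \<otimes>\<^bsub>G\<^esub> d" by eventually_elim simp
    then show ?thesis by blast
  qed
  ultimately show ?thesis using assms by (auto simp: ray_funs_def)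
qed

lemma ray_inv:
  assumes "f \<in> ray_funs G"
  shows "(\<lambda>k. inv\<^bsub>G\<^esub> f k) \<in> ray_funs G"
proof -
  have "\<forall>\<^sub>F k in at_bot. inv\<^bsub>G\<^esub> f k = \<one>\<^bsub>G\<^esub>"
  proof -
    have "\<forall>\<^sub>F k in at_bot. f k = \<one>\<^bsub>G\<^esub>" using assms by (auto simp: ray_funs_def)
    then show ?thesis by eventually_elim simp
  qed
  moreover have "\<exists>c. \<forall>\<^sub>F k in at_top. inv\<^bsub>G\<^esub> f k = c"
  proof -
    obtain c where "\<forall>\<^sub>F k in at_top. f k = c" using assms by (auto simp: ray_funs_def)
    then have "\<forall>\<^sub>F k in at_top. inv\<^bsub>G\<^esub> f k = inv\<^bsub>G\<^esub> c" by eventually_elim simp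
    then show ?thesis by blast
  qed
  ultimately show ?thesis using assms by (auto simp: ray_funs_def)
qed

lemma ray_group_group: "group (ray_group G)"
proof (rule groupI)
  fix x y z assume "x \<in> carrier (ray_group G)" "y \<in> carrier (ray_group G)" "z \<in> carrier (ray_group G)"
  then show "x \<otimes>\<^bsub>ray_group G\<^esub> y \<otimes>\<^bsub>ray_group G\<^esub> z = x \<otimes>\<^bsub>ray_group G\<^esub> (y \<otimes>\<^bsub>ray_group G\<^esub> z)"
    by (cases x; cases y; cases z) (auto simp: m_assoc ray_closed diff_diff_eq)
next
  fix x y assume "x \<in> carrier (ray_group G)" "y \<in> carrier (ray_group G)"
  then show "x \<otimes>\<^bsub>ray_group G\<^esub> y \<in> carrier (ray_group G)"
    using ray_mult[OF _ ray_shift[of "fst y" G "- snd x"]] by (cases x; cases y) auto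
next
  fix x assume "x \<in> carrier (ray_group G)"
  then obtain f m where x: "x = (f, m)" "f \<in> ray_funs G" by (cases x) auto
  show "\<one>\<^bsub>ray_group G\<^esub> \<otimes>\<^bsub>ray_group G\<^esub> x = x"
    using x by (simp add: ray_closed)
  show "\<exists>y\<in>carrier (ray_group G). y \<otimes>\<^bsub>ray_group G\<^esub> x = \<one>\<^bsub>ray_group G\<^esub>"
    using x ray_inv[OF ray_shift[OF x(2), of m]]
    by (intro bexI[of _ "(\<lambda>k. inv\<^bsub>G\<^esub> f (k + m), - m)"]) (auto simp: ray_closed)
qed (simp add: ray_const)

interpretation W: group "ray_group G" by (rule ray_group_group)

lemma ray_group_inv:
  assumes "f \<in> ray_funs G"
  shows "inv\<^bsub>ray_group G\<^esub> (f, m) = (\<lambda>k. inv\<^bsub>G\<^esub> f (k + m), - m)"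
  by (rule W.inv_equality) (use assms ray_inv[OF ray_shift[OF assms, of m]] in \<open>auto simp: ray_closed\<close>)

text \<open>A function is encoded by a point where it is still trivial, the finite list of its
  values up to a point where it is already constant, and that constant.\<close>

lemma countable_ray_group:
  assumes "countable (carrier G)"
  shows "countable (carrier (ray_group G))"
proof -
  let ?F = "\<lambda>(a :: int, xs, c) k. if k < a then \<one>\<^bsub>G\<^esub> else if nat (k - a) < length xs then xs ! nat (k - a) else c"
  have "f \<in> ?F ` (UNIV \<times> lists (carrier G) \<times> carrier G)" if f: "f \<in> ray_funs G" for f
  proof -
    obtain a where a: "\<And>k. k \<le> a \<Longrightarrow> f k = \<one>\<^bsub>G\<^esub>"
      using f by (auto simp: ray_funs_def eventually_at_bot_linorder)
    obtain b c where b: "\<And>k. k \<ge> b \<Longrightarrow> f k = c"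
      using f by (auto simp: ray_funs_def eventually_at_top_linorder)
    let ?xs = "map (\<lambda>i. f (a + int i)) [0..<nat (b - a)]"
    have "f = ?F (a, ?xs, c)"
    proof
      fix k
      consider "k < a" | "k \<ge> a" "k < b" | "k \<ge> a" "k \<ge> b" by linarith
      then show "f k = ?F (a, ?xs, c) k"
        by cases (simp_all add: a b)
    qed
    moreover have "?xs \<in> lists (carrier G)" using ray_closed[OF f] by auto
    moreover have "c \<in> carrier G" using ray_closed[OF f, of b] b[of b] by simp
    ultimately show ?thesis by blast
  qed
  then have "ray_funs G \<subseteq> ?F ` (UNIV \<times> lists (carrier G) \<times> carrier G)" by blast
  moreover have "countable (?F ` ((UNIV :: int set) \<times> lists (carrier G) \<times> carrier G))"
    using assms by (intro countable_image countable_SIGMA countable_lists) auto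
  ultimately have "countable (ray_funs G)" by (rule countable_subset)
  then show ?thesis by simp
qed

lemma point_ray:
  assumes "x \<in> carrier G"
  shows "(\<lambda>k. if k = a then x else \<one>\<^bsub>G\<^esub>) \<in> ray_funs G" (is "?f \<in> _")
proof -
  have "\<forall>\<^sub>F k in at_bot. ?f k = \<one>\<^bsub>G\<^esub>"
    unfolding eventually_at_bot_linorder by (intro exI[of _ "a - 1"]) auto
  moreover have "\<forall>\<^sub>F k in at_top. ?f k = \<one>\<^bsub>G\<^esub>"
    unfolding eventually_at_top_linorder by (intro exI[of _ "a + 1"]) auto
  moreover have "\<forall>k. ?f k \<in> carrier G" using assms by simp
  ultimately show ?thesis unfolding ray_funs_def by blast
qed

lemma half_line_ray:
  assumes "x \<in> carrier G"
  shows "(\<lambda>k. if k \<ge> 0 then x else \<one>\<^bsub>G\<^esub>) \<in> ray_funs G" (is "?f \<in> _")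
    and "ray_end (\<lambda>k. if k \<ge> 0 then x else \<one>\<^bsub>G\<^esub>) = x"
proof -
  have "\<forall>\<^sub>F k in at_bot. ?f k = \<one>\<^bsub>G\<^esub>"
    unfolding eventually_at_bot_linorder by (intro exI[of _ "-1"]) auto
  moreover have top: "\<forall>\<^sub>F k in at_top. ?f k = x"
    unfolding eventually_at_top_linorder by (intro exI[of _ 0]) auto
  moreover have "\<forall>k. ?f k \<in> carrier G" using assms by simp
  ultimately show "?f \<in> ray_funs G" unfolding ray_funs_def by blast
  show "ray_end ?f = x" by (rule ray_end_eq[OF top])
qed

lemma ray_embed_hom: "ray_embed G \<in> hom G (ray_group G)"
  by (auto simp: hom_def ray_embed_def point_ray)

lemma ray_embed_inj: "inj_on (ray_embed G) (carrier G)"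
  by (rule inj_onI) (auto simp: ray_embed_def dest: fun_cong[of _ _ 0])

text \<open>The commutator of the half-line function \<open>?f\<close> with the unit translation has
  the value \<open>?f k \<otimes> inv (?f (k - 1))\<close> at \<open>k\<close>, which is nontrivial
  at most at \<open>k = 0\<close>.\<close>

lemma ray_embed_commutator:
  assumes "x \<in> carrier G"
  shows "\<exists>u\<in>carrier (ray_group G). \<exists>v\<in>carrier (ray_group G).
    ray_embed G x = u \<otimes>\<^bsub>ray_group G\<^esub> v \<otimes>\<^bsub>ray_group G\<^esub> inv\<^bsub>ray_group G\<^esub> u \<otimes>\<^bsub>ray_group G\<^esub> inv\<^bsub>ray_group G\<^esub> v"
proof -
  let ?f = "\<lambda>k::int. if k \<ge> 0 then x else \<one>\<^bsub>G\<^esub>" and ?o = "\<lambda>k::int. \<one>\<^bsub>G\<^esub>"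
  have "ray_embed G x = (?f, 0) \<otimes>\<^bsub>ray_group G\<^esub> (?o, 1) \<otimes>\<^bsub>ray_group G\<^esub> inv\<^bsub>ray_group G\<^esub> (?f, 0)
      \<otimes>\<^bsub>ray_group G\<^esub> inv\<^bsub>ray_group G\<^esub> (?o, 1)"
    unfolding ray_group_inv[OF half_line_ray(1)[OF assms]] ray_group_inv[OF ray_const] ray_embed_def
    using assms by (auto simp: fun_eq_iff)
  moreover have "(?f, 0) \<in> carrier (ray_group G)" "(?o, 1) \<in> carrier (ray_group G)"
    using half_line_ray(1)[OF assms] ray_const by auto
  ultimately show ?thesis by blast
qed

lemma ray_end_eventually:
  assumes "f \<in> ray_funs G"
  shows "\<forall>\<^sub>F k in at_top. f k = ray_end f"
  using assms ray_end_eq unfolding ray_funs_def by force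

lemma ray_end_closed:
  assumes "f \<in> ray_funs G"
  shows "ray_end f \<in> carrier G"
  using ray_end_eventually[OF assms] ray_closed[OF assms]
  by (auto simp: eventually_at_top_linorder) (metis order_refl)

lemma supp_sub_subgroup: "subgroup (supp_sub G F) (ray_group G)"
proof (rule W.subgroupI)
  show "supp_sub G F \<subseteq> carrier (ray_group G)" by (auto simp: supp_sub_def)
  show "supp_sub G F \<noteq> {}" using ray_const by (auto simp: supp_sub_def)
  show "inv\<^bsub>ray_group G\<^esub> a \<in> supp_sub G F" if "a \<in> supp_sub G F" for a
    using that ray_inv by (auto simp: supp_sub_def ray_group_inv)
  show "a \<otimes>\<^bsub>ray_group G\<^esub> b \<in> supp_sub G F" if "a \<in> supp_sub G F" "b \<in> supp_sub G F" for a b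
    using that ray_mult by (auto simp: supp_sub_def)
qed

lemma eval_hom: "(\<lambda>p. fst p a) \<in> hom ((ray_group G)\<lparr>carrier := supp_sub G F\<rparr>) G"
  by (rule homI) (auto simp: supp_sub_def ray_closed)

lemma eval_onto:
  assumes "a \<in> F"
  shows "(\<lambda>p. fst p a) ` supp_sub G F = carrier G"
proof
  show "(\<lambda>p. fst p a) ` supp_sub G F \<subseteq> carrier G" by (auto simp: supp_sub_def ray_closed)
  show "carrier G \<subseteq> (\<lambda>p. fst p a) ` supp_sub G F"
  proof
    fix x assume x: "x \<in> carrier G"
    then show "x \<in> (\<lambda>p. fst p a) ` supp_sub G F"
      using point_ray[OF x, of a] assms
      by (intro image_eqI[of _ _ "(\<lambda>k. if k = a then x else \<one>\<^bsub>G\<^esub>, 0)"]) (auto simp: supp_sub_def)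
  qed
qed

text \<open>With \<open>eval_onto\<close>, this splits off one coordinate and makes the functions
  supported on a finite set an iterated extension of copies of \<open>G\<close>.\<close>

lemma eval_kernel:
  assumes "a \<notin> F"
  shows "kernel ((ray_group G)\<lparr>carrier := supp_sub G (insert a F)\<rparr>) G (\<lambda>p. fst p a) = supp_sub G F"
  using assms by (auto simp: kernel_def supp_sub_def)

text \<open>
  The class of orderable groups is not closed under extensions, so a cone is given directly: an
  element is positive if its translation is, or if its translation is zero and its leftmost
  nontrivial value is positive.
\<close>

lemma orderable_ray_group:
  assumes "orderable G"
  shows "orderable (ray_group G)"
proof -
  obtain A where "normal_cone G A" using assms unfolding orderable_iff by blast
  then have A: "A \<subseteq> carrier G" "\<one>\<^bsub>G\<^esub> \<notin> A" "\<And>x y. x \<in> A \<Longrightarrow> y \<in> A \<Longrightarrow> x \<otimes>\<^bsub>G\<^esub> y \<in> A"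
    "\<And>x. x \<in> carrier G \<Longrightarrow> x \<noteq> \<one>\<^bsub>G\<^esub> \<Longrightarrow> x \<in> A \<or> inv\<^bsub>G\<^esub> x \<in> A"
    "\<And>g x. g \<in> carrier G \<Longrightarrow> x \<in> A \<Longrightarrow> g \<otimes>\<^bsub>G\<^esub> x \<otimes>\<^bsub>G\<^esub> inv\<^bsub>G\<^esub> g \<in> A"
    unfolding normal_cone_def pos_cone_def by blast+
  define pos where "pos f k \<longleftrightarrow> f k \<in> A \<and> (\<forall>j<k. f j = \<one>\<^bsub>G\<^esub>)" for f and k :: int
  define C where "C = {(f, n :: int). f \<in> ray_funs G \<and> (n > 0 \<or> n = 0 \<and> (\<exists>k. pos f k))}"
  have mult: "p \<otimes>\<^bsub>ray_group G\<^esub> q \<in> C" if pq: "p \<in> C" "q \<in> C" for p q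
  proof -
    obtain f m g n where fg: "p = (f, m)" "q = (g, n)" "f \<in> ray_funs G" "g \<in> ray_funs G"
      using pq by (auto simp: C_def)
    have "p \<otimes>\<^bsub>ray_group G\<^esub> q \<in> carrier (ray_group G)" using fg by (intro W.m_closed) auto
    then have ray: "(\<lambda>k. f k \<otimes>\<^bsub>G\<^esub> g (k - m)) \<in> ray_funs G" using fg by simp
    show ?thesis
    proof (cases "m = 0 \<and> n = 0")
      case True
      then obtain k l where k: "pos f k" and l: "pos g l" using pq fg by (auto simp: C_def)
      \<comment> \<open>The product starts where the earlier of the two factors starts; if both
        start together, its first value is a product of two positive elements.\<close>
      have "pos (\<lambda>k. f k \<otimes>\<^bsub>G\<^esub> g k) (min k l)"
        using k l A(1,3) by (cases k l rule: linorder_cases) (auto simp: pos_def)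
      then show ?thesis using ray fg True by (auto simp: C_def)
    next
      case False
      then show ?thesis using ray fg pq by (auto simp: C_def)
    qed
  qed
  have total: "p \<in> C \<or> inv\<^bsub>ray_group G\<^esub> p \<in> C"
    if p: "p \<in> carrier (ray_group G)" "p \<noteq> \<one>\<^bsub>ray_group G\<^esub>" for p
  proof -
    obtain f n where fn: "p = (f, n)" "f \<in> ray_funs G" using p by (cases p) auto
    have inv: "inv\<^bsub>ray_group G\<^esub> p = (\<lambda>k. inv\<^bsub>G\<^esub> f (k + n), - n)" using ray_group_inv[OF fn(2)] fn(1) by simp
    have ray: "(\<lambda>k. inv\<^bsub>G\<^esub> f (k + n)) \<in> ray_funs G" by (rule ray_inv[OF ray_shift[OF fn(2)]])
    consider "n > 0" | "n < 0" | "n = 0" by linarith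
    then show ?thesis
    proof cases
      case 3
      then obtain j where j: "f j \<noteq> \<one>\<^bsub>G\<^esub>" using p fn by (auto simp: fun_eq_iff)
      obtain a where a: "\<And>k. k \<le> a \<Longrightarrow> f k = \<one>\<^bsub>G\<^esub>"
        using fn(2) by (auto simp: ray_funs_def eventually_at_bot_linorder)
      \<comment> \<open>Triviality near minus infinity provides a leftmost nontrivial value, found
        by counting upwards from \<open>a\<close>.\<close>
      define i where "i = (LEAST i. f (a + int i) \<noteq> \<one>\<^bsub>G\<^esub>)"
      have "j > a" using a[of j] j by linarith
      then have "f (a + int (nat (j - a))) \<noteq> \<one>\<^bsub>G\<^esub>" using j by simp
      then have i: "f (a + int i) \<noteq> \<one>\<^bsub>G\<^esub>" unfolding i_def by (rule LeastI)
      have below: "f k = \<one>\<^bsub>G\<^esub>" if k: "k < a + int i" for k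
      proof (cases "k \<le> a")
        case False
        then have "nat (k - a) < i" using k by linarith
        then have "f (a + int (nat (k - a))) = \<one>\<^bsub>G\<^esub>" unfolding i_def using not_less_Least by blast
        then show ?thesis using False by simp
      qed (rule a)
      have "f (a + int i) \<in> A \<or> inv\<^bsub>G\<^esub> f (a + int i) \<in> A" using A(4) i ray_closed[OF fn(2)] by blast
      then have "pos f (a + int i) \<or> pos (\<lambda>k. inv\<^bsub>G\<^esub> f k) (a + int i)" using below by (auto simp: pos_def)
      then show ?thesis using fn ray inv 3 by (auto simp: C_def)
    qed (use fn ray inv in \<open>auto simp: C_def\<close>)
  qed
  have conj: "w \<otimes>\<^bsub>ray_group G\<^esub> p \<otimes>\<^bsub>ray_group G\<^esub> inv\<^bsub>ray_group G\<^esub> w \<in> C"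
    if w: "w \<in> carrier (ray_group G)" and p: "p \<in> C" for w p
  proof -
    obtain g m where g: "w = (g, m)" "g \<in> ray_funs G" using w by (cases w) auto
    obtain f n where f: "p = (f, n)" "f \<in> ray_funs G" using p by (auto simp: C_def)
    have eq: "w \<otimes>\<^bsub>ray_group G\<^esub> p \<otimes>\<^bsub>ray_group G\<^esub> inv\<^bsub>ray_group G\<^esub> w =
        (\<lambda>k. g k \<otimes>\<^bsub>G\<^esub> f (k - m) \<otimes>\<^bsub>G\<^esub> inv\<^bsub>G\<^esub> g (k - n), n)"
      using g f by (simp add: ray_group_inv fun_eq_iff algebra_simps)
    have "w \<otimes>\<^bsub>ray_group G\<^esub> p \<otimes>\<^bsub>ray_group G\<^esub> inv\<^bsub>ray_group G\<^esub> w \<in> carrier (ray_group G)"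
      using w f by (intro W.m_closed W.inv_closed) auto
    then have ray: "(\<lambda>k. g k \<otimes>\<^bsub>G\<^esub> f (k - m) \<otimes>\<^bsub>G\<^esub> inv\<^bsub>G\<^esub> g (k - n)) \<in> ray_funs G" unfolding eq by simp
    show ?thesis
    proof (cases "n = 0")
      case True
      then obtain k where k: "pos f k" using p f by (auto simp: C_def)
      \<comment> \<open>Conjugation moves the leftmost value by \<open>m\<close> places and
        conjugates it by a value of \<open>g\<close>; normality of \<open>A\<close> keeps it
        positive.\<close>
      have "pos (\<lambda>k. g k \<otimes>\<^bsub>G\<^esub> f (k - m) \<otimes>\<^bsub>G\<^esub> inv\<^bsub>G\<^esub> g k) (k + m)"
        using k A(5) ray_closed[OF g(2)] by (auto simp: pos_def)
      then show ?thesis unfolding eq using ray True by (auto simp: C_def)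
    next
      case False
      then show ?thesis unfolding eq using ray p f by (auto simp: C_def)
    qed
  qed
  have "\<one>\<^bsub>ray_group G\<^esub> \<notin> C" using A(2) by (auto simp: C_def pos_def)
  then have "normal_cone (ray_group G) C"
    using mult total conj unfolding normal_cone_def pos_cone_def by (auto simp: C_def)
  then show ?thesis unfolding orderable_iff using ray_group_group by blast
qed

end

text \<open>
  The translation part is a quotient \<open>\<int>\<close>, the value at plus infinity is a quotient \<open>G\<close> of the
  remaining group, and what is left are the functions of finite support.
\<close>

lemma (in extension_closed_class) copy_ray_group:
  assumes "has_copy P G" "has_copy P integer_group"
  shows "has_copy P (ray_group G)"
proof -
  have group_G: "group G" by (rule has_copyD(1)[OF assms(1)])
  interpret group G by (rule group_G)
  interpret W: group "ray_group G" by (rule ray_group_group[OF group_G])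
  note ray_const = ray_const[OF group_G]
    and ray_end_eventually = ray_end_eventually[OF group_G]
    and ray_end_closed = ray_end_closed[OF group_G]
    and half_line_ray = half_line_ray[OF group_G]
    and supp_sub_subgroup = supp_sub_subgroup[OF group_G]
    and eval_hom = eval_hom[OF group_G]
    and eval_onto = eval_onto[OF group_G]
    and eval_kernel = eval_kernel[OF group_G]
    and ray_group_group = ray_group_group[OF group_G]
  note cW = countable_ray_group[OF group_G has_copyD(2)[OF assms(1)]]
  let ?W = "ray_group G"
  let ?K0 = "kernel ?W integer_group snd"
  have snd: "snd \<in> hom ?W integer_group" "snd ` carrier ?W = carrier integer_group"
    using ray_const by (auto simp: hom_def image_iff)
  have K0: "?K0 = {(f, 0) |f. f \<in> ray_funs G}" by (auto simp: kernel_def)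
  have sub: "countable A" "group (?W\<lparr>carrier := A\<rparr>)" if "subgroup A ?W" for A
    using that countable_subset[OF subgroup.subset cW] group.subgroup_imp_group[OF ray_group_group] by auto
  have sK0: "subgroup ?K0 ?W" by (rule subgroup_hom_kernel[OF ray_group_group group_integer_group snd(1)])
  let ?e = "\<lambda>p. ray_end (fst p)"
  let ?K1 = "kernel (?W\<lparr>carrier := ?K0\<rparr>) G ?e"
  have e: "?e \<in> hom (?W\<lparr>carrier := ?K0\<rparr>) G"
  proof (rule homI)
    fix p q assume "p \<in> carrier (?W\<lparr>carrier := ?K0\<rparr>)" "q \<in> carrier (?W\<lparr>carrier := ?K0\<rparr>)"
    then obtain f g where fg: "p = (f, 0)" "q = (g, 0)" "f \<in> ray_funs G" "g \<in> ray_funs G" by (auto simp: K0)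
    have "\<forall>\<^sub>F k in at_top. f k \<otimes>\<^bsub>G\<^esub> g k = ray_end f \<otimes>\<^bsub>G\<^esub> ray_end g"
      using ray_end_eventually[OF fg(3)] ray_end_eventually[OF fg(4)] by eventually_elim simp
    then show "?e (p \<otimes>\<^bsub>?W\<lparr>carrier := ?K0\<rparr>\<^esub> q) = ?e p \<otimes>\<^bsub>G\<^esub> ?e q"
      using ray_end_eq fg(1,2) by simp
  qed (auto simp: K0 ray_end_closed)
  have e_onto: "?e ` ?K0 = carrier G"
  proof
    show "?e ` ?K0 \<subseteq> carrier G" by (auto simp: K0 ray_end_closed)
    show "carrier G \<subseteq> ?e ` ?K0"
    proof
      fix x assume x: "x \<in> carrier G"
      let ?f = "\<lambda>k::int. if k \<ge> 0 then x else \<one>\<^bsub>G\<^esub>"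
      show "x \<in> ?e ` ?K0"
        by (rule image_eqI[of _ _ "(?f, 0)"]) (simp add: half_line_ray(2)[OF x], use half_line_ray(1)[OF x] K0 in blast)
    qed
  qed
  \<comment> \<open>The induction starts with one point, where evaluation identifies the subgroup
    with \<open>G\<close>; the empty support would give the trivial group, about which the locale
    assumes nothing.\<close>
  have fin: "has_copy P (?W\<lparr>carrier := supp_sub G F\<rparr>)" if "finite F" "F \<noteq> {}" for F
    using that
  proof (induction F rule: finite_ne_induct)
    case (singleton a)
    have "(\<lambda>p. fst p a) \<in> iso (?W\<lparr>carrier := supp_sub G {a}\<rparr>) G"
    proof (rule isoI[OF eval_hom])
      show "bij_betw (\<lambda>p. fst p a) (carrier (?W\<lparr>carrier := supp_sub G {a}\<rparr>)) (carrier G)"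
        unfolding bij_betw_def using eval_onto[of a "{a}"]
        by (auto simp: inj_on_def supp_sub_def fun_eq_iff) metis
    qed
    then have "?W\<lparr>carrier := supp_sub G {a}\<rparr> \<cong> G" by (rule is_isoI)
    then show ?case
      using copy_iso[OF assms(1)] group.iso_sym sub(2)[OF supp_sub_subgroup] by metis
  next
    case (insert a F)
    show ?case
      by (rule copy_ext[OF sub(2)[OF supp_sub_subgroup] _ eval_hom[of a]])
        (use sub(1)[OF supp_sub_subgroup] eval_onto[of a "insert a F"] eval_kernel[of a F] insert assms(1) in simp_all)
  qed
  have "has_copy P (?W\<lparr>carrier := ?K1\<rparr>)"
  proof (rule copy_union[where K = "\<lambda>n. supp_sub G {- int n..int n}"])
    have sK1: "subgroup ?K1 ?W"
      using group.incl_subgroup[OF ray_group_group sK0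
          subgroup_hom_kernel[OF group.subgroup_imp_group[OF ray_group_group sK0] group_G e]] .
    show "group (?W\<lparr>carrier := ?K1\<rparr>)" by (rule sub(2)[OF sK1])
    have K1: "?K1 = {(f, 0) |f. f \<in> ray_funs G \<and> ray_end f = \<one>\<^bsub>G\<^esub>}" by (auto simp: kernel_def)
    have le: "supp_sub G {- int n..int n} \<subseteq> ?K1" for n
    proof
      fix p assume "p \<in> supp_sub G {- int n..int n}"
      then obtain f where f: "p = (f, 0)" "f \<in> ray_funs G" "\<And>k. k \<notin> {- int n..int n} \<Longrightarrow> f k = \<one>\<^bsub>G\<^esub>"
        by (auto simp: supp_sub_def)
      have "\<forall>\<^sub>F k in at_top. f k = \<one>\<^bsub>G\<^esub>"
        unfolding eventually_at_top_linorder by (intro exI[of _ "int n + 1"]) (auto intro: f(3))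
      then show "p \<in> ?K1" using f(1,2) ray_end_eq by (simp add: K1)
    qed
    show "subgroup (supp_sub G {- int n..int n}) (?W\<lparr>carrier := ?K1\<rparr>)" for n
      by (rule W.subgroup_incl[OF supp_sub_subgroup sK1 le])
    show "incseq (\<lambda>n. supp_sub G {- int n..int n})"
      by (rule monoI) (auto simp: supp_sub_def)
    have "?K1 \<subseteq> (\<Union>n. supp_sub G {- int n..int n})"
    proof
      fix p assume "p \<in> ?K1"
      then obtain f where f: "p = (f, 0)" "f \<in> ray_funs G" "ray_end f = \<one>\<^bsub>G\<^esub>" by (auto simp: K1)
      obtain a where a: "\<And>k. k \<le> a \<Longrightarrow> f k = \<one>\<^bsub>G\<^esub>"
        using f(2) by (auto simp: ray_funs_def eventually_at_bot_linorder)
      obtain b where b: "\<And>k. k \<ge> b \<Longrightarrow> f k = \<one>\<^bsub>G\<^esub>"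
        using ray_end_eventually[OF f(2)] unfolding f(3) eventually_at_top_linorder by blast
      \<comment> \<open>Large enough for the window to reach both \<open>a\<close>, below which
        \<open>f\<close> is trivial, and \<open>b\<close>, above which it is trivial again.\<close>
      define n where "n = nat (\<bar>a\<bar> + \<bar>b\<bar>)"
      have "int n = \<bar>a\<bar> + \<bar>b\<bar>" unfolding n_def by (rule nat_0_le) simp
      then have n: "\<bar>a\<bar> \<le> int n" "\<bar>b\<bar> \<le> int n" by linarith+
      have "f k = \<one>\<^bsub>G\<^esub>" if k: "k \<notin> {- int n..int n}" for k
      proof -
        have "k \<le> a \<or> b \<le> k" using n k unfolding atLeastAtMost_iff by linarith
        then show ?thesis using a b by blast
      qed
      then have "p \<in> supp_sub G {- int n..int n}" using f(1,2) unfolding supp_sub_def by blast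
      then show "p \<in> (\<Union>n. supp_sub G {- int n..int n})" by blast
    qed
    then show "(\<Union>n. supp_sub G {- int n..int n}) = carrier (?W\<lparr>carrier := ?K1\<rparr>)" using le by auto
  qed (simp add: fin)
  then have "has_copy P (?W\<lparr>carrier := ?K0\<rparr>)"
    by (intro copy_ext[OF sub(2)[OF sK0] _ e _ _ assms(1)]) (use sub(1)[OF sK0] e_onto in simp_all)
  then show ?thesis by (rule copy_ext[OF ray_group_group cW snd _ assms(2)])
qed


section \<open>The tower\<close>

text \<open>Copying back to the natural numbers at every step keeps the type constant; otherwise
  each application of the shift extension would enlarge it and the recursion could not be
  typed.\<close>

primrec tower :: "'a monoid \<Rightarrow> nat \<Rightarrow> nat monoid" where
  "tower G 0 = nat_copy G"
| "tower G (Suc n) = nat_copy (ray_group (tower G n))"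

definition tower_step :: "'a monoid \<Rightarrow> nat \<Rightarrow> nat \<Rightarrow> nat" where
  "tower_step G n = to_nat_on (carrier (ray_group (tower G n))) \<circ> ray_embed (tower G n)"

text \<open>The recursion is on the number of steps climbed from level \<open>i\<close>; the map
  from level \<open>i\<close> to level \<open>j\<close> uses \<open>j - i\<close> steps.\<close>

primrec tower_up :: "'a monoid \<Rightarrow> nat \<Rightarrow> nat \<Rightarrow> nat \<Rightarrow> nat" where
  "tower_up G i 0 x = x"
| "tower_up G i (Suc k) x = tower_step G (i + k) (tower_up G i k x)"

lemma tower_up_add: "tower_up G i (a + b) x = tower_up G (i + a) b (tower_up G i a x)"
  by (induction b) (simp_all add: add.assoc)

lemma commutator_hom:
  assumes "group_hom G H h" "u \<in> carrier G" "v \<in> carrier G"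
  shows "h (u \<otimes>\<^bsub>G\<^esub> v \<otimes>\<^bsub>G\<^esub> inv\<^bsub>G\<^esub> u \<otimes>\<^bsub>G\<^esub> inv\<^bsub>G\<^esub> v) =
    h u \<otimes>\<^bsub>H\<^esub> h v \<otimes>\<^bsub>H\<^esub> inv\<^bsub>H\<^esub> h u \<otimes>\<^bsub>H\<^esub> inv\<^bsub>H\<^esub> h v"
proof -
  interpret group_hom G H h by fact
  show ?thesis using assms(2,3) by simp
qed

locale group_tower =
  fixes G :: "'a monoid"
  assumes group_G: "group G" and countable_G: "countable (carrier G)"
begin

lemma tower_group: "group (tower G n)"
  by (induction n)
    (simp_all add: nat_copy_group[OF group_G countable_G] nat_copy_group ray_group_group countable_ray_group
      del: ray_group_simps(1))

lemma copy_ray_tower_iso: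
  "to_nat_on (carrier (ray_group (tower G n))) \<in> iso (ray_group (tower G n)) (tower G (Suc n))"
  by (simp add: nat_copy_iso ray_group_group[OF tower_group] countable_ray_group[OF tower_group]
      del: ray_group_simps)

lemma tower_step_hom: "tower_step G n \<in> hom (tower G n) (tower G (Suc n))"
  unfolding tower_step_def
  by (rule Group.hom_compose[OF ray_embed_hom[OF tower_group]])
    (use copy_ray_tower_iso in \<open>simp add: iso_def\<close>)

lemma tower_step_inj: "inj_on (tower_step G n) (carrier (tower G n))"
  unfolding tower_step_def
proof (rule comp_inj_on[OF ray_embed_inj[OF tower_group]])
  have "ray_embed (tower G n) ` carrier (tower G n) \<subseteq> carrier (ray_group (tower G n))"
    by (rule hom_carrier[OF ray_embed_hom[OF tower_group]])
  then show "inj_on (to_nat_on (carrier (ray_group (tower G n)))) (ray_embed (tower G n) ` carrier (tower G n))"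
    using copy_ray_tower_iso[of n] inj_on_subset by (fastforce simp: iso_def bij_betw_def)
qed

lemma tower_step_commutator:
  assumes "x \<in> carrier (tower G n)"
  shows "\<exists>u\<in>carrier (tower G (Suc n)). \<exists>v\<in>carrier (tower G (Suc n)).
    tower_step G n x = u \<otimes>\<^bsub>tower G (Suc n)\<^esub> v \<otimes>\<^bsub>tower G (Suc n)\<^esub>
      inv\<^bsub>tower G (Suc n)\<^esub> u \<otimes>\<^bsub>tower G (Suc n)\<^esub> inv\<^bsub>tower G (Suc n)\<^esub> v"
proof -
  let ?W = "ray_group (tower G n)" and ?e = "to_nat_on (carrier (ray_group (tower G n)))"
  have e: "?e \<in> hom ?W (tower G (Suc n))" using copy_ray_tower_iso by (simp add: iso_def)
  have gh: "group_hom ?W (tower G (Suc n)) ?e"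
    by (rule group_homI[OF ray_group_group[OF tower_group] tower_group e])
  obtain u v where uv: "u \<in> carrier ?W" "v \<in> carrier ?W"
    "ray_embed (tower G n) x = u \<otimes>\<^bsub>?W\<^esub> v \<otimes>\<^bsub>?W\<^esub> inv\<^bsub>?W\<^esub> u \<otimes>\<^bsub>?W\<^esub> inv\<^bsub>?W\<^esub> v"
    using ray_embed_commutator[OF tower_group assms] by blast
  have "?e u \<in> carrier (tower G (Suc n))" "?e v \<in> carrier (tower G (Suc n))"
    using hom_in_carrier[OF e] uv(1,2) by blast+
  moreover have "tower_step G n x = ?e u \<otimes>\<^bsub>tower G (Suc n)\<^esub> ?e v \<otimes>\<^bsub>tower G (Suc n)\<^esub>
      inv\<^bsub>tower G (Suc n)\<^esub> ?e u \<otimes>\<^bsub>tower G (Suc n)\<^esub> inv\<^bsub>tower G (Suc n)\<^esub> ?e v"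
    using commutator_hom[OF gh uv(1,2)] uv(3) by (simp only: tower_step_def comp_apply)
  ultimately show ?thesis by blast
qed

lemma tower_up_hom: "tower_up G i k \<in> hom (tower G i) (tower G (i + k))"
proof (induction k)
  case 0
  then show ?case by (simp add: hom_def)
next
  case (Suc k)
  have eq: "tower_up G i (Suc k) = tower_step G (i + k) \<circ> tower_up G i k" by (simp add: fun_eq_iff)
  show ?case unfolding eq add_Suc_right by (rule Group.hom_compose[OF Suc tower_step_hom])
qed

lemma tower_up_inj: "inj_on (tower_up G i k) (carrier (tower G i))"
proof (induction k)
  case 0
  then show ?case by (simp add: inj_on_def)
next
  case (Suc k)
  have eq: "tower_up G i (Suc k) = tower_step G (i + k) \<circ> tower_up G i k" by (simp add: fun_eq_iff)
  show ?case
    unfolding eq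
    by (rule comp_inj_on[OF Suc inj_on_subset[OF tower_step_inj hom_carrier[OF tower_up_hom]]])
qed

text \<open>Only pairs with \<open>i \<le> j\<close> are related, so truncated subtraction gives the
  true number of steps.\<close>

sublocale direct_sys UNIV "{(i, j). i \<le> j}" "tower G" "\<lambda>i j. tower_up G i (j - i)"
proof
  have "tower_up G i (j - i) \<in> hom (tower G i) (tower G j)" if "i \<le> j" for i j
    using tower_up_hom[of i "j - i"] that by simp
  moreover have "tower_up G j (k - j) (tower_up G i (j - i) x) = tower_up G i (k - i) x"
    if "i \<le> j" "j \<le> k" for i j k x
    using tower_up_add[of G i "j - i" "k - j" x] that by simp
  moreover have "\<exists>k\<ge>i. j \<le> k" for i j :: nat by (metis linear)
  ultimately show "directed_system UNIV {(i, j). i \<le> j} (tower G) (\<lambda>i j. tower_up G i (j - i))"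
    unfolding directed_system_def preorder_on_def refl_on_def trans_def by (auto simp: tower_group)
qed

lemma cl_inj: "inj_on (cl n) (carrier (tower G n))"
proof (rule inj_onI)
  fix x y assume xy: "x \<in> carrier (tower G n)" "y \<in> carrier (tower G n)" "cl n x = cl n y"
  then obtain k where "tower_up G n (k - n) x = tower_up G n (k - n) y"
    using cl_eqE[OF xy(3) _ _ xy(1,2)] by blast
  then show "x = y" using inj_onD[OF tower_up_inj] xy(1,2) by blast
qed

lemma cl_step: "x \<in> carrier (tower G n) \<Longrightarrow> cl (Suc n) (tower_step G n x) = cl n x"
  using cl_map[of n "Suc n" x] by simp

lemma countable_DL: "countable (carrier DL)"
proof -
  have "carrier DL \<subseteq> (\<lambda>(i, x). cl i x) ` UNIV" unfolding carrier_DL by auto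
  then show ?thesis by (rule countable_subset) simp
qed

text \<open>An element represented at level \<open>n\<close> is also represented at level
  \<open>n + 1\<close>, where it is a commutator.\<close>

lemma perfect_DL: "derived DL (carrier DL) = carrier DL"
proof
  interpret DL: group DL by (rule group_DL)
  show "derived DL (carrier DL) \<subseteq> carrier DL" by (rule DL.derived_in_carrier) simp
  show "carrier DL \<subseteq> derived DL (carrier DL)"
  proof
    fix y assume "y \<in> carrier DL"
    then obtain n x where x: "x \<in> carrier (tower G n)" "y = cl n x" unfolding carrier_DL by blast
    obtain u v where uv: "u \<in> carrier (tower G (Suc n))" "v \<in> carrier (tower G (Suc n))"
      "tower_step G n x = u \<otimes>\<^bsub>tower G (Suc n)\<^esub> v \<otimes>\<^bsub>tower G (Suc n)\<^esub>
        inv\<^bsub>tower G (Suc n)\<^esub> u \<otimes>\<^bsub>tower G (Suc n)\<^esub> inv\<^bsub>tower G (Suc n)\<^esub> v"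
      using tower_step_commutator[OF x(1)] by blast
    have gh: "group_hom (tower G (Suc n)) DL (cl (Suc n))"
      by (rule group_homI[OF tower_group group_DL cl_hom]) simp
    have c: "cl (Suc n) u \<in> carrier DL" "cl (Suc n) v \<in> carrier DL"
      using cl_carrier uv(1,2) by auto
    have "y = cl (Suc n) (tower_step G n x)" using cl_step x by simp
    then have "y = cl (Suc n) u \<otimes>\<^bsub>DL\<^esub> cl (Suc n) v \<otimes>\<^bsub>DL\<^esub> inv\<^bsub>DL\<^esub> cl (Suc n) u \<otimes>\<^bsub>DL\<^esub> inv\<^bsub>DL\<^esub> cl (Suc n) v"
      using commutator_hom[OF gh uv(1,2)] uv(3) by (simp only:)
    then have "y \<in> derived_set DL (carrier DL)" using c by blast
    then show "y \<in> derived DL (carrier DL)" unfolding derived_def by (rule generate.incl)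
  qed
qed

end

text \<open>The limit is the increasing union of the images of the levels, each isomorphic to its
  level since the connecting maps are injective. Passage to the shift extension is a hypothesis, so
  that orderability is covered too.\<close>

lemma (in union_closed_class) copy_tower_limit:
  assumes "group G" "countable (carrier G)" "P (nat_copy G)"
    and step: "\<And>M. group M \<Longrightarrow> P M \<Longrightarrow> P (nat_copy (ray_group M))"
  shows "P (nat_copy (direct_limit UNIV {(i, j). i \<le> j} (tower G) (\<lambda>i j. tower_up G i (j - i))))"
proof -
  interpret group_tower G by (rule group_tower.intro[OF assms(1,2)])
  have PT: "P (tower G n)" for n
    by (induction n) (use assms(3) step[OF tower_group] in auto)
  let ?K = "\<lambda>n. cl n ` carrier (tower G n)"
  have "has_copy P DL"
  proof (rule copy_union[OF group_DL, where K = ?K])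
    show sK: "subgroup (?K n) DL" for n
      by (rule group_hom.img_is_subgroup[OF group_homI[OF tower_group group_DL cl_hom]]) simp
    show "incseq ?K"
    proof (rule incseq_SucI)
      fix n show "?K n \<subseteq> ?K (Suc n)"
        using cl_step[symmetric] hom_in_carrier[OF tower_step_hom] by blast
    qed
    show "(\<Union>n. ?K n) = carrier DL" unfolding carrier_DL by auto
    show "has_copy P (DL\<lparr>carrier := ?K n\<rparr>)" for n
    proof (rule copy_iso)
      show "has_copy P (tower G n)" using PT copy_nat[OF tower_group] by blast
      show "group (DL\<lparr>carrier := ?K n\<rparr>)" by (rule group.subgroup_imp_group[OF group_DL sK])
      show "tower G n \<cong> DL\<lparr>carrier := ?K n\<rparr>"
        by (rule is_isoI[OF mon_iso_image[OF cl_hom cl_inj]]) simp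
    qed
  qed
  then show ?thesis by (rule has_copyD(3))
qed

section \<open>The seven properties, and the embedding\<close>

text \<open>Five of the properties are visibly invariant under isomorphisms between different types.
  The two closure classes depend on the type on which derivations take place, so they rely on the
  rebuilt derivations.\<close>

lemma has_property_copy:
  assumes "group G" "countable (carrier G)" "has_property G p"
  shows "has_property (nat_copy G) p"
  using assms
    torsion_free_iso[OF assms(1) nat_copy_group nat_copy_is_iso]
    locally_indicable_iso[OF assms(1) nat_copy_group nat_copy_is_iso]
    amenable_iso[OF assms(1) nat_copy_group nat_copy_is_iso]
    right_orderable_iso[OF assms(1) nat_copy_group nat_copy_is_iso]
    orderable_iso[OF assms(1) nat_copy_group nat_copy_is_iso]
    elementary_amenable_copy[of G] subexponentially_amenable_copy[of G]
  by (cases p) auto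

lemma has_property_extension_closed:
  assumes "p \<noteq> Orderable"
  shows "extension_closed_class (\<lambda>M. has_property M p)"
proof (cases p)
  case Elementary_Amenable
  then show ?thesis
    using elementary_closure.extension_closed_class_axioms by (simp add: elementary_amenable_def)
next
  case Subexponentially_Amenable
  then show ?thesis
    using elementary_closure.extension_closed_class_axioms by (simp add: subexponentially_amenable_def)
qed (use assms torsion_free.extension_closed_class_axioms locally_indicable.extension_closed_class_axioms
    amenable.extension_closed_class_axioms right_orderable.extension_closed_class_axioms in simp_all)

lemma has_property_union_closed: "union_closed_class (\<lambda>M. has_property M p)"
  using has_property_extension_closed[of p] extension_closed_class.axioms(1)
    orderable.union_closed_class_axioms by (cases "p = Orderable") auto

lemma has_property_integers: "p \<noteq> Orderable \<Longrightarrow> has_property integer_group p"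
  by (cases p) (simp_all add: torsion_free_integers locally_indicable_integers amenable_integers
      elementary_amenable_integers subexponentially_amenable_integers right_orderable_integers)

lemma has_property_ray_group:
  fixes M :: "nat monoid"
  assumes "group M" "has_property M p"
  shows "has_property (nat_copy (ray_group M)) p"
proof (cases "p = Orderable")
  case True
  then show ?thesis
    using has_property_copy[OF ray_group_group[OF assms(1)] countable_ray_group[OF assms(1)], of Orderable]
      orderable_ray_group[OF assms(1)] assms(2) by simp
next
  case False
  interpret extension_closed_class "\<lambda>M. has_property M p" by (rule has_property_extension_closed[OF False])
  have "has_copy (\<lambda>M. has_property M p) M" using copy_nat assms by blast
  moreover have "has_copy (\<lambda>M. has_property M p) integer_group"
    unfolding has_copy_def using has_property_copy[OF _ _ has_property_integers[OF False]] by simp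
  ultimately show ?thesis using copy_ray_group has_copyD(3) by blast
qed

theorem theorem3p1:
  fixes D :: "group_property set" and G :: "'a monoid"
  assumes "group G" and "countable (carrier G)"
    and "\<forall>P\<in>D. has_property G P"
  shows "\<exists>H :: nat monoid.
           group H \<and> countable (carrier H) \<and> perfect_group H \<and>
           (\<forall>P\<in>D. has_property H P) \<and> (\<exists>f. f \<in> mon G H)"
proof -
  interpret group_tower G by (rule group_tower.intro[OF assms(1,2)])
  let ?H = "nat_copy DL" and ?e = "to_nat_on (carrier DL)"
  have gH: "group ?H" by (rule nat_copy_group[OF group_DL countable_DL])
  have e: "?e \<in> iso DL ?H" by (rule nat_copy_iso[OF group_DL countable_DL])
  then have e': "?e \<in> hom DL ?H" "inj_on ?e (carrier DL)" "?e ` carrier DL = carrier ?H"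
    by (auto simp: iso_def bij_betw_def)
  \<comment> \<open>Surjective homomorphisms carry derived subgroups onto derived subgroups.\<close>
  have "derived ?H (carrier ?H) = carrier ?H"
    using group_hom.derived_img[OF group_homI[OF group_DL gH e'(1)], of "carrier DL"] perfect_DL e'(3) by simp
  then have "perfect_group ?H" using gH by (simp add: perfect_group_def)
  moreover have "has_property ?H P" if "P \<in> D" for P
    by (rule union_closed_class.copy_tower_limit[OF has_property_union_closed assms(1,2)])
      (use has_property_copy[OF assms(1,2)] assms(3) that has_property_ray_group in blast)+
  moreover have "\<exists>f. f \<in> mon G ?H"
  proof -
    have "to_nat_on (carrier G) \<in> mon G (tower G 0)"
      using nat_copy_iso[OF assms(1,2)] by (simp add: iso_iff_mon_epi)
    moreover have "cl 0 \<in> mon (tower G 0) DL"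
      using cl_hom[of 0] cl_inj[of 0] by (simp add: mon_def)
    moreover have "?e \<in> mon DL ?H" using e by (simp add: iso_iff_mon_epi)
    \<comment> \<open>The embedding is the copy of \<open>G\<close> at level \<open>0\<close>,
      followed by the canonical map into the limit and the enumeration of the limit.\<close>
    ultimately show ?thesis by (intro exI) (rule mon_compose[OF mon_compose])
  qed
  ultimately show ?thesis using gH by (intro exI[of _ ?H]) (simp add: countableI_type)
qed

end
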